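(* Let $d\in\mathbb{N}$ and let $M\colon\mathbb{R}^d\to\mathbb{R}^d$, $M(x_1,\dots,x_d)=(-x_1,x_2,\dots,x_d)$. Let $\tilde\Omega\subset\mathbb{R}^d$ be open with $M(\tilde\Omega)=\tilde\Omega$ and $\Gamma:=\tilde\Omega\cap(\{0\}\times\mathbb{R}^{d-1})\neq\emptyset$, and set $\Omega:=\tilde\Omega\cap((0,+\infty)\times\mathbb{R}^{d-1})$. Let $A\colon\Omega\to\mathbb{R}^{d\times d}$ be measurable with $A(x)$ symmetric for a.e. $x\in\Omega$, and suppose there are $\theta_1,\theta_2>0$ such that $\theta_1\|\xi\|_{\mathbb{C}^d}^2\le\langle A(x)\xi,\xi\rangle_{\mathbb{C}^d}\le\theta_2\|\xi\|_{\mathbb{C}^d}^2$ for all $\xi\in\mathbb{C}^d$ and a.e. $x\in\Omega$. Let $V\in L^\infty(\Omega)$ be real-valued. Let $U:=\operatorname{diag}(-1,1,\dots,1)$ and let $\tilde A\colon\tilde\Omega\to\mathbb{R}^{d\times d}$ and $\tilde V\colon\tilde\Omega\to\mathbb{R}$ be measurable with $\tilde A(x)=A(x)$, $\tilde V(x)=V(x)$ for $x\in\Omega$ and $\tilde A(x)=U\,A(M(x))\,U$, $\tilde V(x)=V(M(x))$ for $x\in M(\Omega)$. Let $\omega\subset\Omega$ be measurable, $\tilde\omega:=\omega\cup M(\omega)$, $\bullet\in\{D,N\}$, and $T>0$. If the system $$\partial_t\tilde u(t)+H^\bullet_{\tilde\Omega}(\tilde A,\tilde V)\tilde u(t)=\chi_{\tilde\omega}\tilde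 v(t)\quad(0<t<T),\qquad \tilde u(0)=\tilde u_0\in L^2(\tilde\Omega),$$ is null-controllable in time $T$ with control cost $\tilde C_T$, then the system $$\partial_t u(t)+H^\bullet_{\Omega}(A,V)u(t)=\chi_{\omega}v(t)\quad(0<t<T),\qquad u(0)=u_0\in L^2(\Omega),$$ is also null-controllable in time $T$ with control cost $C_T\le\tilde C_T$.
   Context: For an open set $\Omega\subset\mathbb{R}^d$, a measurable, a.e. symmetric, uniformly elliptic and bounded matrix function $A$ (as in the claim) and a real-valued $V\in L^\infty(\Omega)$, $H_\Omega^D(A,V)$ and $H_\Omega^N(A,V)$ denote the Dirichlet and Neumann realizations of $-\nabla\cdot(A\nabla)+V$, i.e. the lower semibounded self-adjoint operators on $L^2(\Omega)$ associated (via the first representation theorem) with the closed, densely defined, lower semibounded form $$\mathfrak{h}[f,g]=\int_\Omega\langle A(x)\nabla f(x),\nabla g(x)\rangle_{\mathbb{C}^d}\,dx+\langle Vf,g\rangle_{L^2(\Omega)}$$ with form domain $H_0^1(\Omega)$ (case $D$), respectively $H^1(\Omega)$ (case $N$). The operators on $\tilde\Omega$ are defined in the same way. Null-controllability: Let $\chi_\omega$ be the characteristic function of the measurable set $\omega\subset\Omega$ and $H=H^\bullet_\Omega(A,V)$. The system $\partial_tu+Hu=\chi_\omega v$, $u(0)=u_0$, is null-controllable in time $T>0$ if for every $u_0\in L^2(\Omega)$ there exists $v\in L^2((0,T),L^2(\Omega))$ such that $$(\ast)\qquad e^{-TH}u_0+\int_0^Te^{-(T-s)H}\chi_\omega v(s)\,ds=0\quad\text{in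 }L^2(\Omega).$$ In this case its control cost is $C_T:=\sup_{\|u_0\|_{L^2(\Omega)}=1}\inf\{\|v\|_{L^2((0,T),L^2(\omega))}\colon v\text{ satisfies }(\ast)\}$. The same notions are used for the system on $\tilde\Omega$ with $\tilde\omega$. *)

theory Defs
  imports "HOL-Analysis.Analysis"
begin

section \<open>The Hilbert space \<open>L\<^sup>2(\<real>\<^sup>d; \<complex>)\<close>\<close>

definition sq_integrable :: "('a::euclidean_space \<Rightarrow> complex) \<Rightarrow> bool" where
  "sq_integrable f \<longleftrightarrow>
     f \<in> borel_measurable lebesgue \<and> integrable lebesgue (\<lambda>x. (cmod (f x))\<^sup>2)"

lemma sq_integrable_measurable [measurable_dest]:
  "sq_integrable f \<Longrightarrow> f \<in> borel_measurable lebesgue"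
  by (simp add: sq_integrable_def)

lemma sq_integrableD: "sq_integrable f \<Longrightarrow> integrable lebesgue (\<lambda>x. (cmod (f x))\<^sup>2)"
  by (simp add: sq_integrable_def)

lemma sq_integrable_dominated:
  assumes "sq_integrable g" "f \<in> borel_measurable lebesgue"
    and "AE x in lebesgue. cmod (f x) \<le> C * cmod (g x)"
  shows "sq_integrable f"
  unfolding sq_integrable_def
proof
  have "integrable lebesgue (\<lambda>x. C\<^sup>2 * (cmod (g x))\<^sup>2)"
    using assms(1) by (auto dest: sq_integrableD)
  moreover have "(\<lambda>x. (cmod (f x))\<^sup>2) \<in> borel_measurable lebesgue"
    using assms(2) by measurable
  moreover have "AE x in lebesgue. norm ((cmod (f x))\<^sup>2) \<le> norm (C\<^sup>2 * (cmod (g x))\<^sup>2)"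
    using assms(3)
  proof eventually_elim
    case (elim x)
    then have "(cmod (f x))\<^sup>2 \<le> (C * cmod (g x))\<^sup>2" by (intro power_mono) auto
    then show ?case by (simp add: power_mult_distrib)
  qed
  ultimately show "integrable lebesgue (\<lambda>x. (cmod (f x))\<^sup>2)"
    by (rule Bochner_Integration.integrable_bound)
qed (rule assms(2))

lemma sq_integrable_add:
  assumes "sq_integrable f" "sq_integrable g"
  shows "sq_integrable (\<lambda>x. f x + g x)"
  unfolding sq_integrable_def
proof
  note [measurable] = sq_integrable_measurable[OF assms(1)] sq_integrable_measurable[OF assms(2)]
  show "(\<lambda>x. f x + g x) \<in> borel_measurable lebesgue" by measurable
  have "integrable lebesgue (\<lambda>x. 2 * (cmod (f x))\<^sup>2 + 2 * (cmod (g x))\<^sup>2)"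
    by (intro Bochner_Integration.integrable_add integrable_mult_right sq_integrableD assms)
  moreover have "(\<lambda>x. (cmod (f x + g x))\<^sup>2) \<in> borel_measurable lebesgue" by measurable
  moreover have "norm ((cmod (f x + g x))\<^sup>2) \<le> norm (2 * (cmod (f x))\<^sup>2 + 2 * (cmod (g x))\<^sup>2)" for x
  proof -
    have "(cmod (f x + g x))\<^sup>2 \<le> (cmod (f x) + cmod (g x))\<^sup>2"
      by (intro power_mono norm_triangle_ineq) auto
    moreover have "0 \<le> (cmod (f x) - cmod (g x))\<^sup>2" by simp
    ultimately show ?thesis by (simp add: power2_sum power2_diff)
  qed
  ultimately show "integrable lebesgue (\<lambda>x. (cmod (f x + g x))\<^sup>2)"
    by (auto intro: Bochner_Integration.integrable_bound)
qed

lemma sq_integrable_cmult: "sq_integrable f \<Longrightarrow> sq_integrable (\<lambda>x. c * f x)"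
  by (rule sq_integrable_dominated[where g = f and C = "cmod c"])
     (auto simp: norm_mult dest: sq_integrable_measurable)

lemma sq_integrable_scaleR: "sq_integrable f \<Longrightarrow> sq_integrable (\<lambda>x. r *\<^sub>R f x)"
  using sq_integrable_cmult[of f "complex_of_real r"] by (simp add: scaleR_conv_of_real)

lemma sq_integrable_uminus: "sq_integrable f \<Longrightarrow> sq_integrable (\<lambda>x. - f x)"
  using sq_integrable_cmult[of f "-1"] by simp

lemma sq_integrable_diff:
  "sq_integrable f \<Longrightarrow> sq_integrable g \<Longrightarrow> sq_integrable (\<lambda>x. f x - g x)"
  using sq_integrable_add[of f "\<lambda>x. - g x"] sq_integrable_uminus[of g] by simp

lemma sq_integrable_0: "sq_integrable (\<lambda>x. 0)"
  by (simp add: sq_integrable_def)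

lemma l2_norm_triangle_aux:
  assumes f: "sq_integrable f" and g: "sq_integrable g"
  shows "sqrt (LINT x|lebesgue. (cmod (f x + g x))\<^sup>2) \<le>
    sqrt (LINT x|lebesgue. (cmod (f x))\<^sup>2) + sqrt (LINT x|lebesgue. (cmod (g x))\<^sup>2)"
proof -
  note [measurable] = sq_integrable_measurable[OF f] sq_integrable_measurable[OF g]
  define A where "A = sqrt (LINT x|lebesgue. (cmod (f x))\<^sup>2)"
  define B where "B = sqrt (LINT x|lebesgue. (cmod (g x))\<^sup>2)"
  have nn: "A \<ge> 0" "B \<ge> 0" unfolding A_def B_def by auto
  have A2: "(LINT x|lebesgue. (cmod (f x))\<^sup>2) = A\<^sup>2"
    and B2: "(LINT x|lebesgue. (cmod (g x))\<^sup>2) = B\<^sup>2" unfolding A_def B_def by auto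
  have fi: "integrable lebesgue (\<lambda>x. (cmod (f x))\<^sup>2)" and gi: "integrable lebesgue (\<lambda>x. (cmod (g x))\<^sup>2)"
    using f g by (auto dest: sq_integrableD)
  have "(LINT x|lebesgue. (cmod (f x + g x))\<^sup>2) \<le> (A + B)\<^sup>2"
  proof (cases "A = 0 \<or> B = 0")
    case True
    then show ?thesis
    proof
      assume "A = 0"
      then have "(LINT x|lebesgue. (cmod (f x))\<^sup>2) = 0" using A2 by simp
      then have "AE x in lebesgue. (cmod (f x))\<^sup>2 = 0"
        using integral_nonneg_eq_0_iff_AE[OF fi] by simp
      then have "(LINT x|lebesgue. (cmod (f x + g x))\<^sup>2) = (LINT x|lebesgue. (cmod (g x))\<^sup>2)"
        by (intro integral_cong_AE) (auto elim: eventually_mono)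
      then show ?thesis using B2 \<open>A = 0\<close> by simp
    next
      assume "B = 0"
      then have "(LINT x|lebesgue. (cmod (g x))\<^sup>2) = 0" using B2 by simp
      then have "AE x in lebesgue. (cmod (g x))\<^sup>2 = 0"
        using integral_nonneg_eq_0_iff_AE[OF gi] by simp
      then have "(LINT x|lebesgue. (cmod (f x + g x))\<^sup>2) = (LINT x|lebesgue. (cmod (f x))\<^sup>2)"
        by (intro integral_cong_AE) (auto elim: eventually_mono)
      then show ?thesis using A2 \<open>B = 0\<close> by simp
    qed
  next
    case False
    then have pos: "A > 0" "B > 0" using nn by auto
    have pw: "(cmod (f x + g x))\<^sup>2 \<le> (1 + B / A) * (cmod (f x))\<^sup>2 + (1 + A / B) * (cmod (g x))\<^sup>2" for x
    proof -
      have "(cmod (f x + g x))\<^sup>2 \<le> (cmod (f x) + cmod (g x))\<^sup>2"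
        by (intro power_mono norm_triangle_ineq) auto
      moreover have "0 \<le> (B * cmod (f x) - A * cmod (g x))\<^sup>2 / (A * B)" using pos by simp
      moreover have "(B * cmod (f x) - A * cmod (g x))\<^sup>2 / (A * B) =
          B / A * (cmod (f x))\<^sup>2 + A / B * (cmod (g x))\<^sup>2 - 2 * cmod (f x) * cmod (g x)"
        using pos by (simp add: field_simps power2_eq_square)
      ultimately show ?thesis by (simp add: power2_sum algebra_simps)
    qed
    have "(LINT x|lebesgue. (cmod (f x + g x))\<^sup>2) \<le>
      (LINT x|lebesgue. (1 + B / A) * (cmod (f x))\<^sup>2 + (1 + A / B) * (cmod (g x))\<^sup>2)"
      using fi gi sq_integrableD[OF sq_integrable_add[OF f g]] pw by (intro integral_mono) auto
    also have "\<dots> = (1 + B / A) * A\<^sup>2 + (1 + A / B) * B\<^sup>2"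
      using fi gi A2 B2 by simp
    also have "\<dots> = (A + B)\<^sup>2"
      using pos by (simp add: field_simps power2_eq_square)
    finally show ?thesis .
  qed
  then show ?thesis
    unfolding A_def[symmetric] B_def[symmetric] using nn by (intro real_le_lsqrt) auto
qed

quotient_type (overloaded) 'a l2 = "'a::euclidean_space \<Rightarrow> complex" /
  partial: "\<lambda>f g. sq_integrable f \<and> sq_integrable g \<and> (AE x in lebesgue. f x = g x)"
proof (rule part_equivpI)
  show "\<exists>f :: 'a \<Rightarrow> complex. sq_integrable f \<and> sq_integrable f \<and> (AE x in lebesgue. f x = f x)"
    using sq_integrable_0 by auto
qed (auto intro!: sympI transpI elim: eventually_elim2)

instantiation l2 :: (euclidean_space) real_vector
begin
lift_definition zero_l2 :: "'a l2" is "\<lambda>x. 0" by (simp add: sq_integrable_0)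
lift_definition plus_l2 :: "'a l2 \<Rightarrow> 'a l2 \<Rightarrow> 'a l2" is "\<lambda>f g x. f x + g x"
  by (auto intro: sq_integrable_add elim: eventually_elim2)
lift_definition minus_l2 :: "'a l2 \<Rightarrow> 'a l2 \<Rightarrow> 'a l2" is "\<lambda>f g x. f x - g x"
  by (auto intro: sq_integrable_diff elim: eventually_elim2)
lift_definition uminus_l2 :: "'a l2 \<Rightarrow> 'a l2" is "\<lambda>f x. - f x"
  by (auto intro: sq_integrable_uminus elim: eventually_mono)
lift_definition scaleR_l2 :: "real \<Rightarrow> 'a l2 \<Rightarrow> 'a l2" is "\<lambda>r f x. r *\<^sub>R f x"
  by (auto intro: sq_integrable_scaleR elim: eventually_mono)
instance
  by standard (transfer; auto simp: algebra_simps intro!: sq_integrable_add sq_integrable_scaleR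
      sq_integrable_uminus sq_integrable_diff sq_integrable_0)+
end

instantiation l2 :: (euclidean_space) real_normed_vector
begin
lift_definition norm_l2 :: "'a l2 \<Rightarrow> real" is "\<lambda>f. sqrt (LINT x|lebesgue. (cmod (f x))\<^sup>2)"
proof -
  fix f g :: "'a \<Rightarrow> complex"
  assume *: "sq_integrable f \<and> sq_integrable g \<and> (AE x in lebesgue. f x = g x)"
  then have [measurable]: "f \<in> borel_measurable lebesgue" "g \<in> borel_measurable lebesgue"
    by (auto dest: sq_integrable_measurable)
  show "sqrt (LINT x|lebesgue. (cmod (f x))\<^sup>2) = sqrt (LINT x|lebesgue. (cmod (g x))\<^sup>2)"
    using * by (intro arg_cong[where f = sqrt] integral_cong_AE) (auto elim: eventually_mono)
qed
definition dist_l2 :: "'a l2 \<Rightarrow> 'a l2 \<Rightarrow> real" where "dist_l2 f g = norm (f - g)"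
definition sgn_l2 :: "'a l2 \<Rightarrow> 'a l2" where "sgn_l2 f = f /\<^sub>R norm f"
definition uniformity_l2 :: "('a l2 \<times> 'a l2) filter"
  where [code del]: "uniformity_l2 = (INF e\<in>{0<..}. principal {(x, y). dist x y < e})"
definition open_l2 :: "'a l2 set \<Rightarrow> bool"
  where [code del]: "open_l2 S = (\<forall>x\<in>S. \<forall>\<^sub>F (x', y) in uniformity. x' = x \<longrightarrow> y \<in> S)"
instance
proof
  fix f g :: "'a l2" and r :: real
  show "norm f = 0 \<longleftrightarrow> f = 0"
  proof transfer
    fix f :: "'a \<Rightarrow> complex"
    assume "sq_integrable f \<and> sq_integrable f \<and> (AE x in lebesgue. f x = f x)"
    then have f: "sq_integrable f" by simp
    show "sqrt (LINT x|lebesgue. (cmod (f x))\<^sup>2) = 0 \<longleftrightarrow>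
      sq_integrable f \<and> sq_integrable (\<lambda>x::'a. 0) \<and> (AE x in lebesgue. f x = 0)"
      using integral_nonneg_eq_0_iff_AE[OF sq_integrableD[OF f]] f by (simp add: sq_integrable_0)
  qed
  show "norm (f + g) \<le> norm f + norm g"
    by transfer (simp add: l2_norm_triangle_aux)
  show "norm (r *\<^sub>R f) = \<bar>r\<bar> * norm f"
    by transfer (simp add: power_mult_distrib real_sqrt_mult)
qed (simp_all add: dist_l2_def sgn_l2_def uniformity_l2_def open_l2_def)
end

text \<open>A square-integrable representative of an element, and the class of a function
  (by convention \<open>0\<close> if the function is not square-integrable).\<close>

definition l2_fun :: "'a::euclidean_space l2 \<Rightarrow> 'a \<Rightarrow> complex" where
  "l2_fun = rep_l2"

definition to_l2 :: "('a::euclidean_space \<Rightarrow> complex) \<Rightarrow> 'a l2" where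
  "to_l2 f = (if sq_integrable f then abs_l2 f else 0)"

lemma sq_integrable_l2_fun: "sq_integrable (l2_fun f)"
  using Quotient_rep_reflp[OF Quotient_l2] by (auto simp: l2_fun_def)

lemma to_l2_l2_fun [simp]: "to_l2 (l2_fun f) = f"
  using sq_integrable_l2_fun[of f] Quotient_abs_rep[OF Quotient_l2, of f]
  by (simp add: to_l2_def l2_fun_def)

lemma to_l2_eq_iff:
  "sq_integrable f \<Longrightarrow> sq_integrable g \<Longrightarrow> to_l2 f = to_l2 g \<longleftrightarrow> (AE x in lebesgue. f x = g x)"
  using Quotient_rel_abs2[OF Quotient_l2] Quotient_rel[OF Quotient_l2, of f g]
  by (auto simp: to_l2_def)

lemma l2_fun_to_l2: "sq_integrable f \<Longrightarrow> AE x in lebesgue. l2_fun (to_l2 f) x = f x"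
  using to_l2_eq_iff[OF sq_integrable_l2_fun[of "to_l2 f"], of f] by simp

lemma to_l2_add: "sq_integrable f \<Longrightarrow> sq_integrable g \<Longrightarrow> to_l2 (\<lambda>x. f x + g x) = to_l2 f + to_l2 g"
  by (simp add: to_l2_def sq_integrable_add plus_l2.abs_eq)

lemma to_l2_diff: "sq_integrable f \<Longrightarrow> sq_integrable g \<Longrightarrow> to_l2 (\<lambda>x. f x - g x) = to_l2 f - to_l2 g"
  by (simp add: to_l2_def sq_integrable_diff minus_l2.abs_eq)

lemma to_l2_scaleR: "sq_integrable f \<Longrightarrow> to_l2 (\<lambda>x. r *\<^sub>R f x) = r *\<^sub>R to_l2 f"
  by (simp add: to_l2_def sq_integrable_scaleR scaleR_l2.abs_eq)

lemma to_l2_0 [simp]: "to_l2 (\<lambda>x. 0) = 0"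
  by (simp add: to_l2_def zero_l2_def)

lemma norm_to_l2: "sq_integrable f \<Longrightarrow> norm (to_l2 f) = sqrt (LINT x|lebesgue. (cmod (f x))\<^sup>2)"
  by (simp add: to_l2_def norm_l2.abs_eq)

lemma norm_l2_eq: "norm f = sqrt (LINT x|lebesgue. (cmod (l2_fun f x))\<^sup>2)"
  using norm_to_l2[OF sq_integrable_l2_fun[of f]] by simp

lemma to_l2_dominated_convergence:
  assumes w: "sq_integrable w" and f: "f \<in> borel_measurable lebesgue"
    and s: "\<And>i. s i \<in> borel_measurable lebesgue"
    and lim: "AE x in lebesgue. (\<lambda>i. s i x) \<longlonglongrightarrow> f x"
    and bound: "\<And>i. AE x in lebesgue. cmod (s i x) \<le> C * cmod (w x)"
  shows "sq_integrable f" "\<And>i. sq_integrable (s i)" "(\<lambda>i. to_l2 (s i)) \<longlonglongrightarrow> to_l2 f"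
proof -
  note [measurable] = f s
  show s': "sq_integrable (s i)" for i
    by (rule sq_integrable_dominated[OF w s bound])
  have bound': "AE x in lebesgue. \<forall>i. cmod (s i x) \<le> C * cmod (w x)"
    using bound by (simp add: AE_all_countable)
  have fb: "AE x in lebesgue. cmod (f x) \<le> C * cmod (w x)"
    using lim bound'
  proof eventually_elim
    case (elim x)
    then show ?case by (intro LIMSEQ_le_const2[OF tendsto_norm[OF elim(1)]]) auto
  qed
  show f': "sq_integrable f"
    by (rule sq_integrable_dominated[OF w f fb])
  have "(\<lambda>i. LINT x|lebesgue. (cmod (s i x - f x))\<^sup>2) \<longlonglongrightarrow> (LINT x|(lebesgue :: 'a measure). 0)"
  proof (rule integral_dominated_convergence[where w = "\<lambda>x. (2 * C)\<^sup>2 * (cmod (w x))\<^sup>2"])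
    show "integrable lebesgue (\<lambda>x. (2 * C)\<^sup>2 * (cmod (w x))\<^sup>2)"
      using sq_integrableD[OF w] by simp
    show "AE x in lebesgue. (\<lambda>i. (cmod (s i x - f x))\<^sup>2) \<longlonglongrightarrow> 0"
      using lim
    proof eventually_elim
      case (elim x)
      have "(\<lambda>i. (cmod (s i x - f x))\<^sup>2) \<longlonglongrightarrow> (cmod (f x - f x))\<^sup>2"
        by (intro tendsto_intros elim)
      then show ?case by simp
    qed
    show "AE x in lebesgue. norm ((cmod (s i x - f x))\<^sup>2) \<le> (2 * C)\<^sup>2 * (cmod (w x))\<^sup>2" for i
      using bound[of i] fb
    proof eventually_elim
      case (elim x)
      then have "cmod (s i x - f x) \<le> 2 * C * cmod (w x)"
        using norm_triangle_ineq4[of "s i x" "f x"] by simp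
      then have "(cmod (s i x - f x))\<^sup>2 \<le> (2 * C * cmod (w x))\<^sup>2" by (intro power_mono) auto
      then show ?case by (simp add: power_mult_distrib)
    qed
  qed auto
  then have "(\<lambda>i. sqrt (LINT x|lebesgue. (cmod (s i x - f x))\<^sup>2)) \<longlonglongrightarrow> sqrt 0"
    by (intro tendsto_real_sqrt) simp
  then have "(\<lambda>i. norm (to_l2 (s i) - to_l2 f)) \<longlonglongrightarrow> 0"
    by (simp add: to_l2_diff[symmetric] norm_to_l2 sq_integrable_diff s' f')
  then show "(\<lambda>i. to_l2 (s i)) \<longlonglongrightarrow> to_l2 f"
    by (subst Lim_null, subst tendsto_norm_zero_iff[symmetric])
qed

lemma closure_scaleR_Rats:
  fixes D :: "'b::real_normed_vector set"
  assumes add: "\<And>x y. x \<in> D \<Longrightarrow> y \<in> D \<Longrightarrow> x + y \<in> D"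
    and scale: "\<And>q x. q \<in> \<rat> \<Longrightarrow> x \<in> D \<Longrightarrow> q *\<^sub>R x \<in> D"
    and zero: "0 \<in> D"
  shows "subspace (closure D)"
  unfolding subspace_def
proof (intro conjI ballI allI)
  show "0 \<in> closure D" using zero closure_subset by auto
next
  fix x y assume "x \<in> closure D" "y \<in> closure D"
  then obtain X Y where XY: "\<forall>n. X n \<in> D" "X \<longlonglongrightarrow> x" "\<forall>n. Y n \<in> D" "Y \<longlonglongrightarrow> y"
    unfolding closure_sequential by blast
  then have "(\<lambda>n. X n + Y n) \<longlonglongrightarrow> x + y" "\<forall>n. X n + Y n \<in> D"
    by (auto intro: tendsto_add add)
  then show "x + y \<in> closure D" unfolding closure_sequential
    by (intro exI[of _ "\<lambda>n. X n + Y n"]) auto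
next
  fix r x assume "x \<in> closure D"
  then obtain X where X: "\<forall>n. X n \<in> D" "X \<longlonglongrightarrow> x"
    unfolding closure_sequential by blast
  have "\<exists>q\<in>\<rat>. r < q \<and> q < r + 1 / real (Suc n)" for n
    by (rule Rats_dense_in_real) simp
  then obtain q where q: "\<And>n. q n \<in> \<rat>" "\<And>n. r < q n" "\<And>n. q n < r + 1 / real (Suc n)"
    by metis
  have "q \<longlonglongrightarrow> r"
  proof (rule real_tendsto_sandwich[where f = "\<lambda>_. r" and h = "\<lambda>n. r + 1 / real (Suc n)"])
    have "(\<lambda>n. 1 / real (Suc n)) \<longlonglongrightarrow> 0"
      by (rule LIMSEQ_Suc[OF lim_1_over_n])
    then have "(\<lambda>n. r + 1 / real (Suc n)) \<longlonglongrightarrow> r + 0" by (intro tendsto_add) auto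
    then show "(\<lambda>n. r + 1 / real (Suc n)) \<longlonglongrightarrow> r" by simp
  qed (use q in \<open>auto intro!: always_eventually less_imp_le\<close>)
  then have "(\<lambda>n. q n *\<^sub>R X n) \<longlonglongrightarrow> r *\<^sub>R x" using X by (intro tendsto_scaleR) auto
  moreover have "\<forall>n. q n *\<^sub>R X n \<in> D" using X q by (auto intro: scale)
  ultimately show "r *\<^sub>R x \<in> closure D" unfolding closure_sequential
    by (intro exI[of _ "\<lambda>n. q n *\<^sub>R X n"]) auto
qed

lemma separable_from_countable_span:
  fixes E :: "'b::real_normed_vector set"
  assumes "countable E"
  shows "\<exists>D. countable D \<and> subspace (closure D) \<and> E \<subseteq> closure D"
proof -
  define comb where "comb L = (\<Sum>(q, e)\<leftarrow>L. q *\<^sub>R e)" for L :: "(real \<times> 'b) list"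
  define D where "D = comb ` lists (\<rat> \<times> E)"
  have "countable (lists (\<rat> \<times> E))"
    using assms countable_rat by (intro countable_lists countable_SIGMA) auto
  then have "countable D" unfolding D_def by (rule countable_image)
  moreover have "subspace (closure D)"
  proof (rule closure_scaleR_Rats)
    show "0 \<in> D" unfolding D_def by (intro image_eqI[of _ _ "[]"]) (auto simp: comb_def)
  next
    fix x y assume "x \<in> D" "y \<in> D"
    then obtain L L' where L: "L \<in> lists (\<rat> \<times> E)" "x = comb L" "L' \<in> lists (\<rat> \<times> E)" "y = comb L'"
      unfolding D_def by blast
    have "x + y = comb (L @ L')" using L by (simp add: comb_def)
    moreover have "L @ L' \<in> lists (\<rat> \<times> E)" using L by simp
    ultimately show "x + y \<in> D" unfolding D_def by blast
  next
    fix q :: real and x assume q: "q \<in> \<rat>" and "x \<in> D"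
    then obtain L where L: "L \<in> lists (\<rat> \<times> E)" "x = comb L" unfolding D_def by blast
    have "q *\<^sub>R comb L = comb (map (\<lambda>(p, e). (q * p, e)) L)"
      unfolding comb_def by (induction L) (auto simp: scaleR_add_right)
    moreover have "map (\<lambda>(p, e). (q * p, e)) L \<in> lists (\<rat> \<times> E)"
      using L(1) q by (induction L) auto
    ultimately show "q *\<^sub>R x \<in> D" unfolding D_def using L(2) by auto
  qed
  moreover have "E \<subseteq> closure D"
  proof
    fix e assume e: "e \<in> E"
    have "e = comb [(1, e)]" by (simp add: comb_def)
    moreover have "[(1, e)] \<in> lists (\<rat> \<times> E)" using e by simp
    ultimately have "e \<in> D" unfolding D_def by blast
    then show "e \<in> closure D" using closure_subset by auto
  qed
  ultimately show ?thesis by blast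
qed

lemma sq_integrable_indicator_subset:
  assumes "S \<in> sets lebesgue" "S \<subseteq> box a (b::'a::euclidean_space)"
  shows "sq_integrable (\<lambda>x. c * indicator S x)"
proof -
  have "integrable lebesgue (\<lambda>x. indicator S x :: real)"
  proof (rule integrable_real_indicator)
    have "emeasure lebesgue S \<le> emeasure lebesgue (box a b)"
      using assms(2) by (rule emeasure_mono) simp
    also have "\<dots> < \<infinity>" using emeasure_lborel_box_finite[of a b] by simp
    finally show "emeasure lebesgue S < \<infinity>" .
  qed (rule assms(1))
  then have "integrable lebesgue (\<lambda>x. (cmod (indicator S x))\<^sup>2)"
    by (rule Bochner_Integration.integrable_cong[THEN iffD1, rotated -1]) (auto simp: indicator_def)
  then have "sq_integrable (indicator S)"
    using assms by (simp add: sq_integrable_def)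
  then show ?thesis by (rule sq_integrable_cmult)
qed

lemma l2_separable: "\<exists>D :: 'a::euclidean_space l2 set. countable D \<and> closure D = UNIV"
proof -
  define R where "R = {x :: 'a. \<forall>i\<in>Basis. x \<bullet> i \<in> \<rat>}"
  have cR: "countable R"
  proof -
    have "R \<subseteq> (\<lambda>f. \<Sum>i\<in>Basis. f i *\<^sub>R i) ` (Basis \<rightarrow>\<^sub>E \<rat>)"
    proof
      fix x assume x: "x \<in> R"
      have "x = (\<Sum>i\<in>Basis. (restrict (\<lambda>i. x \<bullet> i) Basis) i *\<^sub>R i)"
        by (simp add: euclidean_representation)
      moreover have "restrict (\<lambda>i. x \<bullet> i) Basis \<in> Basis \<rightarrow>\<^sub>E \<rat>" using x by (auto simp: R_def)
      ultimately show "x \<in> (\<lambda>f. \<Sum>i\<in>Basis. f i *\<^sub>R i) ` (Basis \<rightarrow>\<^sub>E \<rat>)" by blast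
    qed
    moreover have "countable ((\<lambda>f. \<Sum>i\<in>Basis. f i *\<^sub>R i) ` (Basis \<rightarrow>\<^sub>E \<rat>) :: 'a set)"
      by (intro countable_image countable_PiE) (auto simp: countable_rat)
    ultimately show ?thesis by (rule countable_subset)
  qed
  define E where "E = (\<lambda>(c, a, b). to_l2 (\<lambda>x. c * indicator (box a b) x)) ` ({1, \<i>} \<times> R \<times> R)"
  have "countable E" unfolding E_def using cR by (intro countable_image countable_SIGMA) auto
  from separable_from_countable_span[OF this] obtain D
    where D: "countable D" "subspace (closure D)" "E \<subseteq> closure D" by blast
  define W where "W = closure D"
  have W: "subspace W" "E \<subseteq> W" "closed W" using D by (auto simp: W_def)
  have lim: "l \<in> W" if "X \<longlonglongrightarrow> l" "\<And>n. X n \<in> W" for X l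
    using closed_sequentially[OF W(3), of X l] that by auto
  define G where "G = (\<lambda>(a, b). box a b) ` (R \<times> R)"
  have G: "box a b \<in> G" if "a \<in> R" "b \<in> R" for a b using that by (auto simp: G_def)
  have Int: "A \<inter> B \<in> G" if "A \<in> G" "B \<in> G" for A B
  proof -
    from that obtain a b a' b' where ab: "a \<in> R" "b \<in> R" "a' \<in> R" "b' \<in> R" "A = box a b" "B = box a' b'"
      by (auto simp: G_def)
    have "A \<inter> B = box (\<Sum>i\<in>Basis. max (a \<bullet> i) (a' \<bullet> i) *\<^sub>R i) (\<Sum>i\<in>Basis. min (b \<bullet> i) (b' \<bullet> i) *\<^sub>R i)"
      by (auto simp: ab(5,6) box_def)
    also have "\<dots> \<in> G" using ab by (intro G) (auto simp: R_def max_def min_def)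
    finally show ?thesis .
  qed
  have borel: "sets (borel :: 'a measure) = sigma_sets UNIV G"
  proof -
    have "sigma_sets UNIV {S :: 'a set. open S} = sigma_sets UNIV G"
    proof (rule sigma_sets_eqI)
      fix M :: "'a set" assume "M \<in> {S. open S}"
      then have "open M" by simp
      define a b where "a f = (\<Sum>i\<in>Basis. fst (f i) *\<^sub>R i)" and "b f = (\<Sum>i\<in>Basis. snd (f i) *\<^sub>R i)"
        for f :: "'a \<Rightarrow> real \<times> real"
      define I where "I = {f\<in>Basis \<rightarrow>\<^sub>E \<rat> \<times> \<rat>. box (a f) (b f) \<subseteq> M}"
      have M1: "M = (\<Union>f\<in>I. box (a f) (b f))"
        using open_UNION_box[OF \<open>open M\<close>] unfolding I_def a_def b_def by simp
      have M2: "countable I" unfolding I_def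
        by (intro countable_subset[OF _ countable_PiE[OF finite_Basis, of "\<lambda>_. \<rat> \<times> \<rat>"]])
           (auto intro!: countable_SIGMA countable_rat)
      have M3: "a f \<in> R \<and> b f \<in> R" if "f \<in> I" for f
      proof -
        have "fst (f i) \<in> \<rat> \<and> snd (f i) \<in> \<rat>" if "i \<in> Basis" for i
          using \<open>f \<in> I\<close> that PiE_mem[of f Basis "\<lambda>_. \<rat> \<times> \<rat>" i] by (auto simp: I_def mem_Times_iff)
        then show ?thesis by (auto simp: R_def a_def b_def)
      qed
      show "M \<in> sigma_sets UNIV G"
        by (subst M1, rule sigma_sets_UNION) (use M2 M3 G in \<open>auto intro!: sigma_sets.Basic\<close>)
    next
      show "\<And>B. B \<in> G \<Longrightarrow> B \<in> sigma_sets UNIV {S. open S}" by (auto simp: G_def)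
    qed
    then show ?thesis by (simp add: borel_def)
  qed
  have ind_W: "to_l2 (\<lambda>x. c * indicator (B \<inter> K) x) \<in> W"
    if K: "K \<in> G" and c: "c \<in> {1, \<i>}" and B: "B \<in> sets (borel :: 'a measure)" for K c B
  proof -
    from K obtain p q where Kpq: "K = box p q" by (auto simp: G_def)
    have Kb: "K \<in> sets lebesgue" by (simp add: Kpq)
    have sq: "sq_integrable (\<lambda>x. c * indicator (A \<inter> K) x)" if "A \<in> sets borel" for A
      using that by (intro sq_integrable_indicator_subset[of _ p q]) (auto simp: Kpq)
    have "Int_stable G" using Int by (auto simp: Int_stable_def)
    moreover have "G \<subseteq> Pow UNIV" by simp
    moreover have "B \<in> sigma_sets UNIV G" using B borel by simp
    ultimately show ?thesis
    proof (induction B rule: sigma_sets_induct_disjoint)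
      case (basic A)
      then obtain a b where "a \<in> R" "b \<in> R" "A \<inter> K = box a b" using Int[OF basic K] by (auto simp: G_def)
      then have "to_l2 (\<lambda>x. c * indicator (A \<inter> K) x) \<in> E" unfolding E_def using c by force
      then show ?case using W by auto
    next
      case empty
      then show ?case using W(1) by (simp add: subspace_0)
    next
      case (compl A)
      then have A: "A \<in> sets borel" using borel by simp
      have "(\<lambda>x. c * indicator ((UNIV - A) \<inter> K) x) =
          (\<lambda>x. c * indicator (UNIV \<inter> K) x - c * indicator (A \<inter> K) x)"
        by (auto simp: indicator_def)
      then have "to_l2 (\<lambda>x. c * indicator ((UNIV - A) \<inter> K) x) =
          to_l2 (\<lambda>x. c * indicator (UNIV \<inter> K) x) - to_l2 (\<lambda>x. c * indicator (A \<inter> K) x)"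
        using to_l2_diff[OF sq[of UNIV] sq[OF A]] by simp
      moreover have "to_l2 (\<lambda>x. c * indicator (UNIV \<inter> K) x) \<in> W"
        using W(2) c K by (force simp: E_def G_def)
      ultimately show ?case using compl W(1) by (simp add: subspace_diff)
    next
      case (union A)
      then have A: "A i \<in> sets borel" for i using borel by auto
      define s where "s n = (\<lambda>x. c * indicator ((\<Union>i<n. A i) \<inter> K) x)" for n :: nat
      have "to_l2 (s n) \<in> W" for n
      proof (induction n)
        case 0
        then show ?case using W(1) by (simp add: s_def subspace_0)
      next
        case (Suc n)
        have "s (Suc n) = (\<lambda>x. s n x + c * indicator (A n \<inter> K) x)"
        proof
          fix x
          have "x \<notin> A j" if "x \<in> A n" "j < n" for j
            using union(1) that unfolding disjoint_family_on_def
            by (metis IntI UNIV_I empty_iff less_irrefl)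
          then show "s (Suc n) x = s n x + c * indicator (A n \<inter> K) x"
            by (auto simp: s_def indicator_def lessThan_Suc)
        qed
        moreover have "sq_integrable (s n)" unfolding s_def using A by (intro sq) auto
        ultimately show ?case
          using sq[OF A[of n]] Suc union(3)[of n] W(1) by (simp add: to_l2_add subspace_add)
      qed
      moreover have "(\<lambda>n. to_l2 (s n)) \<longlonglongrightarrow> to_l2 (\<lambda>x. c * indicator ((\<Union>i. A i) \<inter> K) x)"
      proof (rule to_l2_dominated_convergence(3)[where w = "\<lambda>x. c * indicator (UNIV \<inter> K) x" and C = 1])
        show "AE x in lebesgue. (\<lambda>n. s n x) \<longlonglongrightarrow> c * indicator ((\<Union>i. A i) \<inter> K) x"
        proof (intro AE_I2)
          fix x
          show "(\<lambda>n. s n x) \<longlonglongrightarrow> c * indicator ((\<Union>i. A i) \<inter> K) x"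
          proof (cases "x \<in> (\<Union>i. A i)")
            case True
            then obtain i where "x \<in> A i" by auto
            then have "s n x = c * indicator ((\<Union>i. A i) \<inter> K) x" if "n > i" for n
              using that by (auto simp: s_def indicator_def)
            then show ?thesis
              by (intro tendsto_eventually eventually_sequentiallyI[of "Suc i"]) simp
          next
            case False
            then show ?thesis by (simp add: s_def)
          qed
        qed
        show "\<And>i. s i \<in> borel_measurable lebesgue"
          unfolding s_def using A by (intro sq_integrable_measurable sq) auto
        show "(\<lambda>x. c * indicator ((\<Union>i. A i) \<inter> K) x) \<in> borel_measurable lebesgue"
          using A by (intro sq_integrable_measurable sq) auto
        show "sq_integrable (\<lambda>x. c * indicator (UNIV \<inter> K) x)" by (intro sq) auto
        show "\<And>i. AE x in lebesgue. cmod (s i x) \<le> 1 * cmod (c * indicator (UNIV \<inter> K) x)"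
          by (intro AE_I2) (auto simp: s_def indicator_def)
      qed
      ultimately show ?case using lim by blast
    qed
  qed
  have ind_W': "to_l2 (\<lambda>x. z * indicator (S \<inter> K) x) \<in> W"
    if K: "K \<in> G" and S: "S \<in> sets (lebesgue :: 'a measure)" for K z S
  proof -
    from K obtain p q where Kpq: "K = box p q" by (auto simp: G_def)
    from S obtain B N N' where B: "S = B \<union> N" "N \<subseteq> N'" "N' \<in> null_sets lborel" "B \<in> sets lborel"
      by (rule sets_completionE)
    then have ae: "AE x in lebesgue. indicator S x = (indicator B x :: complex)"
      by (intro AE_I'[of N']) (auto simp: null_sets_completionI indicator_def)
    have sqS: "sq_integrable (\<lambda>x. c * indicator (S \<inter> K) x)"
      and sqB: "sq_integrable (\<lambda>x. c * indicator (B \<inter> K) x)" for c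
      using S B by (auto intro!: sq_integrable_indicator_subset[of _ p q] simp: Kpq)
    have "to_l2 (\<lambda>x. z * indicator (S \<inter> K) x) = to_l2 (\<lambda>x. z * indicator (B \<inter> K) x)"
    proof (subst to_l2_eq_iff[OF sqS sqB])
      show "AE x in lebesgue. z * indicator (S \<inter> K) x = z * indicator (B \<inter> K) x"
        using ae by eventually_elim (simp add: indicator_inter_arith)
    qed
    also have "(\<lambda>x. z * indicator (B \<inter> K) x) =
        (\<lambda>x. Re z *\<^sub>R (1 * indicator (B \<inter> K) x) + Im z *\<^sub>R (\<i> * indicator (B \<inter> K) x))"
      by (auto simp: indicator_def complex_eq_iff)
    also have "to_l2 \<dots> = Re z *\<^sub>R to_l2 (\<lambda>x. 1 * indicator (B \<inter> K) x) +
        Im z *\<^sub>R to_l2 (\<lambda>x. \<i> * indicator (B \<inter> K) x)"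
      using sqB[of 1] sqB[of \<i>] by (simp only: to_l2_add to_l2_scaleR sq_integrable_scaleR)
    also have "\<dots> \<in> W"
      using ind_W[OF K, of 1 B] ind_W[OF K, of \<i> B] B(4) W(1)
      by (intro subspace_add subspace_scale) auto
    finally show ?thesis .
  qed
  have "f \<in> W" for f
  proof -
    define g where "g = l2_fun f"
    have g: "sq_integrable g" by (simp add: g_def sq_integrable_l2_fun)
    then have gm [measurable]: "g \<in> borel_measurable lebesgue" by (rule sq_integrable_measurable)
    from borel_measurable_implies_sequence_metric[OF gm, of 0] obtain F
      where F: "\<And>i. simple_function lebesgue (F i)" "\<And>x. (\<lambda>i. F i x) \<longlonglongrightarrow> g x"
        "\<And>i x. cmod (F i x) \<le> 2 * cmod (g x)" by auto
    define K where "K n = box (- (\<Sum>i\<in>Basis. real n *\<^sub>R i)) (\<Sum>i\<in>Basis. real n *\<^sub>R i :: 'a)" for n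
    have K: "K n \<in> G" for n unfolding K_def by (intro G) (auto simp: R_def)
    have Kb: "K n \<in> sets lebesgue" for n by (simp add: K_def)
    define s where "s n = (\<lambda>x. F n x * indicator (K n) x)" for n
    have Fm [measurable]: "F n \<in> borel_measurable lebesgue" for n
      using F(1) by (rule borel_measurable_simple_function)
    have "(\<lambda>n. to_l2 (s n)) \<longlonglongrightarrow> to_l2 g"
    proof (rule to_l2_dominated_convergence(3)[OF g gm, where C = 2])
      show "s i \<in> borel_measurable lebesgue" for i
        unfolding s_def using Kb[of i] by measurable
      show "AE x in lebesgue. cmod (s i x) \<le> 2 * cmod (g x)" for i
        using F(3)[of i] by (intro AE_I2) (auto simp: s_def indicator_def)
      show "AE x in lebesgue. (\<lambda>i. s i x) \<longlonglongrightarrow> g x"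
      proof (intro AE_I2)
        fix x :: 'a
        obtain m :: nat where m: "norm x < real m" using reals_Archimedean2 by blast
        have "x \<in> K n" if "n \<ge> m" for n
        proof -
          have "\<bar>x \<bullet> i\<bar> < real n" if "i \<in> Basis" for i
            using Basis_le_norm[OF that, of x] m \<open>n \<ge> m\<close> by linarith
          then show ?thesis
            by (auto simp: K_def mem_box inner_sum_left_Basis abs_less_iff minus_less_iff)
        qed
        then have "eventually (\<lambda>n. F n x = s n x) sequentially"
          by (auto simp: s_def intro!: eventually_sequentiallyI[of m])
        with F(2)[of x] show "(\<lambda>i. s i x) \<longlonglongrightarrow> g x" by (rule Lim_transform_eventually)
      qed
    qed
    moreover have "to_l2 (s n) \<in> W" for n
    proof -
      have fin: "finite (F n ` UNIV)" using simple_functionD(1)[OF F(1)[of n]] by simp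
      have meas: "F n -` {z} \<in> sets lebesgue" for z
        using simple_functionD(2)[OF F(1)[of n], of "{z}"] by simp
      have sq: "sq_integrable (\<lambda>x. z * indicator (F n -` {z} \<inter> K n) x)" for z
        using meas Kb by (auto intro!: sq_integrable_indicator_subset simp: K_def)
      have "sq_integrable (\<lambda>x. \<Sum>z\<in>Z. z * indicator (F n -` {z} \<inter> K n) x) \<and>
          to_l2 (\<lambda>x. \<Sum>z\<in>Z. z * indicator (F n -` {z} \<inter> K n) x) \<in> W" if "finite Z" for Z
        using that
      proof induction
        case empty
        then show ?case using W(1) by (simp add: sq_integrable_0 subspace_0)
      next
        case (insert z Z)
        define h where "h y x = y * indicator (F n -` {y} \<inter> K n) x" for y x
        have "(\<lambda>x. \<Sum>y\<in>insert z Z. h y x) = (\<lambda>x. h z x + (\<Sum>y\<in>Z. h y x))"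
          using insert by simp
        moreover have "sq_integrable (h z)" "to_l2 (h z) \<in> W"
          using sq[of z] ind_W'[OF K[of n] meas[of z], of z] unfolding h_def by auto
        moreover have "sq_integrable (\<lambda>x. \<Sum>y\<in>Z. h y x)" "to_l2 (\<lambda>x. \<Sum>y\<in>Z. h y x) \<in> W"
          using insert unfolding h_def by auto
        ultimately show ?case
          using W(1) unfolding h_def[symmetric] by (simp add: to_l2_add sq_integrable_add subspace_add)
      qed
      from this[OF fin] have "to_l2 (\<lambda>x. \<Sum>z\<in>F n ` UNIV. z * indicator (F n -` {z} \<inter> K n) x) \<in> W" by simp
      moreover have "(\<lambda>x. \<Sum>z\<in>F n ` UNIV. z * indicator (F n -` {z} \<inter> K n) x) = s n"
      proof
        fix x
        have "(\<Sum>z\<in>F n ` UNIV. z * indicator (F n -` {z} \<inter> K n) x) =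
            (\<Sum>z\<in>F n ` UNIV. if z = F n x then s n x else 0)"
          by (intro sum.cong) (auto simp: s_def indicator_def)
        also have "\<dots> = s n x" using fin by (simp add: sum.delta)
        finally show "(\<Sum>z\<in>F n ` UNIV. z * indicator (F n -` {z} \<inter> K n) x) = s n x" .
      qed
      ultimately show ?thesis by simp
    qed
    ultimately have "to_l2 g \<in> W" using lim by blast
    then show ?thesis by (simp add: g_def)
  qed
  then have "closure D = UNIV" by (auto simp: W_def)
  with D(1) show ?thesis by blast
qed

instance l2 :: (euclidean_space) second_countable_topology
proof
  obtain D :: "'a l2 set" where D: "countable D" "closure D = UNIV" using l2_separable by blast
  define B where "B = (\<lambda>(d, q). ball d q) ` (D \<times> {q \<in> \<rat>. 0 < q})"
  have "countable {q \<in> \<rat>. 0 < (q :: real)}" by (rule countable_subset[OF _ countable_rat]) auto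
  then have cB: "countable B" unfolding B_def using D by (intro countable_image countable_SIGMA) auto
  have "topological_basis B"
  proof (rule topological_basisI)
    show "\<And>b. b \<in> B \<Longrightarrow> open b" by (auto simp: B_def)
  next
    fix U and x :: "'a l2" assume "open U" "x \<in> U"
    then obtain e where e: "e > 0" "ball x e \<subseteq> U" by (meson openE)
    obtain q where q: "q \<in> \<rat>" "0 < q" "q < e / 2" using Rats_dense_in_real[of 0 "e / 2"] e by auto
    have "x \<in> closure D" using D by simp
    then obtain d where d: "d \<in> D" "dist d x < q" using q by (meson closure_approachable)
    have "ball d q \<subseteq> U"
    proof
      fix y assume "y \<in> ball d q"
      then have "dist x y < e" using d q dist_triangle[of x y d] by (simp add: dist_commute)
      then show "y \<in> U" using e by auto
    qed
    moreover have "ball d q \<in> B"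
      unfolding B_def by (rule image_eqI[of _ _ "(d, q)"]) (use d q in auto)
    ultimately show "\<exists>B'\<in>B. x \<in> B' \<and> B' \<subseteq> U"
      using d(2) by (intro bexI[of _ "ball d q"] conjI) simp_all
  qed
  then have "open = generate_topology B" by (rule topological_basis_imp_subbasis)
  with cB have "countable B \<and> open = generate_topology B" by (rule conjI)
  then show "\<exists>B :: 'a l2 set set. countable B \<and> open = generate_topology B" by (rule exI)
qed


definition l2_inner :: "'a::euclidean_space l2 \<Rightarrow> 'a l2 \<Rightarrow> complex" where
  "l2_inner f g = (LINT x|lebesgue. l2_fun f x * cnj (l2_fun g x))"

definition l2_mult :: "('a::euclidean_space \<Rightarrow> complex) \<Rightarrow> 'a l2 \<Rightarrow> 'a l2" where
  "l2_mult m f = to_l2 (\<lambda>x. m x * l2_fun f x)"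

abbreviation cutoff :: "'a::euclidean_space set \<Rightarrow> 'a l2 \<Rightarrow> 'a l2" where
  "cutoff \<omega> \<equiv> l2_mult (indicator \<omega>)"

text \<open>\<open>L\<^sup>2(\<Omega>)\<close>, identified via extension by zero with the functions vanishing a.e. outside \<open>\<Omega>\<close>.\<close>

definition L2_on :: "'a::euclidean_space set \<Rightarrow> 'a l2 set" where
  "L2_on \<Omega> = {f. AE x in lebesgue. x \<notin> \<Omega> \<longrightarrow> l2_fun f x = 0}"


section \<open>The Sobolev spaces \<open>H\<^sup>1\<close> and \<open>H\<^sub>0\<^sup>1\<close>\<close>

definition dir_deriv :: "'a::euclidean_space \<Rightarrow> ('a \<Rightarrow> complex) \<Rightarrow> 'a \<Rightarrow> complex" where
  "dir_deriv b f x = frechet_derivative f (at x) b"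

primrec C_k :: "nat \<Rightarrow> ('a::euclidean_space \<Rightarrow> complex) \<Rightarrow> bool" where
  "C_k 0 f \<longleftrightarrow> continuous_on UNIV f"
| "C_k (Suc k) f \<longleftrightarrow> (\<forall>x. f differentiable at x) \<and> (\<forall>b\<in>Basis. C_k k (dir_deriv b f))"

definition test_functions :: "'a::euclidean_space set \<Rightarrow> ('a \<Rightarrow> complex) set" where
  "test_functions \<Omega> =
     {\<phi>. (\<forall>k. C_k k \<phi>) \<and> (\<exists>K. compact K \<and> K \<subseteq> \<Omega> \<and> (\<forall>x. x \<notin> K \<longrightarrow> \<phi> x = 0))}"

definition is_weak_deriv :: "'a::euclidean_space set \<Rightarrow> 'a \<Rightarrow> 'a l2 \<Rightarrow> 'a l2 \<Rightarrow> bool" where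
  "is_weak_deriv \<Omega> b f g \<longleftrightarrow> f \<in> L2_on \<Omega> \<and> g \<in> L2_on \<Omega> \<and>
     (\<forall>\<phi>\<in>test_functions \<Omega>.
        (LINT x|lebesgue_on \<Omega>. l2_fun f x * dir_deriv b \<phi> x) =
        - (LINT x|lebesgue_on \<Omega>. l2_fun g x * \<phi> x))"

definition weak_deriv :: "'a::euclidean_space set \<Rightarrow> 'a \<Rightarrow> 'a l2 \<Rightarrow> 'a l2" where
  "weak_deriv \<Omega> b f = (THE g. is_weak_deriv \<Omega> b f g)"

definition H1 :: "'a::euclidean_space set \<Rightarrow> 'a l2 set" where
  "H1 \<Omega> = {f \<in> L2_on \<Omega>. \<forall>b\<in>Basis. \<exists>g. is_weak_deriv \<Omega> b f g}"

definition h1_norm :: "'a::euclidean_space set \<Rightarrow> 'a l2 \<Rightarrow> real" where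
  "h1_norm \<Omega> f = sqrt ((norm f)\<^sup>2 + (\<Sum>b\<in>Basis. (norm (weak_deriv \<Omega> b f))\<^sup>2))"

definition H01 :: "'a::euclidean_space set \<Rightarrow> 'a l2 set" where
  "H01 \<Omega> = {f \<in> H1 \<Omega>. \<forall>\<epsilon>>0. \<exists>\<phi>\<in>test_functions \<Omega>. h1_norm \<Omega> (f - to_l2 \<phi>) < \<epsilon>}"


section \<open>Dirichlet and Neumann realizations of \<open>-\<nabla>\<cdot>(A\<nabla>) + V\<close>\<close>

definition cvec_inner :: "complex ^ 'n \<Rightarrow> complex ^ 'n \<Rightarrow> complex" where
  "cvec_inner \<xi> \<eta> = (\<Sum>i\<in>UNIV. \<xi> $ i * cnj (\<eta> $ i))"

definition cmat_vec :: "real ^ 'n ^ 'n \<Rightarrow> complex ^ 'n \<Rightarrow> complex ^ 'n" where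
  "cmat_vec A \<xi> = map_matrix complex_of_real A *v \<xi>"

definition weak_grad :: "(real ^ 'n) set \<Rightarrow> (real ^ 'n) l2 \<Rightarrow> real ^ 'n \<Rightarrow> complex ^ 'n" where
  "weak_grad \<Omega> f x = (\<chi> i. l2_fun (weak_deriv \<Omega> (axis i 1) f) x)"

definition sesq_form ::
  "(real ^ 'n) set \<Rightarrow> (real ^ 'n \<Rightarrow> real ^ 'n ^ 'n) \<Rightarrow> (real ^ 'n \<Rightarrow> real) \<Rightarrow>
    (real ^ 'n) l2 \<Rightarrow> (real ^ 'n) l2 \<Rightarrow> complex" where
  "sesq_form \<Omega> A V f g =
     (LINT x|lebesgue_on \<Omega>. cvec_inner (cmat_vec (A x) (weak_grad \<Omega> f x)) (weak_grad \<Omega> g x)) +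
     (LINT x|lebesgue_on \<Omega>. complex_of_real (V x) * l2_fun f x * cnj (l2_fun g x))"

datatype boundary_condition = Dirichlet | Neumann

fun form_domain :: "boundary_condition \<Rightarrow> 'a::euclidean_space set \<Rightarrow> 'a l2 set" where
  "form_domain Dirichlet \<Omega> = H01 \<Omega>"
| "form_domain Neumann \<Omega> = H1 \<Omega>"

text \<open>The graph of the operator associated with the form by the first representation theorem.\<close>

definition realization ::
  "boundary_condition \<Rightarrow> (real ^ 'n) set \<Rightarrow> (real ^ 'n \<Rightarrow> real ^ 'n ^ 'n) \<Rightarrow> (real ^ 'n \<Rightarrow> real) \<Rightarrow>
    ((real ^ 'n) l2 \<times> (real ^ 'n) l2) set" where
  "realization bc \<Omega> A V =
     {(f, w). f \<in> form_domain bc \<Omega> \<and> w \<in> L2_on \<Omega> \<and>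
        (\<forall>g\<in>form_domain bc \<Omega>. sesq_form \<Omega> A V f g = l2_inner w g)}"


section \<open>The semigroup \<open>e\<^bsup>-tH\<^esup>\<close>\<close>

text \<open>A \<open>C\<^sub>0\<close>-semigroup on a closed subspace \<open>X\<close> (below always some \<open>L2_on \<Omega>\<close>); only the values
  \<open>S t f\<close> with \<open>t \<ge> 0\<close> and \<open>f \<in> X\<close> are relevant.\<close>

definition c0_semigroup ::
  "'a::euclidean_space l2 set \<Rightarrow> (real \<Rightarrow> 'a l2 \<Rightarrow> 'a l2) \<Rightarrow> bool" where
  "c0_semigroup X S \<longleftrightarrow>
     (\<forall>t\<ge>0. (\<forall>f\<in>X. S t f \<in> X) \<and>
            (\<forall>f\<in>X. \<forall>g\<in>X. S t (f + g) = S t f + S t g) \<and>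
            (\<forall>c. \<forall>f\<in>X. S t (l2_mult (\<lambda>_. c) f) = l2_mult (\<lambda>_. c) (S t f)) \<and>
            (\<exists>B. \<forall>f\<in>X. norm (S t f) \<le> B * norm f)) \<and>
     (\<forall>f\<in>X. S 0 f = f) \<and>
     (\<forall>s\<ge>0. \<forall>t\<ge>0. \<forall>f\<in>X. S (s + t) f = S s (S t f)) \<and>
     (\<forall>f\<in>X. ((\<lambda>t. S t f) \<longlongrightarrow> f) (at_right 0))"

definition generator ::
  "'a::euclidean_space l2 set \<Rightarrow> (real \<Rightarrow> 'a l2 \<Rightarrow> 'a l2) \<Rightarrow> ('a l2 \<times> 'a l2) set" where
  "generator X S =
     {(f, g). f \<in> X \<and> g \<in> X \<and> ((\<lambda>t. (S t f - f) /\<^sub>R t) \<longlongrightarrow> g) (at_right 0)}"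

definition is_exp_semigroup ::
  "'a::euclidean_space l2 set \<Rightarrow> ('a l2 \<times> 'a l2) set \<Rightarrow> (real \<Rightarrow> 'a l2 \<Rightarrow> 'a l2) \<Rightarrow> bool" where
  "is_exp_semigroup X H S \<longleftrightarrow>
     c0_semigroup X S \<and> generator X S = {(f, - w) | f w. (f, w) \<in> H}"

definition exp_semigroup ::
  "'a::euclidean_space l2 set \<Rightarrow> ('a l2 \<times> 'a l2) set \<Rightarrow> real \<Rightarrow> 'a l2 \<Rightarrow> 'a l2" where
  "exp_semigroup X H = (SOME S. is_exp_semigroup X H S)"


section \<open>Null-controllability and control cost\<close>

definition L2_time :: "real \<Rightarrow> 'a::euclidean_space l2 set \<Rightarrow> (real \<Rightarrow> 'a l2) set" where
  "L2_time T X =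
     {v. v \<in> borel_measurable (lebesgue_on {0<..<T}) \<and> (\<forall>s\<in>{0<..<T}. v s \<in> X) \<and>
         integrable (lebesgue_on {0<..<T}) (\<lambda>s. (norm (v s))\<^sup>2)}"

definition steers_to_zero ::
  "'a::euclidean_space l2 set \<Rightarrow> ('a l2 \<times> 'a l2) set \<Rightarrow> 'a set \<Rightarrow> real \<Rightarrow>
    'a l2 \<Rightarrow> (real \<Rightarrow> 'a l2) \<Rightarrow> bool" where
  "steers_to_zero X H \<omega> T u0 v \<longleftrightarrow>
     (\<exists>w. has_bochner_integral (lebesgue_on {0<..<T})
            (\<lambda>s. exp_semigroup X H (T - s) (cutoff \<omega> (v s))) w \<and>
          exp_semigroup X H T u0 + w = 0)"

text \<open>The first conjunct says that the system is well-posed, i.e. that \<open>e\<^bsup>-tH\<^esup>\<close> exists; this holds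
  for every lower semibounded self-adjoint \<open>H\<close>, and \<open>e\<^bsup>-tH\<^esup>\<close> is then unique on \<open>X\<close>.\<close>

definition null_controllable ::
  "'a::euclidean_space l2 set \<Rightarrow> ('a l2 \<times> 'a l2) set \<Rightarrow> 'a set \<Rightarrow> real \<Rightarrow> bool" where
  "null_controllable X H \<omega> T \<longleftrightarrow>
     (\<exists>S. is_exp_semigroup X H S) \<and>
     (\<forall>u0\<in>X. \<exists>v\<in>L2_time T X. steers_to_zero X H \<omega> T u0 v)"

definition control_cost ::
  "'a::euclidean_space l2 set \<Rightarrow> ('a l2 \<times> 'a l2) set \<Rightarrow> 'a set \<Rightarrow> real \<Rightarrow> ennreal" where
  "control_cost X H \<omega> T =
     (SUP u0\<in>{u0 \<in> X. norm u0 = 1}.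
        INF v\<in>{v \<in> L2_time T X. steers_to_zero X H \<omega> T u0 v}.
          ennreal (sqrt (LINT s|lebesgue_on {0<..<T}. (norm (cutoff \<omega> (v s)))\<^sup>2)))"


section \<open>Reflection in a hyperplane\<close>

text \<open>The index type carries no order, so the first coordinate is the one with a chosen index \<open>k\<close>.\<close>

definition mirror :: "'n \<Rightarrow> real ^ 'n \<Rightarrow> real ^ 'n" where
  "mirror k x = (\<chi> i. if i = k then - (x $ i) else x $ i)"

definition mirror_matrix :: "'n \<Rightarrow> real ^ 'n ^ 'n" where
  "mirror_matrix k = (\<chi> i j. if i = j then (if i = k then -1 else 1) else 0)"

end

theory Submission
  imports Defs
begin

text \<open>Let \<open>R f = f \<circ> mirror k\<close>, let \<open>\<epsilon> = -1\<close> for Dirichlet and \<open>\<epsilon> = 1\<close> for Neumann conditions, and let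
  \<open>E f = f + \<epsilon> R f\<close> be the odd respectively even extension of \<open>f \<in> L\<^sup>2(\<Omega>)\<close>. Its adjoint
  \<open>E\<^sup>* g = (g + \<epsilon> R g)|\<Omega>\<close> satisfies \<open>E\<^sup>* E = 2\<close>. Both \<open>E\<close> and \<open>E\<^sup>*\<close> preserve the form domains, and the forms are
  related by \<open>h'[E f, g] = h[f, E\<^sup>* g]\<close>; hence \<open>(f, w) \<in> H\<close> iff \<open>(E f, E w) \<in> H'\<close>. As \<open>H'\<close> commutes with \<open>R\<close>, so
  does its semigroup, because a strongly continuous semigroup is determined by its generator. Therefore \<open>e\<^bsup>-tH\<^esup> f\<close> is
  the restriction of \<open>e\<^bsup>-tH'\<^esup> E f\<close> to \<open>\<Omega>\<close>. If \<open>v'\<close> steers \<open>E u\<^sub>0 / \<surd>2\<close> to zero, then \<open>E\<^sup>* v' / \<surd>2\<close> steers \<open>u\<^sub>0\<close>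
  to zero at no larger cost.\<close>

section \<open>Strongly continuous semigroups on Banach spaces\<close>

text \<open>The sign \<epsilon> is forced by the form domains. Restricting an element of
  \<open>H01 \<Omega>'\<close> to \<Omega> need not give an element of \<open>H01 \<Omega>\<close>,
  because the trace on the hyperplane survives; subtracting the reflection first removes it. Dually,
  testing the even extension of f against a derivative of \<phi> amounts to testing f against the
  same derivative of \<phi> + R \<phi> in tangential directions and of \<phi> - R \<phi> in the
  normal one. Both times the obstacle is that a symmetrised test function, restricted to \<Omega>,
  is no test function of \<Omega>. The cutoff in \<open>half_approx\<close> repairs this without
  trace theory: its only dangerous term is the normal derivative of the cutoff, and that term is met
  only with test functions vanishing on the hyperplane.

  \<open>exp_semigroup\<close> is a choice among all semigroups with the prescribed generator, which
  is determined only on the subspace and for nonnegative times. Hence every fact about it goes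
  through uniqueness: a candidate is built by conjugation and its generator is computed. The
  extension multiplies norms on \<Omega> by \<open>sqrt 2\<close>; this is the origin of the
  normalisation.\<close>

lemma has_vector_derivative_iff_quotient:
  "(f has_vector_derivative D) (at x within S) \<longleftrightarrow>
     ((\<lambda>t. (f t - f x) /\<^sub>R (t - x)) \<longlongrightarrow> D) (at x within S)"
proof -
  have *: "eventually (\<lambda>t. norm (f t - f x - (t - x) *\<^sub>R D) / norm (t - x) =
      norm ((f t - f x) /\<^sub>R (t - x) - D)) (at x within S)"
    unfolding eventually_at_filter
  proof (intro always_eventually allI impI)
    fix t assume "t \<noteq> x"
    then have "(f t - f x) /\<^sub>R (t - x) - D = (f t - f x - (t - x) *\<^sub>R D) /\<^sub>R (t - x)"
      by (simp add: scaleR_diff_right)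
    then show "norm (f t - f x - (t - x) *\<^sub>R D) / norm (t - x) = norm ((f t - f x) /\<^sub>R (t - x) - D)"
      by (simp add: divide_inverse_commute)
  qed
  have "((\<lambda>t. (f t - f x) /\<^sub>R (t - x)) \<longlongrightarrow> D) (at x within S) \<longleftrightarrow>
      ((\<lambda>t. norm ((f t - f x) /\<^sub>R (t - x) - D)) \<longlongrightarrow> 0) (at x within S)"
    by (subst Lim_null, subst tendsto_norm_zero_iff[symmetric]) simp
  then show ?thesis
    by (simp only: has_vector_derivative_def has_derivative_iff_norm bounded_linear_scaleR_left
        tendsto_cong[OF *] simp_thms)
qed

locale banach_semigroup =
  fixes U :: "real \<Rightarrow> 'b::banach \<Rightarrow> 'b"
  assumes bounded_linear: "0 \<le> t \<Longrightarrow> bounded_linear (U t)"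
    and add: "0 \<le> s \<Longrightarrow> 0 \<le> t \<Longrightarrow> U (s + t) f = U s (U t f)"
    and continuous_at_0: "((\<lambda>t. U t f) \<longlongrightarrow> U 0 f) (at_right 0)"
begin

text \<open>One index n serves both as the bound and as the inverse length of the time interval, so
  that countably many closed sets cover the space in the Baire argument.\<close>

lemma eventually_bounded_pointwise: "\<exists>n::nat. \<forall>t\<in>{0..1 / Suc n}. norm (U t f) \<le> Suc n"
proof -
  have "eventually (\<lambda>t. dist (U t f) (U 0 f) < 1) (at_right 0)"
    using continuous_at_0[of f] by (rule tendstoD) simp
  then obtain d where d: "d > 0" "\<And>t. 0 < t \<Longrightarrow> t < d \<Longrightarrow> dist (U t f) (U 0 f) < 1"
    unfolding eventually_at_right_field by auto
  obtain n1 :: nat where n1: "1 / Suc n1 < d" using d(1) by (metis reals_Archimedean inverse_eq_divide)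
  obtain n2 :: nat where n2: "norm (U 0 f) + 1 \<le> n2" using real_arch_simple by blast
  define n where "n = max n1 n2"
  have "norm (U t f) \<le> Suc n" if "t \<in> {0..1 / Suc n}" for t
  proof (cases "t = 0")
    case True
    then show ?thesis using n2 by (auto simp: n_def)
  next
    case False
    have "1 / Suc n \<le> 1 / Suc n1" by (intro divide_left_mono) (auto simp: n_def)
    then have "dist (U t f) (U 0 f) < 1" using that False n1 by (intro d(2)) auto
    then have "norm (U t f) < norm (U 0 f) + 1"
      using norm_triangle_sub[of "U t f" "U 0 f"] by (simp add: dist_norm)
    also have "\<dots> \<le> Suc n" using n2 by (simp add: n_def)
    finally show ?thesis by simp
  qed
  then show ?thesis by blast
qed

text \<open>The uniform boundedness principle, by Baire category.\<close>

lemma bounded_near_0: "\<exists>d>0. \<exists>B. \<forall>t\<in>{0..d}. \<forall>f. norm (U t f) \<le> B * norm f"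
proof -
  define E where "E n = {f. \<forall>t\<in>{0..1 / Suc n}. norm (U t f) \<le> Suc n}" for n :: nat
  have cl: "closed (E n)" for n
  proof -
    have "E n = (\<Inter>t\<in>{0..1 / Suc n}. {f. norm (U t f) \<le> Suc n})" by (auto simp: E_def)
    moreover have "closed {f. norm (U t f) \<le> Suc n}" if "t \<in> {0..1 / Suc n}" for t
      using that by (intro closed_Collect_le continuous_on_norm bounded_linear.continuous_on[OF bounded_linear] continuous_intros) auto
    ultimately show ?thesis by (auto intro: closed_INT)
  qed
  have "\<exists>n. interior (E n) \<noteq> {}"
  proof (rule ccontr)
    assume "\<nexists>n. interior (E n) \<noteq> {}"
    then have "(euclidean :: 'b topology) interior_of (\<Union>(range E)) = {}"
      by (intro Baire_category_alt)
         (auto simp: completely_metrizable_space_euclidean cl)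
    moreover have "\<Union>(range E) = UNIV"
      using eventually_bounded_pointwise by (auto simp: E_def)
    ultimately show False by simp
  qed
  then obtain n g r where g: "r > 0" "ball g r \<subseteq> E n"
    by (metis ex_in_conv mem_interior)
  have "norm (U t f) \<le> (4 * Suc n / r) * norm f" if t: "t \<in> {0..1 / Suc n}" for t f
  proof (cases "f = 0")
    case True
    then show ?thesis using t linear_0[OF bounded_linear.linear[OF bounded_linear[of t]]] by simp
  next
    case False
    interpret T: bounded_linear "U t" using t by (intro bounded_linear) simp
    \<comment> \<open>The scaled vector is the difference of g + c f and g. Half the radius keeps g
      + c f inside the open ball, so both points obey the bound defining \<open>E n\<close>.\<close>
    define c where "c = r / (2 * norm f)"
    have c: "c > 0" "c * norm f = r / 2" using False g by (auto simp: c_def)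
    have "g + c *\<^sub>R f \<in> E n" "g \<in> E n" using g c by (auto simp: subset_iff dist_norm)
    then have "norm (U t (g + c *\<^sub>R f)) \<le> Suc n" "norm (U t g) \<le> Suc n" using t by (auto simp: E_def)
    moreover have "norm (U t (c *\<^sub>R f)) \<le> norm (U t (g + c *\<^sub>R f)) + norm (U t g)"
      using norm_triangle_ineq4[of "U t (g + c *\<^sub>R f)" "U t g"] by (simp add: T.add)
    ultimately have "c * norm (U t f) \<le> 2 * Suc n" using c by (simp add: T.scaleR)
    then have "norm (U t f) \<le> 2 * Suc n / c" using c by (simp add: field_simps)
    also have "\<dots> = (4 * Suc n / r) * norm f" using False g by (simp add: c_def field_simps)
    finally show ?thesis .
  qed
  then show ?thesis by (intro exI[of _ "1 / Suc n"] conjI exI[of _ "4 * Suc n / r"]) auto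
qed

text \<open>A time up to (n + 1) d is reached by n + 1 steps of length at most d, and each step
  costs one factor.\<close>

lemma locally_bounded: "\<exists>B\<ge>0. \<forall>t\<in>{0..s}. \<forall>f. norm (U t f) \<le> B * norm f"
proof -
  obtain d B0 where d: "d > 0" and B0: "\<And>t f. t \<in> {0..d} \<Longrightarrow> norm (U t f) \<le> B0 * norm f"
    using bounded_near_0 by blast
  \<comment> \<open>The maximum with 1 makes the powers of B increase, so that times below d also
    satisfy the bounds for larger n.\<close>
  define B where "B = max B0 1"
  have B: "B \<ge> 1" "\<And>t f. t \<in> {0..d} \<Longrightarrow> norm (U t f) \<le> B * norm f"
    unfolding B_def by (auto intro!: order_trans[OF B0 mult_right_mono])
  have *: "norm (U t f) \<le> B ^ Suc n * norm f" if "t \<in> {0..Suc n * d}" for n t f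
    using that
  proof (induction n arbitrary: t f)
    case 0
    then show ?case using B by simp
  next
    case (Suc n)
    show ?case
    proof (cases "t \<le> d")
      case True
      have "norm (U t f) \<le> B * norm f" using Suc.prems True B by simp
      also have "\<dots> \<le> B ^ Suc (Suc n) * norm f"
        using B(1) self_le_power[of B "Suc (Suc n)"] by (intro mult_right_mono) auto
      finally show ?thesis .
    next
      case False
      have "U t f = U d (U (t - d) f)" using add[of d "t - d" f] d False by simp
      also have "norm \<dots> \<le> B * norm (U (t - d) f)" using B d by simp
      also have "norm (U (t - d) f) \<le> B ^ Suc n * norm f"
        using Suc.prems False by (intro Suc.IH) (auto simp: algebra_simps)
      finally show ?thesis using B by (simp add: mult_left_mono algebra_simps)
    qed
  qed
  obtain n :: nat where "s / d \<le> n" using real_arch_simple by blast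
  then have "s \<le> Suc n * d" using d by (simp add: field_simps)
  then have "\<forall>t\<in>{0..s}. \<forall>f. norm (U t f) \<le> B ^ Suc n * norm f" using *[of _ n] by auto
  moreover have "B ^ Suc n \<ge> 0" using B by simp
  ultimately show ?thesis by blast
qed

section \<open>Continuity of the orbits, jointly in time and vector\<close>

lemma U_0_U: "0 \<le> t \<Longrightarrow> U 0 (U t f) = U t f" "0 \<le> t \<Longrightarrow> U t (U 0 f) = U t f"
  using add[of 0 t f] add[of t 0 f] by simp_all

text \<open>Only right continuity at 0 is assumed. For a \<le> b the increment is \<open>U a\<close>
  applied to \<open>U (b - a) f - U 0 f\<close>: with the smaller time outside and a local bound,
  both one-sided limits follow from the one at 0.\<close>

lemma continuous: "continuous_on {0..} (\<lambda>t. U t f)"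
proof -
  have "continuous (at x within {0..}) (\<lambda>t. U t f)" if x: "x \<ge> 0" for x
  proof -
    obtain B where B: "B \<ge> 0" "\<And>t f. t \<in> {0..x + 1} \<Longrightarrow> norm (U t f) \<le> B * norm f"
      using locally_bounded by blast
    show ?thesis
      unfolding continuous_within_eps_delta
    proof (intro allI impI)
      fix e :: real assume e: "e > 0"
      define e' where "e' = e / (B + 1)"
      have e': "e' > 0" "B * e' < e" using e B by (auto simp: e'_def field_simps)
      have "eventually (\<lambda>t. dist (U t f) (U 0 f) < e') (at_right 0)"
        using continuous_at_0[of f] e' by (intro tendstoD)
      then obtain d where d: "d > 0" "\<And>t. 0 < t \<Longrightarrow> t < d \<Longrightarrow> dist (U t f) (U 0 f) < e'"
        unfolding eventually_at_right_field by auto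
      have d': "dist (U t f) (U 0 f) < e'" if "0 \<le> t" "t < d" for t
        using d(2)[of t] that e' by (cases "t = 0") auto
      have *: "dist (U b f) (U a f) < e" if ab: "0 \<le> a" "a \<le> b" "b < a + d" "a \<le> x + 1" for a b
      proof -
        interpret T: bounded_linear "U a" using ab by (intro bounded_linear)
        have "U b f = U a (U (b - a) f)" "U a f = U a (U 0 f)"
          using add[of a "b - a" f] ab U_0_U by auto
        then have "dist (U b f) (U a f) = norm (U a (U (b - a) f - U 0 f))"
          by (simp add: dist_norm T.diff)
        also have "\<dots> \<le> B * norm (U (b - a) f - U 0 f)" using B ab by simp
        also have "\<dots> \<le> B * e'" using d'[of "b - a"] ab B by (intro mult_left_mono) (auto simp: dist_norm)
        also have "\<dots> < e" by (rule e')
        finally show ?thesis .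
      qed
      show "\<exists>d>0. \<forall>x'\<in>{0..}. dist x' x < d \<longrightarrow> dist (U x' f) (U x f) < e"
      proof (intro exI[of _ "d"] conjI ballI impI)
        fix y assume y: "y \<in> {0..}" "dist y x < d"
        show "dist (U y f) (U x f) < e"
        proof (cases "y \<le> x")
          case True
          then show ?thesis using *[of y x] y x by (simp add: dist_commute dist_real_def)
        next
          case False
          then show ?thesis using *[of x y] y x by (simp add: dist_real_def)
        qed
      qed (rule d)
    qed
  qed
  then show ?thesis by (auto simp: continuous_on_eq_continuous_within)
qed

lemma tendsto_U:
  assumes \<tau>: "(\<tau> \<longlongrightarrow> t) F" and nn: "eventually (\<lambda>x. \<tau> x \<ge> 0) F" "t \<ge> 0" and y: "(y \<longlongrightarrow> z) F"
  shows "((\<lambda>x. U (\<tau> x) (y x)) \<longlongrightarrow> U t z) F"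
proof -
  obtain B where B: "B \<ge> 0" "\<And>s f. s \<in> {0..t + 1} \<Longrightarrow> norm (U s f) \<le> B * norm f"
    using locally_bounded by blast
  have 1: "((\<lambda>x. U (\<tau> x) z) \<longlongrightarrow> U t z) F"
    by (rule continuous_on_tendsto_compose[OF continuous \<tau>]) (use nn in auto)
  have ev: "eventually (\<lambda>x. \<tau> x < t + 1) F" using \<tau> by (rule order_tendstoD) simp
  have "((\<lambda>x. U (\<tau> x) (y x - z)) \<longlongrightarrow> 0) F"
  proof (rule Lim_null_comparison)
    show "eventually (\<lambda>x. norm (U (\<tau> x) (y x - z)) \<le> B * norm (y x - z)) F"
      using ev nn(1) by eventually_elim (auto intro: B)
    have "((\<lambda>x. B * norm (y x - z)) \<longlongrightarrow> B * norm (z - z)) F" by (intro tendsto_intros y)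
    then show "((\<lambda>x. B * norm (y x - z)) \<longlongrightarrow> 0) F" by simp
  qed
  with 1 have "((\<lambda>x. U (\<tau> x) z + U (\<tau> x) (y x - z)) \<longlongrightarrow> U t z + 0) F" by (intro tendsto_add)
  moreover have "eventually (\<lambda>x. U (\<tau> x) z + U (\<tau> x) (y x - z) = U (\<tau> x) (y x)) F"
    using nn(1) by eventually_elim (simp add: linear_diff bounded_linear.linear bounded_linear)
  ultimately show ?thesis by (simp add: tendsto_cong)
qed

text \<open>The fixed points of the idempotent \<open>U 0\<close> form the space on which the
  semigroup really acts; the two fixed point conditions confine the generator to it.\<close>

definition gen :: "('b \<times> 'b) set" where
  "gen = {(f, g). U 0 f = f \<and> U 0 g = g \<and> ((\<lambda>t. (U t f - f) /\<^sub>R t) \<longlongrightarrow> g) (at_right 0)}"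

lemma gen_invariant: 
  assumes "(f, g) \<in> gen" "0 \<le> s"
  shows "(U s f, U s g) \<in> gen"
proof -
  interpret T: bounded_linear "U s" using assms by (intro bounded_linear)
  have "((\<lambda>t. U s ((U t f - f) /\<^sub>R t)) \<longlongrightarrow> U s g) (at_right 0)"
    using assms by (intro T.tendsto) (auto simp: gen_def)
  moreover have "eventually (\<lambda>t. U s ((U t f - f) /\<^sub>R t) = (U t (U s f) - U s f) /\<^sub>R t) (at_right 0)"
    using eventually_at_right_less[of 0]
  proof eventually_elim
    case (elim t)
    have "U s (U t f) = U t (U s f)" using add[of s t f] add[of t s f] assms(2) elim by (simp add: add.commute)
    then show ?case by (simp add: T.scaleR T.diff)
  qed
  ultimately show ?thesis using assms(2) U_0_U by (simp add: gen_def tendsto_cong)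
qed

text \<open>Left and right quotients are handled together: with m = min t x and h = \<bar>t -
  x\<bar>, the quotient at x is \<open>U m\<close> applied to the quotient of length h at 0. Joint
  continuity then gives the limit.\<close>

lemma vector_derivative:
  assumes fg: "(f, g) \<in> gen" and x: "x \<ge> 0"
  shows "((\<lambda>t. U t f) has_vector_derivative U x g) (at x within {0..})"
proof -
  have f0: "U 0 f = f" and lim: "((\<lambda>t. (U t f - f) /\<^sub>R t) \<longlongrightarrow> g) (at_right 0)" using fg by (auto simp: gen_def)
  have ev: "eventually (\<lambda>t. t \<ge> 0 \<and> t \<noteq> x) (at x within {0..})"
    by (auto simp: eventually_at_filter)
  define q where "q h = (if h = 0 then g else (U h f - f) /\<^sub>R h)" for h
  have q0: "(q \<longlongrightarrow> g) (at_right 0)"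
    using lim by (rule Lim_transform_eventually) (auto simp: q_def eventually_at_filter)
  have q: "((\<lambda>t. q \<bar>t - x\<bar>) \<longlongrightarrow> g) (at x within {0..})"
  proof -
    have "filterlim (\<lambda>t. \<bar>t - x\<bar>) (at_right 0) (at x within {0..})"
      unfolding filterlim_at
    proof
      have "((\<lambda>t. \<bar>t - x\<bar>) \<longlongrightarrow> \<bar>x - x\<bar>) (at x within {0..})" by (intro tendsto_intros)
      then show "((\<lambda>t. \<bar>t - x\<bar>) \<longlongrightarrow> 0) (at x within {0..})" by simp
    qed (auto simp: eventually_at_filter)
    then show ?thesis by (rule filterlim_compose[OF q0])
  qed
  have m: "((\<lambda>t. min t x) \<longlongrightarrow> x) (at x within {0..})"
  proof -
    have "((\<lambda>t. min t x) \<longlongrightarrow> min x x) (at x within {0..})" by (intro tendsto_intros)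
    then show ?thesis by simp
  qed
  have "((\<lambda>t. U (min t x) (q \<bar>t - x\<bar>)) \<longlongrightarrow> U x g) (at x within {0..})"
    by (rule tendsto_U[OF m _ x q]) (use ev x in \<open>auto elim: eventually_mono\<close>)
  moreover have "eventually (\<lambda>t. U (min t x) (q \<bar>t - x\<bar>) = (U t f - U x f) /\<^sub>R (t - x)) (at x within {0..})"
    using ev
  proof eventually_elim
    case (elim t)
    interpret T: bounded_linear "U (min t x)" using elim x by (intro bounded_linear) simp
    have "U (min t x) (q \<bar>t - x\<bar>) = (U (min t x + \<bar>t - x\<bar>) f - U (min t x) f) /\<^sub>R \<bar>t - x\<bar>"
      using elim x by (simp add: q_def T.scaleR T.diff add)
    also have "\<dots> = (U t f - U x f) /\<^sub>R (t - x)"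
    proof (cases "t \<le> x")
      case True
      have "inverse (x - t) *\<^sub>R (U x f - U t f) = inverse (t - x) *\<^sub>R (U t f - U x f)"
        by (metis inverse_minus_eq minus_diff_eq scaleR_minus_left scaleR_minus_right)
      then show ?thesis using True by (simp add: min_def)
    qed (simp add: min_def)
    finally show ?case .
  qed
  ultimately show ?thesis
    by (simp add: has_vector_derivative_iff_quotient tendsto_cong)
qed

text \<open>Time averages of an orbit lie in the domain of the generator, because applying
  \<open>U t\<close> to an integral over time merely shifts the interval of integration; as the
  interval shrinks, the averages tend to f.\<close>

lemma gen_dense:
  assumes "U 0 f = f"
  shows "f \<in> closure (Domain gen)"
proof -
  define I where "I a = integral {0..a} (\<lambda>s. U s f)" for a
  have int: "(\<lambda>s. U s f) integrable_on {a..b}" if "0 \<le> a" for a b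
    using that by (intro integrable_continuous_real continuous_on_subset[OF continuous]) auto
  have I: "(I has_vector_derivative U a f) (at a within {0..})" if "a \<ge> 0" for a
  proof -
    have "(I has_vector_derivative U a f) (at a within {0..a + 1})"
      unfolding I_def using that
      by (intro integral_has_vector_derivative continuous_on_subset[OF continuous]) auto
    moreover have "at a within {0..a + 1} = at a within {0..}"
      using that by (intro at_within_nhd[of a "{..<a + 1}"]) auto
    ultimately show ?thesis by simp
  qed
  have shift: "U t (I h) = I (t + h) - I t" if "t \<ge> 0" "h \<ge> 0" for t h
  proof -
    interpret T: bounded_linear "U t" using that by (intro bounded_linear)
    have "U t (I h) = integral {0..h} (\<lambda>s. U t (U s f))"
      unfolding I_def using integral_linear[OF int[of 0 h] T.bounded_linear] by (simp add: o_def)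
    also have "\<dots> = integral {0..h} (\<lambda>s. U (s + t) f)"
      using that by (intro integral_cong) (metis add add.commute atLeastAtMost_iff)
    also have "\<dots> = integral {t..t + h} (\<lambda>s. U s f)"
      using integral_shift_cbox_plus[of 0 h "\<lambda>s. U s f" t] by (simp add: o_def add.commute)
    also have "\<dots> = I (t + h) - I t"
      using Henstock_Kurzweil_Integration.integral_combine[of 0 t "t + h" "\<lambda>s. U s f"] int[of 0] that
      by (simp add: I_def algebra_simps)
    finally show ?thesis .
  qed
  have at_right: "at_right 0 \<le> at 0 within {0::real..}" by (intro at_le) auto
  have dom: "I h \<in> Domain gen" if "h \<ge> 0" for h
  proof -
    have "U 0 (I h) = I h" using shift[of 0 h] that by (simp add: I_def)
    moreover have "U 0 (U h f - f) = U h f - f"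
      using U_0_U[of h f] that assms linear_diff[OF bounded_linear.linear[OF bounded_linear[of 0]]] by simp
    moreover have "((\<lambda>t. (U t (I h) - I h) /\<^sub>R t) \<longlongrightarrow> U h f - f) (at_right 0)"
    proof -
      have "((\<lambda>t. (I (h + t) - I h) /\<^sub>R ((h + t) - h)) \<longlongrightarrow> U h f) (at_right 0)"
      proof (rule filterlim_compose[OF I[OF that, unfolded has_vector_derivative_iff_quotient]])
        have "((\<lambda>t. h + t) \<longlongrightarrow> h + 0) (at_right 0)" by (intro tendsto_intros)
        then show "filterlim (\<lambda>t. h + t) (at h within {0..}) (at_right 0)"
          using that by (auto simp: filterlim_at eventually_at_filter)
      qed
      moreover have "((\<lambda>t. (I t - I 0) /\<^sub>R (t - 0)) \<longlongrightarrow> U 0 f) (at_right 0)"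
        using I[of 0] unfolding has_vector_derivative_iff_quotient by (rule tendsto_mono[OF at_right, rotated]) simp
      ultimately have "((\<lambda>t. (I (h + t) - I h) /\<^sub>R t - I t /\<^sub>R t) \<longlongrightarrow> U h f - f) (at_right 0)"
        using assms by (intro tendsto_diff) (auto simp: I_def)
      moreover have "eventually (\<lambda>t. (I (h + t) - I h) /\<^sub>R t - I t /\<^sub>R t = (U t (I h) - I h) /\<^sub>R t) (at_right 0)"
        using eventually_at_right_less[of 0]
        by eventually_elim (use shift that in \<open>simp add: scaleR_diff_right add.commute\<close>)
      ultimately show ?thesis by (simp add: tendsto_cong)
    qed
    ultimately show ?thesis by (auto simp: gen_def)
  qed
  have dom': "c *\<^sub>R I h \<in> Domain gen" if "h \<ge> 0" for c h
  proof -
    from dom[OF that] obtain g where g: "(I h, g) \<in> gen" by auto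
    then have "((\<lambda>t. c *\<^sub>R ((U t (I h) - I h) /\<^sub>R t)) \<longlongrightarrow> c *\<^sub>R g) (at_right 0)"
      by (intro tendsto_intros) (auto simp: gen_def)
    moreover have "eventually (\<lambda>t. c *\<^sub>R ((U t (I h) - I h) /\<^sub>R t) = (U t (c *\<^sub>R I h) - c *\<^sub>R I h) /\<^sub>R t) (at_right 0)"
      using eventually_at_right_less[of 0]
      by eventually_elim (simp add: linear_scale[OF bounded_linear.linear[OF bounded_linear]] algebra_simps)
    ultimately have "(c *\<^sub>R I h, c *\<^sub>R g) \<in> gen"
      using g by (simp add: gen_def tendsto_cong linear_scale[OF bounded_linear.linear[OF bounded_linear]])
    then show ?thesis by auto
  qed
  have "((\<lambda>t. I t /\<^sub>R t) \<longlongrightarrow> f) (at_right 0)"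
    using tendsto_mono[OF at_right I[of 0, unfolded has_vector_derivative_iff_quotient]] assms by (simp add: I_def)
  moreover have "eventually (\<lambda>t. I t /\<^sub>R t \<in> closure (Domain gen)) (at_right 0)"
    using eventually_at_right_less[of 0]
    by eventually_elim (intro subsetD[OF closure_subset] dom', simp)
  ultimately show ?thesis
    by (rule Lim_in_closed_set[OF closed_closure, rotated 2]) simp
qed

end

text \<open>For f in the common domain the curve s \<mapsto> \<open>U (t - s) (W s f)\<close> joins
  \<open>U t f\<close> to \<open>W t f\<close>. Its derivative vanishes, since the product rule
  yields \<open>U (t - s) (W s g)\<close> twice with opposite signs. Density extends the
  equality.\<close>

theorem banach_semigroup_unique:
  fixes U W :: "real \<Rightarrow> 'b::banach \<Rightarrow> 'b"
  assumes "banach_semigroup U" "banach_semigroup W"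
    and "U 0 = W 0" and gen: "banach_semigroup.gen U = banach_semigroup.gen W" and t: "t \<ge> 0"
  shows "U t = W t"
proof
  fix f0
  interpret U: banach_semigroup U by fact
  interpret W: banach_semigroup W by fact
  have eq: "U t f = W t f" if "(f, g) \<in> U.gen" for f g
  proof -
    have "((\<lambda>s. U (t - s) (W s f)) has_vector_derivative 0) (at s within {0..t})"
      if s: "s \<in> {0..t}" for s
      unfolding has_vector_derivative_iff_quotient
    proof -
      have fg: "(f, g) \<in> W.gen" using \<open>(f, g) \<in> U.gen\<close> gen by simp
      \<comment> \<open>The equality of the generators enters here: the orbit under W stays in the
        domain of the generator of U, so the outer factor can be differentiated too.\<close>
      have Ws: "(W s f, W s g) \<in> U.gen" using W.gen_invariant[OF fg, of s] s gen by simp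
      let ?F = "at s within {0..t}"
      have r: "(\<lambda>r. t - r) \<midarrow>s\<rightarrow> t - s" by (intro tendsto_intros)
      then have r: "((\<lambda>r. t - r) \<longlongrightarrow> t - s) ?F" by (rule tendsto_within_subset) simp
      have ev: "eventually (\<lambda>r. r \<in> {0..t} \<and> r \<noteq> s) ?F" by (auto simp: eventually_at_filter)
      have 0: "((\<lambda>r. (W r f - W s f) /\<^sub>R (r - s)) \<longlongrightarrow> W s g) ?F"
        using W.vector_derivative[OF fg, of s] s unfolding has_vector_derivative_iff_quotient
        by (auto intro: tendsto_within_subset)
      have 1: "((\<lambda>r. U (t - r) ((W r f - W s f) /\<^sub>R (r - s))) \<longlongrightarrow> U (t - s) (W s g)) ?F"
        by (rule U.tendsto_U[where \<tau> = "\<lambda>r. t - r" and y = "\<lambda>r. (W r f - W s f) /\<^sub>R (r - s)", OF r _ _ 0])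
           (use ev s in \<open>auto elim: eventually_mono\<close>)
      have 2: "((\<lambda>r. (U (t - r) (W s f) - U (t - s) (W s f)) /\<^sub>R ((t - r) - (t - s))) \<longlongrightarrow> U (t - s) (W s g)) ?F"
      proof (rule filterlim_compose[where g = "\<lambda>r. (U r (W s f) - U (t - s) (W s f)) /\<^sub>R (r - (t - s))"])
        show "((\<lambda>r. (U r (W s f) - U (t - s) (W s f)) /\<^sub>R (r - (t - s))) \<longlongrightarrow> U (t - s) (W s g)) (at (t - s) within {0..})"
          using U.vector_derivative[OF Ws, of "t - s"] s unfolding has_vector_derivative_iff_quotient by simp
        show "filterlim (\<lambda>r. t - r) (at (t - s) within {0..}) ?F"
          using r ev by (auto simp: filterlim_at elim: eventually_mono)
      qed
      have "((\<lambda>r. U (t - r) ((W r f - W s f) /\<^sub>R (r - s)) -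
          (U (t - r) (W s f) - U (t - s) (W s f)) /\<^sub>R ((t - r) - (t - s))) \<longlongrightarrow> 0) ?F"
        using tendsto_diff[OF 1 2] by simp
      moreover have "eventually (\<lambda>r. U (t - r) ((W r f - W s f) /\<^sub>R (r - s)) -
          (U (t - r) (W s f) - U (t - s) (W s f)) /\<^sub>R ((t - r) - (t - s)) =
          (U (t - r) (W r f) - U (t - s) (W s f)) /\<^sub>R (r - s)) ?F"
        using ev
      proof eventually_elim
        case (elim r)
        interpret T: bounded_linear "U (t - r)" using elim by (intro U.bounded_linear) simp
        have "inverse ((t - r) - (t - s)) = - inverse (r - s)" by (simp flip: inverse_minus_eq)
        then show ?case by (simp add: T.scaleR T.diff scaleR_diff_right)
      qed
      ultimately show "((\<lambda>r. (U (t - r) (W r f) - U (t - s) (W s f)) /\<^sub>R (r - s)) \<longlongrightarrow> 0) ?F"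
        by (simp add: tendsto_cong)
    qed
    then obtain c where "\<And>s. s \<in> {0..t} \<Longrightarrow> U (t - s) (W s f) = c"
      by (rule has_vector_derivative_zero_constant[rotated]) auto
    then have "U (t - 0) (W 0 f) = U (t - t) (W t f)" using t by (metis atLeastAtMost_iff order_refl)
    moreover have "W 0 f = f" using that gen by (auto simp: W.gen_def)
    moreover have "U 0 (W t f) = W t f" using W.U_0_U t \<open>U 0 = W 0\<close> by simp
    ultimately show ?thesis by simp
  qed
  have "closed {f. U t f = W t f}"
    using t by (intro closed_Collect_eq bounded_linear.continuous_on[OF U.bounded_linear]
        bounded_linear.continuous_on[OF W.bounded_linear] continuous_intros)
  then have "closure (Domain U.gen) \<subseteq> {f. U t f = W t f}"
    using eq by (intro closure_minimal) auto
  \<comment> \<open>An arbitrary vector is first projected by \<open>U 0\<close>, as density holds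
    only among the fixed points of this projection.\<close>
  moreover have "U 0 f0 \<in> closure (Domain U.gen)" by (intro U.gen_dense U.U_0_U) simp
  ultimately have "U t (U 0 f0) = W t (U 0 f0)" by auto
  then show "U t f0 = W t f0" using U.U_0_U(2)[OF t] W.U_0_U(2)[OF t] \<open>U 0 = W 0\<close> by simp
qed

section \<open>The space \<open>L\<^sup>2\<close> and the reflection\<close>

lemma l2_fun_measurable [measurable]: "l2_fun f \<in> borel_measurable lebesgue"
  by (intro sq_integrable_measurable sq_integrable_l2_fun)

lemma l2_eqI: "(AE x in lebesgue. l2_fun f x = l2_fun g x) \<Longrightarrow> f = g"
  using to_l2_eq_iff[OF sq_integrable_l2_fun sq_integrable_l2_fun, of f g] by simp

lemma l2_fun_add: "AE x in lebesgue. l2_fun (f + g) x = l2_fun f x + l2_fun g x"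
  using l2_fun_to_l2[OF sq_integrable_add[OF sq_integrable_l2_fun[of f] sq_integrable_l2_fun[of g]]]
  by (simp add: to_l2_add sq_integrable_l2_fun)

lemma l2_fun_scaleR: "AE x in lebesgue. l2_fun (r *\<^sub>R f) x = r *\<^sub>R l2_fun f x"
  using l2_fun_to_l2[OF sq_integrable_scaleR[OF sq_integrable_l2_fun[of f]]]
  by (simp add: to_l2_scaleR sq_integrable_l2_fun)

lemma l2_fun_0: "AE x in lebesgue. l2_fun 0 x = 0"
  using l2_fun_to_l2[OF sq_integrable_0] by simp

lemma to_l2_add_of_real_mult:
  assumes "sq_integrable f" "sq_integrable g"
  shows "to_l2 (\<lambda>x. f x + complex_of_real c * g x) = to_l2 f + c *\<^sub>R to_l2 g"
  using to_l2_add[OF assms(1) sq_integrable_scaleR[OF assms(2), of c]] to_l2_scaleR[OF assms(2), of c]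
  by (simp add: scaleR_conv_of_real)

lemma norm_to_l2_mono:
  assumes "sq_integrable g" "f \<in> borel_measurable lebesgue" "AE x in lebesgue. cmod (f x) \<le> C * cmod (g x)" "C \<ge> 0"
  shows "norm (to_l2 f) \<le> C * norm (to_l2 g)"
proof -
  have f: "sq_integrable f" by (rule sq_integrable_dominated[OF assms(1,2,3)])
  have "(LINT x|lebesgue. (cmod (f x))\<^sup>2) \<le> (LINT x|lebesgue. C\<^sup>2 * (cmod (g x))\<^sup>2)"
  proof (rule integral_mono_AE)
    show "AE x in lebesgue. (cmod (f x))\<^sup>2 \<le> C\<^sup>2 * (cmod (g x))\<^sup>2"
      using assms(3)
    proof eventually_elim
      case (elim x)
      then have "(cmod (f x))\<^sup>2 \<le> (C * cmod (g x))\<^sup>2" by (intro power_mono) auto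
      then show ?case by (simp add: power_mult_distrib)
    qed
  qed (use f assms(1) in \<open>auto dest: sq_integrableD\<close>)
  then have "norm (to_l2 f) \<le> sqrt (C\<^sup>2 * (LINT x|lebesgue. (cmod (g x))\<^sup>2))"
    using f by (simp add: norm_to_l2)
  then show ?thesis using assms by (simp add: norm_to_l2 real_sqrt_mult)
qed

lemma norm_to_l2_sq:
  assumes "sq_integrable f"
  shows "(\<integral>\<^sup>+x. ennreal ((cmod (f x))\<^sup>2) \<partial>lebesgue) = ennreal ((norm (to_l2 f))\<^sup>2)"
  using assms sq_integrableD[OF assms] by (simp add: norm_to_l2 nn_integral_eq_integral)

text \<open>Riesz--Fischer: a rapidly converging subsequence is dominated by a square-integrable function.\<close>

lemma l2_convergent_of_summable:
  fixes X :: "nat \<Rightarrow> 'a::euclidean_space l2"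
  assumes "\<And>n. norm (X (Suc n) - X n) \<le> (1/2) ^ n"
  shows "convergent X"
proof -
  define f where "f n = l2_fun (X n)" for n
  \<comment> \<open>The partial sums of moduli are real, but are stored as complex numbers so that
    \<open>sq_integrable\<close> and \<open>to_l2\<close> apply to them.\<close>
  define P where "P N x = complex_of_real (\<Sum>n<N. cmod (f (Suc n) x - f n x))" for N x
  have fs: "sq_integrable (f n)" for n by (simp add: f_def sq_integrable_l2_fun)
  have [measurable]: "f n \<in> borel_measurable lebesgue" for n by (simp add: f_def)
  have d: "sq_integrable (\<lambda>x. complex_of_real (cmod (f (Suc n) x - f n x)))" for n
    by (rule sq_integrable_dominated[OF sq_integrable_diff[OF fs[of "Suc n"] fs[of n]], where C = 1]) auto
  have nd: "norm (to_l2 (\<lambda>x. complex_of_real (cmod (f (Suc n) x - f n x)))) \<le> (1/2) ^ n" for n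
    using norm_to_l2_mono[OF sq_integrable_diff[OF fs[of "Suc n"] fs[of n]],
        of "\<lambda>x. complex_of_real (cmod (f (Suc n) x - f n x))" 1] assms[of n]
    by (simp add: to_l2_diff[OF fs fs]) (simp add: f_def)
  have P: "sq_integrable (P N) \<and> norm (to_l2 (P N)) \<le> (\<Sum>n<N. (1/2) ^ n)" for N
  proof (induction N)
    case 0
    then show ?case by (simp add: P_def[abs_def] sq_integrable_0)
  next
    case (Suc N)
    have "P (Suc N) = (\<lambda>x. P N x + complex_of_real (cmod (f (Suc N) x - f N x)))"
      by (simp add: P_def[abs_def])
    then show ?case
      using Suc d[of N] nd[of N] norm_triangle_ineq[of "to_l2 (P N)" "to_l2 (\<lambda>x. complex_of_real (cmod (f (Suc N) x - f N x)))"]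
      by (simp add: sq_integrable_add to_l2_add)
  qed
  have P2: "norm (to_l2 (P N)) \<le> 2" for N
  proof -
    have "(\<Sum>n<N. (1/2) ^ n) \<le> (2::real)" by (simp add: sum_gp_strict)
    then show ?thesis using P[of N] by linarith
  qed
  have [measurable]: "P N \<in> borel_measurable lebesgue" for N using P sq_integrable_measurable by blast
  have cP: "cmod (P N x) = (\<Sum>n<N. cmod (f (Suc n) x - f n x))" for N x
    unfolding P_def norm_of_real by (intro abs_of_nonneg sum_nonneg) simp
  have Pmono: "cmod (P N x) \<le> cmod (P (Suc N) x)" for N x
    by (simp add: cP)
  \<comment> \<open>The supremum is taken in the extended reals, so that monotone convergence
    applies before finiteness is known. The integral is at most 4, the square of the norm bound
    2.\<close>
  define G where "G x = (SUP N. ennreal ((cmod (P N x))\<^sup>2))" for x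
  have [measurable]: "G \<in> borel_measurable lebesgue" unfolding G_def by measurable
  have "(\<integral>\<^sup>+x. G x \<partial>lebesgue) = (SUP N. \<integral>\<^sup>+x. ennreal ((cmod (P N x))\<^sup>2) \<partial>lebesgue)"
    unfolding G_def
    by (rule nn_integral_monotone_convergence_SUP)
       (auto intro!: incseq_SucI le_funI ennreal_leI power_mono Pmono)
  also have "\<dots> \<le> ennreal 4"
  proof (intro SUP_least)
    fix N
    have "(norm (to_l2 (P N)))\<^sup>2 \<le> 2\<^sup>2" by (intro power_mono P2) simp
    then have "ennreal ((norm (to_l2 (P N)))\<^sup>2) \<le> ennreal 4" by (intro ennreal_leI) simp
    then show "(\<integral>\<^sup>+x. ennreal ((cmod (P N x))\<^sup>2) \<partial>lebesgue) \<le> ennreal 4" by (simp add: norm_to_l2_sq P)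
  qed
  finally have Gfin: "(\<integral>\<^sup>+x. G x \<partial>lebesgue) < \<infinity>" by (auto simp: less_top[symmetric] top_unique)
  then have GAE: "AE x in lebesgue. G x \<noteq> \<infinity>" by (intro nn_integral_PInf_AE) auto
  have Pb: "cmod (P N x) \<le> sqrt (enn2real (G x))" if "G x \<noteq> \<infinity>" for N x
  proof -
    have "ennreal ((cmod (P N x))\<^sup>2) \<le> G x" unfolding G_def by (rule SUP_upper) simp
    also have "G x = ennreal (enn2real (G x))" using that by (simp add: less_top)
    finally have "(cmod (P N x))\<^sup>2 \<le> enn2real (G x)" by (subst (asm) ennreal_le_iff) auto
    then show ?thesis by (rule real_le_rsqrt)
  qed
  define w where "w x = complex_of_real (cmod (f 0 x) + sqrt (enn2real (G x)))" for x
  have "integrable lebesgue (\<lambda>x. enn2real (G x))"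
  proof (rule integrableI_bounded)
    have "(\<integral>\<^sup>+x. ennreal (norm (enn2real (G x))) \<partial>lebesgue) \<le> (\<integral>\<^sup>+x. G x \<partial>lebesgue)"
      by (intro nn_integral_mono) (auto simp: ennreal_enn2real_if)
    with Gfin show "(\<integral>\<^sup>+x. ennreal (norm (enn2real (G x))) \<partial>lebesgue) < \<infinity>" by order
  qed simp
  then have "sq_integrable (\<lambda>x. complex_of_real (sqrt (enn2real (G x))))" by (simp add: sq_integrable_def)
  moreover have "sq_integrable (\<lambda>x. complex_of_real (cmod (f 0 x)))"
    by (rule sq_integrable_dominated[OF fs[of 0], where C = 1]) auto
  ultimately have w: "sq_integrable w" using sq_integrable_add unfolding w_def by (simp add: add.commute)
  have fb: "cmod (f N x - f 0 x) \<le> cmod (P N x)" for N x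
  proof -
    have "f N x - f 0 x = (\<Sum>n<N. f (Suc n) x - f n x)" by (rule sum_lessThan_telescope[of "\<lambda>n. f n x", symmetric])
    then have "cmod (f N x - f 0 x) \<le> (\<Sum>n<N. cmod (f (Suc n) x - f n x))" by (simp add: norm_sum)
    then show ?thesis by (simp add: cP)
  qed
  \<comment> \<open>Where G is infinite the telescoping series need not converge. This is a null
    set, and 0 is a default value there.\<close>
  define l where "l x = (if G x \<noteq> \<infinity> then lim (\<lambda>n. f n x) else 0)" for x
  have conv: "(\<lambda>n. f n x) \<longlonglongrightarrow> l x" if G: "G x \<noteq> \<infinity>" for x
  proof -
    have "summable (\<lambda>n. f (Suc n) x - f n x)"
    proof (rule summable_norm_cancel, rule summableI_nonneg_bounded)
      show "(\<Sum>n<N. norm (f (Suc n) x - f n x)) \<le> sqrt (enn2real (G x))" for N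
        using Pb[OF G, of N] by (simp add: cP)
    qed simp
    then have "convergent (\<lambda>n. \<Sum>i<n. f (Suc i) x - f i x)" by (rule summable_iff_convergent[THEN iffD1])
    then have "convergent (\<lambda>n. f n x)"
      unfolding sum_lessThan_telescope[of "\<lambda>n. f n x"] by (simp add: convergent_diff_const_right_iff)
    then show ?thesis using G by (simp add: l_def convergent_LIMSEQ_iff)
  qed
  have "(\<lambda>n. to_l2 (f n)) \<longlonglongrightarrow> to_l2 l"
  proof (rule to_l2_dominated_convergence(3)[OF w, where C = 1])
    show "l \<in> borel_measurable lebesgue" unfolding l_def by measurable
    show "AE x in lebesgue. (\<lambda>n. f n x) \<longlonglongrightarrow> l x" using GAE by eventually_elim (rule conv)
    show "AE x in lebesgue. cmod (f n x) \<le> 1 * cmod (w x)" for n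
      using GAE
    proof eventually_elim
      case (elim x)
      have "cmod (f n x) \<le> cmod (f 0 x) + cmod (f n x - f 0 x)" by (rule norm_triangle_sub)
      also have "\<dots> \<le> cmod (f 0 x) + sqrt (enn2real (G x))" using fb[of n x] Pb[OF elim, of n] by simp
      also have "\<dots> = cmod (w x)" by (simp only: w_def norm_of_real) (simp add: abs_of_nonneg)
      finally show ?case by simp
    qed
  qed simp
  then show ?thesis unfolding convergent_def by (auto simp: f_def)
qed

instance l2 :: (euclidean_space) banach
proof
  fix X :: "nat \<Rightarrow> 'a l2"
  assume X: "Cauchy X"
  have "\<forall>n. \<exists>N. \<forall>i\<ge>N. \<forall>j\<ge>N. norm (X i - X j) < (1/2) ^ n"
    using X unfolding Cauchy_iff by auto
  then obtain N where N: "\<And>n i j. i \<ge> N n \<Longrightarrow> j \<ge> N n \<Longrightarrow> norm (X i - X j) < (1/2) ^ n" by metis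
  \<comment> \<open>Summing the thresholds puts both \<open>r n\<close> and \<open>r (Suc n)\<close>
    beyond \<open>N n\<close>, and the added n makes r strictly increasing.\<close>
  define r where "r n = (\<Sum>i\<le>n. N i) + n" for n
  have r: "strict_mono r" by (auto simp: strict_mono_Suc_iff r_def)
  have "N n \<le> r n" for n unfolding r_def by (intro trans_le_add1 member_le_sum) auto
  moreover have "N n \<le> r (Suc n)" for n unfolding r_def by (intro trans_le_add1 member_le_sum) auto
  ultimately have "norm (X (r (Suc n)) - X (r n)) \<le> (1/2) ^ n" for n
    using N by (simp add: less_imp_le)
  then have "convergent (X \<circ> r)" by (intro l2_convergent_of_summable) simp
  then obtain l where "(X \<circ> r) \<longlonglongrightarrow> l" by (auto simp: convergent_def)
  then have "X \<longlonglongrightarrow> l" by (rule Cauchy_converges_subseq[OF X r])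
  then show "convergent X" by (auto simp: convergent_def)
qed

section \<open>The Cauchy-Schwarz inequality\<close>

lemma l2_Cauchy_Schwarz:
  assumes f: "sq_integrable f" and g: "sq_integrable g"
  shows "integrable lebesgue (\<lambda>x. f x * g x)"
    and "cmod (LINT x|lebesgue. f x * g x) \<le> norm (to_l2 f) * norm (to_l2 g)"
proof -
  note [measurable] = sq_integrable_measurable[OF f] sq_integrable_measurable[OF g]
  define a b where "a = norm (to_l2 f)" and "b = norm (to_l2 g)"
  have fi: "integrable lebesgue (\<lambda>x. (cmod (f x))\<^sup>2)" and gi: "integrable lebesgue (\<lambda>x. (cmod (g x))\<^sup>2)"
    using f g by (auto dest: sq_integrableD)
  show int: "integrable lebesgue (\<lambda>x. f x * g x)"
  proof (rule Bochner_Integration.integrable_bound)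
    show "integrable lebesgue (\<lambda>x. (cmod (f x))\<^sup>2 + (cmod (g x))\<^sup>2)" using fi gi by simp
    have "cmod (f x * g x) \<le> (cmod (f x))\<^sup>2 + (cmod (g x))\<^sup>2" for x
      unfolding norm_mult using sum_squares_bound[of "cmod (f x)" "cmod (g x)"]
        mult_nonneg_nonneg[OF norm_ge_zero[of "f x"] norm_ge_zero[of "g x"]] by linarith
    then show "AE x in lebesgue. norm (f x * g x) \<le> norm ((cmod (f x))\<^sup>2 + (cmod (g x))\<^sup>2)" by simp
  qed simp
  have "(LINT x|lebesgue. cmod (f x * g x)) \<le> a * b"
  proof (cases "a = 0 \<or> b = 0")
    case True
    then have "AE x in lebesgue. f x = 0 \<or> g x = 0"
      using to_l2_eq_iff[OF f sq_integrable_0] to_l2_eq_iff[OF g sq_integrable_0]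
      by (auto simp: a_def b_def elim: eventually_mono)
    then have "(LINT x|lebesgue. cmod (f x * g x)) = (LINT x|(lebesgue :: 'a measure). 0)"
      by (intro integral_cong_AE) (auto elim: eventually_mono)
    then show ?thesis by (simp add: a_def b_def)
  next
    case False
    then have pos: "a > 0" "b > 0" by (auto simp: a_def b_def)
    \<comment> \<open>Young's inequality with weights chosen such that both terms on the right have
      integral a b / 2.\<close>
    have "cmod (f x * g x) \<le> b / (2 * a) * (cmod (f x))\<^sup>2 + a / (2 * b) * (cmod (g x))\<^sup>2" for x
    proof -
      have "0 \<le> (b * cmod (f x) - a * cmod (g x))\<^sup>2 / (2 * a * b)" using pos by simp
      also have "\<dots> = b / (2 * a) * (cmod (f x))\<^sup>2 + a / (2 * b) * (cmod (g x))\<^sup>2 - cmod (f x) * cmod (g x)"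
        using pos by (simp add: field_simps power2_eq_square)
      finally show ?thesis by (simp add: norm_mult)
    qed
    then have "(LINT x|lebesgue. cmod (f x * g x)) \<le>
        (LINT x|lebesgue. b / (2 * a) * (cmod (f x))\<^sup>2 + a / (2 * b) * (cmod (g x))\<^sup>2)"
      using fi gi int by (intro integral_mono) auto
    also have "\<dots> = b / (2 * a) * a\<^sup>2 + a / (2 * b) * b\<^sup>2"
      using fi gi f g by (simp add: a_def b_def norm_to_l2)
    also have "\<dots> = a * b" using pos by (simp add: field_simps power2_eq_square)
    finally show ?thesis .
  qed
  then show "cmod (LINT x|lebesgue. f x * g x) \<le> norm (to_l2 f) * norm (to_l2 g)"
    using order_trans[OF integral_norm_bound[of lebesgue "\<lambda>x. f x * g x"]] unfolding a_def b_def by blast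
qed

section \<open>Multiplication operators, cutoffs and pairings\<close>

lemma sq_integrable_bounded_mult:
  assumes "sq_integrable f" "m \<in> borel_measurable lebesgue" "\<And>x. cmod (m x) \<le> C"
  shows "sq_integrable (\<lambda>x. m x * f x)"
  using assms sq_integrable_measurable[OF assms(1)]
  by (intro sq_integrable_dominated[OF assms(1), where C = C]) (auto simp: norm_mult intro!: mult_right_mono)

lemma l2_fun_mult:
  assumes "m \<in> borel_measurable lebesgue" "\<And>x. cmod (m x) \<le> C"
  shows "AE x in lebesgue. l2_fun (l2_mult m f) x = m x * l2_fun f x"
  unfolding l2_mult_def by (rule l2_fun_to_l2[OF sq_integrable_bounded_mult[OF sq_integrable_l2_fun assms]])

lemma bounded_linear_l2_mult:
  assumes m: "m \<in> borel_measurable lebesgue" "\<And>x. cmod (m x) \<le> C"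
  shows "bounded_linear (l2_mult m)"
proof (rule bounded_linear_intro[where K = C])
  show "l2_mult m (f + g) = l2_mult m f + l2_mult m g" for f g
    by (rule l2_eqI) (use l2_fun_mult[OF m, of "f + g"] l2_fun_mult[OF m, of f] l2_fun_mult[OF m, of g]
      l2_fun_add[of f g] l2_fun_add[of "l2_mult m f" "l2_mult m g"] in \<open>eventually_elim, simp add: algebra_simps\<close>)
  show "l2_mult m (r *\<^sub>R f) = r *\<^sub>R l2_mult m f" for r f
    by (rule l2_eqI) (use l2_fun_mult[OF m, of "r *\<^sub>R f"] l2_fun_mult[OF m, of f] l2_fun_scaleR[of r f] l2_fun_scaleR[of r "l2_mult m f"] in \<open>eventually_elim, simp add: algebra_simps\<close>)
  show "norm (l2_mult m f) \<le> norm f * C" for f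
  proof -
    have "AE x in lebesgue. cmod (m x * l2_fun f x) \<le> C * cmod (l2_fun f x)"
      using m(2) by (auto simp: norm_mult intro!: mult_right_mono)
    moreover have "C \<ge> 0" using order_trans[OF norm_ge_zero m(2)] .
    moreover have "(\<lambda>x. m x * l2_fun f x) \<in> borel_measurable lebesgue" using m(1) by measurable
    ultimately show ?thesis
      using norm_to_l2_mono[OF sq_integrable_l2_fun[of f]] by (simp add: l2_mult_def mult.commute[of _ C])
  qed
qed

lemma l2_fun_const_mult: "AE x in lebesgue. l2_fun (l2_mult (\<lambda>_. c) f) x = c * l2_fun f x"
  by (rule l2_fun_mult[where C = "cmod c"]) auto

lemma
  assumes S: "S \<in> sets lebesgue"
  shows bounded_linear_cutoff: "bounded_linear (cutoff S)"
    and l2_fun_cutoff: "AE x in lebesgue. l2_fun (cutoff S f) x = indicator S x * l2_fun f x"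
    and norm_cutoff_le: "norm (cutoff S f) \<le> norm f"
    and cutoff_in_L2_on: "cutoff S f \<in> L2_on S"
proof -
  have m: "(indicator S :: _ \<Rightarrow> complex) \<in> borel_measurable lebesgue" "cmod (indicator S x) \<le> 1" for x
    using S by (auto simp: indicator_def)
  show "bounded_linear (cutoff S)" by (rule bounded_linear_l2_mult[OF m])
  show ae: "AE x in lebesgue. l2_fun (cutoff S f) x = indicator S x * l2_fun f x" by (rule l2_fun_mult[OF m])
  show "norm (cutoff S f) \<le> norm f"
    using norm_to_l2_mono[OF sq_integrable_l2_fun[of f], of "\<lambda>x. indicator S x * l2_fun f x" 1] m
    by (simp add: l2_mult_def norm_mult mult_left_le_one_le)
  show "cutoff S f \<in> L2_on S" unfolding L2_on_def using ae by (auto elim: eventually_mono)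
qed

lemma L2_on_iff_cutoff: "S \<in> sets lebesgue \<Longrightarrow> f \<in> L2_on S \<longleftrightarrow> cutoff S f = f"
proof
  assume S: "S \<in> sets lebesgue" and f: "f \<in> L2_on S"
  have "AE x in lebesgue. x \<notin> S \<longrightarrow> l2_fun f x = 0" using f by (simp add: L2_on_def)
  then show "cutoff S f = f"
    by (rule l2_eqI[OF eventually_elim2[OF _ l2_fun_cutoff[OF S, of f]]]) (auto simp: indicator_def)
next
  assume "S \<in> sets lebesgue" "cutoff S f = f"
  then show "f \<in> L2_on S" using cutoff_in_L2_on[of S f] by simp
qed

lemma cutoff_cutoff:
  assumes "S \<in> sets lebesgue" "S' \<in> sets lebesgue"
  shows "cutoff S (cutoff S' f) = cutoff (S \<inter> S') f"
  by (rule l2_eqI) (use l2_fun_cutoff[OF assms(1), of "cutoff S' f"] l2_fun_cutoff[OF assms(2), of f]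
    l2_fun_cutoff[OF sets.Int[OF assms], of f] in \<open>eventually_elim, auto simp: indicator_def\<close>)

lemma L2_on_mono: "S \<subseteq> S' \<Longrightarrow> f \<in> L2_on S \<Longrightarrow> f \<in> L2_on S'"
  by (auto simp: L2_on_def elim: eventually_mono)

lemma cutoff_to_l2:
  assumes "S \<in> sets lebesgue" "sq_integrable f"
  shows "cutoff S (to_l2 f) = to_l2 (\<lambda>x. indicator S x * f x)"
proof -
  have s: "sq_integrable (\<lambda>x. indicator S x * f x)"
    using assms by (intro sq_integrable_bounded_mult[where C = 1]) (auto simp: indicator_def)
  show ?thesis
    by (rule l2_eqI) (use l2_fun_cutoff[OF assms(1), of "to_l2 f"] l2_fun_to_l2[OF assms(2)] l2_fun_to_l2[OF s] in \<open>eventually_elim, simp\<close>)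
qed

lemma closed_subspace_L2_on:
  assumes "S \<in> sets lebesgue"
  shows "subspace (L2_on S)" "closed (L2_on S)"
proof -
  interpret bounded_linear "cutoff S" by (rule bounded_linear_cutoff[OF assms])
  have *: "L2_on S = {f. cutoff S f = f}" using L2_on_iff_cutoff[OF assms] by auto
  show "subspace (L2_on S)" unfolding * by (auto simp: subspace_def zero add scaleR)
  show "closed (L2_on S)" unfolding * by (intro closed_Collect_eq continuous_on continuous_intros)
qed

lemma cnj_measurable [measurable]: "cnj \<in> borel_measurable borel"
  by (intro borel_measurable_continuous_onI continuous_intros)

text \<open>The pairing without conjugation. Weak derivatives are defined by it, whereas the forms
  and the operators use \<open>l2_inner\<close>.\<close>

definition l2_bil :: "'a::euclidean_space l2 \<Rightarrow> 'a l2 \<Rightarrow> complex" where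
  "l2_bil f g = (LINT x|lebesgue. l2_fun f x * l2_fun g x)"

text \<open>\<sigma> is the identity for \<open>l2_bil\<close> and complex conjugation for
  \<open>l2_inner\<close>; one proof covers both.\<close>

lemma bounded_bilinear_l2_pairing:
  assumes "bounded_linear \<sigma>" "\<And>z. cmod (\<sigma> z) = cmod z"
  shows "bounded_bilinear (\<lambda>f g. LINT x|lebesgue. l2_fun f x * \<sigma> (l2_fun g x))"
proof -
  interpret \<sigma>: bounded_linear \<sigma> by fact
  have [measurable]: "\<sigma> \<in> borel_measurable borel"
    by (intro borel_measurable_continuous_onI \<sigma>.continuous_on continuous_intros)
  have s: "sq_integrable (\<lambda>x. \<sigma> (l2_fun g x))" for g :: "'a l2"
    using assms(2) by (intro sq_integrable_dominated[OF sq_integrable_l2_fun[of g], where C = 1]) auto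
  have ns: "norm (to_l2 (\<lambda>x. \<sigma> (l2_fun g x))) = norm g" for g :: "'a l2"
    using assms(2) by (simp add: norm_to_l2[OF s] norm_l2_eq[of g])
  note int = l2_Cauchy_Schwarz(1)[OF sq_integrable_l2_fun s]
  have m: "(\<lambda>x. l2_fun f x * \<sigma> (l2_fun g x)) \<in> borel_measurable lebesgue" for f g :: "'a l2" by measurable
  show ?thesis
  proof
    fix f f' g g' :: "'a l2" and r :: real
    show "(LINT x|lebesgue. l2_fun (f + f') x * \<sigma> (l2_fun g x)) =
        (LINT x|lebesgue. l2_fun f x * \<sigma> (l2_fun g x)) + (LINT x|lebesgue. l2_fun f' x * \<sigma> (l2_fun g x))"
      using l2_fun_add[of f f']
      by (subst Bochner_Integration.integral_add[OF int int, symmetric], intro integral_cong_AE m)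
         (auto simp: algebra_simps elim!: eventually_mono)
    show "(LINT x|lebesgue. l2_fun f x * \<sigma> (l2_fun (g + g') x)) =
        (LINT x|lebesgue. l2_fun f x * \<sigma> (l2_fun g x)) + (LINT x|lebesgue. l2_fun f x * \<sigma> (l2_fun g' x))"
      using l2_fun_add[of g g']
      by (subst Bochner_Integration.integral_add[OF int int, symmetric], intro integral_cong_AE m)
         (auto simp: algebra_simps \<sigma>.add elim!: eventually_mono)
    show "(LINT x|lebesgue. l2_fun (r *\<^sub>R f) x * \<sigma> (l2_fun g x)) = r *\<^sub>R (LINT x|lebesgue. l2_fun f x * \<sigma> (l2_fun g x))"
      using l2_fun_scaleR[of r f]
      by (subst integral_scaleR_right[symmetric], intro integral_cong_AE m) (auto elim!: eventually_mono)
    show "(LINT x|lebesgue. l2_fun f x * \<sigma> (l2_fun (r *\<^sub>R g) x)) = r *\<^sub>R (LINT x|lebesgue. l2_fun f x * \<sigma> (l2_fun g x))"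
      using l2_fun_scaleR[of r g]
      by (subst integral_scaleR_right[symmetric], intro integral_cong_AE m) (auto simp: \<sigma>.scaleR elim!: eventually_mono)
    show "\<exists>K. \<forall>f g. norm (LINT x|lebesgue. l2_fun f x * \<sigma> (l2_fun g x)) \<le> norm (f :: 'a l2) * norm g * K"
      using l2_Cauchy_Schwarz(2)[OF sq_integrable_l2_fun s] by (intro exI[of _ 1]) (simp add: ns)
  qed
qed

lemma bounded_bilinear_l2_bil: "bounded_bilinear l2_bil"
  unfolding l2_bil_def[abs_def] by (rule bounded_bilinear_l2_pairing[where \<sigma> = "\<lambda>z. z"]) auto

lemma bounded_bilinear_l2_inner: "bounded_bilinear l2_inner"
  unfolding l2_inner_def[abs_def] by (rule bounded_bilinear_l2_pairing) (auto intro: bounded_linear_cnj)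

lemma
  assumes S: "S \<in> sets lebesgue"
  shows l2_bil_cutoff: "l2_bil (cutoff S f) g = l2_bil f (cutoff S g)"
    and l2_inner_cutoff: "l2_inner (cutoff S f) g = l2_inner f (cutoff S g)"
proof -
  have "AE x in lebesgue. l2_fun (cutoff S f) x * l2_fun g x = l2_fun f x * l2_fun (cutoff S g) x \<and>
      l2_fun (cutoff S f) x * cnj (l2_fun g x) = l2_fun f x * cnj (l2_fun (cutoff S g) x)"
    using l2_fun_cutoff[OF S, of f] l2_fun_cutoff[OF S, of g] by eventually_elim (simp add: indicator_def)
  then show "l2_bil (cutoff S f) g = l2_bil f (cutoff S g)" "l2_inner (cutoff S f) g = l2_inner f (cutoff S g)"
    unfolding l2_bil_def l2_inner_def
    by (intro integral_cong_AE; (measurable | auto elim: eventually_mono))+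
qed

section \<open>The reflection on points, measures and classes of functions\<close>

lemma mirror_mirror [simp]: "mirror k (mirror k x) = x"
  by (simp add: mirror_def vec_eq_iff)

lemma mirror_nth: "mirror k x $ i = (if i = k then - (x $ i) else x $ i)"
  by (simp add: mirror_def)

lemma linear_mirror: "linear (mirror k)"
  by (rule linearI) (auto simp: mirror_def vec_eq_iff)

lemma
  fixes k :: "'n::finite"
  shows mirror_measurable [measurable]: "mirror k \<in> lebesgue \<rightarrow>\<^sub>M lebesgue"
    and distr_mirror: "distr lebesgue lebesgue (mirror k) = lebesgue"
proof -
  \<comment> \<open>In the standard basis the reflection is diagonal with entries c. The general
    formula for Lebesgue measure under diagonal affine maps has the density factor
    \<open>\<Prod>j\<in>Basis. \<bar>c j\<bar>\<close>, which is 1 here.\<close>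
  define c :: "real ^ 'n \<Rightarrow> real" where "c j = (if j = axis k 1 then -1 else 1)" for j
  have m: "mirror k = (\<lambda>x. 0 + (\<Sum>j\<in>Basis. (c j * (x \<bullet> j)) *\<^sub>R j))"
  proof
    fix x :: "real ^ 'n"
    show "mirror k x = 0 + (\<Sum>j\<in>Basis. (c j * (x \<bullet> j)) *\<^sub>R j)"
    proof (rule euclidean_eqI)
      fix b :: "real ^ 'n" assume b: "b \<in> Basis"
      then obtain i where i: "b = axis i 1" by (auto simp: Basis_vec_def)
      show "mirror k x \<bullet> b = (0 + (\<Sum>j\<in>Basis. (c j * (x \<bullet> j)) *\<^sub>R j)) \<bullet> b"
        using inner_sum_left_Basis[OF b, of "\<lambda>j. c j * (x \<bullet> j)"]
        by (simp add: c_def i inner_axis mirror_nth axis_eq_axis)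
    qed
  qed
  have c: "c j \<noteq> 0" for j by (simp add: c_def)
  have 1: "(\<Prod>j\<in>Basis. \<bar>c j\<bar>) = 1" by (simp add: c_def prod.neutral)
  show "mirror k \<in> lebesgue \<rightarrow>\<^sub>M lebesgue"
    unfolding m by (rule lebesgue_affine_measurable) (rule c)
  show "distr lebesgue lebesgue (mirror k) = lebesgue"
    using lebesgue_affine_euclidean[of c 0, folded m] c 1 by (simp add: density_1)
qed

lemma AE_mirror:
  fixes k :: "'n::finite" and P :: "real ^ 'n \<Rightarrow> bool"
  assumes "AE x in lebesgue. P x"
  shows "AE x in lebesgue. P (mirror k x)"
proof (rule AE_distrD[OF mirror_measurable])
  show "AE x in distr lebesgue lebesgue (mirror k). P x" unfolding distr_mirror by (rule assms)
qed

lemma integral_mirror: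
  fixes f :: "real ^ 'n \<Rightarrow> 'b::{banach, second_countable_topology}"
  assumes "f \<in> borel_measurable lebesgue"
  shows "(LINT x|lebesgue. f (mirror k x)) = (LINT x|lebesgue. f x)"
  using integral_distr[OF mirror_measurable assms, of k] by (simp add: distr_mirror)

lemma integrable_mirror:
  fixes f :: "real ^ 'n \<Rightarrow> 'b::{banach, second_countable_topology}"
  assumes "integrable lebesgue f"
  shows "integrable lebesgue (\<lambda>x. f (mirror k x))"
  using integrable_distr[OF mirror_measurable, of k f] assms by (simp add: distr_mirror)

lemma sq_integrable_mirror: "sq_integrable f \<Longrightarrow> sq_integrable (\<lambda>x. f (mirror k x))"
  using integrable_mirror[of "\<lambda>x. (cmod (f x))\<^sup>2" k]
    measurable_compose[OF mirror_measurable, of f borel k] by (auto simp: sq_integrable_def)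

definition l2_mirror :: "'n \<Rightarrow> (real ^ 'n) l2 \<Rightarrow> (real ^ 'n) l2" where
  "l2_mirror k f = to_l2 (\<lambda>x. l2_fun f (mirror k x))"

lemma l2_fun_mirror: "AE x in lebesgue. l2_fun (l2_mirror k f) x = l2_fun f (mirror k x)"
  unfolding l2_mirror_def by (intro l2_fun_to_l2 sq_integrable_mirror sq_integrable_l2_fun)

lemma l2_mirror_to_l2:
  assumes "sq_integrable f"
  shows "l2_mirror k (to_l2 f) = to_l2 (\<lambda>x. f (mirror k x))"
  by (rule l2_eqI) (use l2_fun_mirror[of k "to_l2 f"] AE_mirror[OF l2_fun_to_l2[OF assms], of k]
    l2_fun_to_l2[OF sq_integrable_mirror[OF assms, of k]] in \<open>eventually_elim, simp\<close>)

lemma norm_l2_mirror [simp]: "norm (l2_mirror k f) = norm f"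
proof -
  have "(LINT x|lebesgue. (cmod (l2_fun f (mirror k x)))\<^sup>2) = (LINT x|lebesgue. (cmod (l2_fun f x))\<^sup>2)"
    by (rule integral_mirror) measurable
  then show ?thesis
    by (simp add: l2_mirror_def norm_to_l2 sq_integrable_mirror sq_integrable_l2_fun norm_l2_eq[of f])
qed

lemma bounded_linear_l2_mirror: "bounded_linear (l2_mirror k)"
proof (rule bounded_linear_intro[where K = 1])
  show "l2_mirror k (f + g) = l2_mirror k f + l2_mirror k g" for f g
    by (rule l2_eqI) (use l2_fun_mirror[of k "f + g"] l2_fun_mirror[of k f] l2_fun_mirror[of k g]
      AE_mirror[OF l2_fun_add[of f g], of k] l2_fun_add[of "l2_mirror k f" "l2_mirror k g"] in \<open>eventually_elim, simp\<close>)
  show "l2_mirror k (r *\<^sub>R f) = r *\<^sub>R l2_mirror k f" for r f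
    by (rule l2_eqI) (use l2_fun_mirror[of k "r *\<^sub>R f"] l2_fun_mirror[of k f]
      AE_mirror[OF l2_fun_scaleR[of r f], of k] l2_fun_scaleR[of r "l2_mirror k f"] in \<open>eventually_elim, simp\<close>)
qed simp

lemma l2_mirror_mirror [simp]: "l2_mirror k (l2_mirror k f) = f"
  by (rule l2_eqI) (use l2_fun_mirror[of k "l2_mirror k f"] AE_mirror[OF l2_fun_mirror[of k f], of k] in \<open>eventually_elim, simp\<close>)

lemma l2_mirror_const_mult: "l2_mirror k (l2_mult (\<lambda>_. c) f) = l2_mult (\<lambda>_. c) (l2_mirror k f)"
  by (rule l2_eqI) (use l2_fun_mirror[of k "l2_mult (\<lambda>_. c) f"] AE_mirror[OF l2_fun_const_mult[of c f], of k]
    l2_fun_const_mult[of c "l2_mirror k f"] l2_fun_mirror[of k f] in \<open>eventually_elim, simp\<close>)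

lemma mirror_image_sets:
  assumes "S \<in> sets lebesgue"
  shows "mirror k ` S \<in> sets lebesgue"
proof -
  have "mirror k ` S = mirror k -` S \<inter> space lebesgue" by (force simp: image_iff intro: mirror_mirror[symmetric])
  also have "\<dots> \<in> sets lebesgue" by (rule measurable_sets[OF mirror_measurable assms])
  finally show ?thesis .
qed

lemma mem_mirror_image: "x \<in> mirror k ` S \<longleftrightarrow> mirror k x \<in> S"
  by (metis image_iff mirror_mirror)

lemma l2_mirror_cutoff:
  assumes "S \<in> sets lebesgue"
  shows "l2_mirror k (cutoff S f) = cutoff (mirror k ` S) (l2_mirror k f)"
  by (rule l2_eqI) (use l2_fun_mirror[of k "cutoff S f"] AE_mirror[OF l2_fun_cutoff[OF assms, of f], of k]
    l2_fun_cutoff[OF mirror_image_sets[OF assms, of k], of "l2_mirror k f"] l2_fun_mirror[of k f] in \<open>eventually_elim, simp add: indicator_def mem_mirror_image\<close>)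

lemma
  shows l2_bil_mirror: "l2_bil (l2_mirror k f) g = l2_bil f (l2_mirror k g)"
    and l2_inner_mirror: "l2_inner (l2_mirror k f) g = l2_inner f (l2_mirror k g)"
proof -
  \<comment> \<open>Substituting x \<mapsto> \<open>mirror k x\<close> moves the reflection to the
    other factor, since the reflection is an involution preserving the measure.\<close>
  have gen: "(LINT x|lebesgue. l2_fun (l2_mirror k f) x * \<sigma> (l2_fun g x)) =
      (LINT x|lebesgue. l2_fun f x * \<sigma> (l2_fun (l2_mirror k g) x))"
    if [measurable]: "\<sigma> \<in> borel_measurable borel" for \<sigma>
  proof -
    have "(LINT x|lebesgue. l2_fun (l2_mirror k f) x * \<sigma> (l2_fun g x)) =
        (LINT x|lebesgue. l2_fun f (mirror k x) * \<sigma> (l2_fun (l2_mirror k g) (mirror k x)))"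
    proof (intro integral_cong_AE)
      show "AE x in lebesgue. l2_fun (l2_mirror k f) x * \<sigma> (l2_fun g x) =
          l2_fun f (mirror k x) * \<sigma> (l2_fun (l2_mirror k g) (mirror k x))"
        using l2_fun_mirror[of k f] AE_mirror[OF l2_fun_mirror[of k g], of k] by eventually_elim simp
    qed measurable
    also have "\<dots> = (LINT x|lebesgue. l2_fun f x * \<sigma> (l2_fun (l2_mirror k g) x))"
      by (rule integral_mirror[of "\<lambda>x. l2_fun f x * \<sigma> (l2_fun (l2_mirror k g) x)"]) measurable
    finally show ?thesis .
  qed
  show "l2_bil (l2_mirror k f) g = l2_bil f (l2_mirror k g)" "l2_inner (l2_mirror k f) g = l2_inner f (l2_mirror k g)"
    unfolding l2_bil_def l2_inner_def using gen[of "\<lambda>z. z"] gen[of cnj] by auto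
qed

section \<open>Test functions\<close>

lemma dir_deriv_eq: "(f has_derivative f') (at x) \<Longrightarrow> dir_deriv b f x = f' b"
  using frechet_derivative_at[of f f' x] by (simp add: dir_deriv_def)

lemma has_derivative_frechet:
  "f differentiable at x \<Longrightarrow> (f has_derivative frechet_derivative f (at x)) (at x)"
  using frechet_derivative_works by blast

lemma C_k_SucD: "C_k (Suc k) f \<Longrightarrow> C_k k f"
proof (induction k arbitrary: f)
  case 0
  then show ?case
    by (auto simp: continuous_on_eq_continuous_at intro: differentiable_imp_continuous_within)
next
  case (Suc k)
  then show ?case by (simp del: C_k.simps(2) add: C_k.simps(2)[of "Suc k"]) (simp add: Suc.IH)
qed

lemma C_k_const: "C_k k (\<lambda>x. c)"
proof (induction k arbitrary: c)
  case (Suc k)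
  have "dir_deriv b (\<lambda>x. c) = (\<lambda>x. 0)" for b :: 'a
    by (rule ext, rule dir_deriv_eq) (rule has_derivative_const)
  then show ?case using Suc.IH by simp
qed simp

lemma C_k_add: "C_k k f \<Longrightarrow> C_k k g \<Longrightarrow> C_k k (\<lambda>x. f x + g x)"
proof (induction k arbitrary: f g)
  case (Suc k)
  then have d: "f differentiable at x" "g differentiable at x" for x by auto
  have "dir_deriv b (\<lambda>x. f x + g x) = (\<lambda>x. dir_deriv b f x + dir_deriv b g x)" for b
    unfolding dir_deriv_def[of b f] dir_deriv_def[of b g]
    by (rule ext, rule dir_deriv_eq) (intro has_derivative_add has_derivative_frechet d)
  then show ?case using Suc d by auto
qed (auto intro: continuous_on_add)

lemma dir_deriv_mult:
  assumes "f differentiable at x" "g differentiable at x"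
  shows "dir_deriv b (\<lambda>x. f x * g x) x = f x * dir_deriv b g x + dir_deriv b f x * g x"
  unfolding dir_deriv_def[of b f] dir_deriv_def[of b g]
  by (rule dir_deriv_eq) (intro has_derivative_mult has_derivative_frechet assms)

lemma C_k_mult: "C_k k f \<Longrightarrow> C_k k g \<Longrightarrow> C_k k (\<lambda>x. f x * g x)"
proof (induction k arbitrary: f g)
  case (Suc k)
  then have d: "f differentiable at x" "g differentiable at x" for x by auto
  have "dir_deriv b (\<lambda>x. f x * g x) = (\<lambda>x. f x * dir_deriv b g x + dir_deriv b f x * g x)" for b
    by (rule ext) (intro dir_deriv_mult d)
  moreover have "C_k k f" "C_k k g" using Suc.prems by (auto intro: C_k_SucD)
  ultimately show ?case using Suc d by (auto intro!: C_k_add)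
qed (auto intro: continuous_on_mult)

lemma C_k_prod: "(\<And>i. i \<in> I \<Longrightarrow> C_k k (f i)) \<Longrightarrow> C_k k (\<lambda>x. \<Prod>i\<in>I. f i x)"
  by (induction I rule: infinite_finite_induct) (auto intro: C_k_const C_k_mult)

lemma C_k_inverse: "C_k k f \<Longrightarrow> (\<And>x. f x \<noteq> 0) \<Longrightarrow> C_k k (\<lambda>x. inverse (f x))"
proof (induction k arbitrary: f)
  case (Suc k)
  then have d: "f differentiable at x" for x by auto
  have D: "((\<lambda>x. inverse (f x)) has_derivative (\<lambda>h. - (inverse (f x) * frechet_derivative f (at x) h * inverse (f x)))) (at x)" for x
    using Suc.prems d by (intro Deriv.has_derivative_inverse has_derivative_frechet) auto
  then have "dir_deriv b (\<lambda>x. inverse (f x)) = (\<lambda>x. (-1) * (inverse (f x) * dir_deriv b f x * inverse (f x)))" for b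
    by (intro ext) (simp add: dir_deriv_eq[OF D] dir_deriv_def)
  moreover have "C_k k (\<lambda>x. inverse (f x))" by (rule Suc.IH[OF C_k_SucD[OF Suc.prems(1)] Suc.prems(2)])
  moreover have "C_k k (\<lambda>x. (-1) * (inverse (f x) * dir_deriv b f x * inverse (f x)))" if "b \<in> Basis" for b
    using Suc.prems that calculation(2) by (intro C_k_mult C_k_const) auto
  moreover have "(\<lambda>x. inverse (f x)) differentiable at x" for x using D unfolding differentiable_def by blast
  ultimately show ?case by simp
qed (auto intro: continuous_on_inverse)

lemma dir_deriv_compose:
  fixes L :: "'a::euclidean_space \<Rightarrow> 'b::euclidean_space"
  assumes L: "linear L" "L e = \<sigma> *\<^sub>R \<beta>" and f: "f differentiable at (L x + d)"
  shows "dir_deriv e (\<lambda>x. f (L x + d)) x = complex_of_real \<sigma> * dir_deriv \<beta> f (L x + d)"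
    and "(\<lambda>x. f (L x + d)) differentiable at x"
proof -
  have "((\<lambda>x. L x + d) has_derivative L) (at x)"
    using linear_imp_has_derivative[OF L(1)] by (auto intro!: derivative_eq_intros)
  from has_derivative_compose[OF this has_derivative_frechet[OF f]]
  have D: "((\<lambda>x. f (L x + d)) has_derivative (\<lambda>h. frechet_derivative f (at (L x + d)) (L h))) (at x)" .
  then show "(\<lambda>x. f (L x + d)) differentiable at x" by (auto simp: differentiable_def)
  have "frechet_derivative f (at (L x + d)) (\<sigma> *\<^sub>R \<beta>) = \<sigma> *\<^sub>R frechet_derivative f (at (L x + d)) \<beta>"
    by (rule linear_scale[OF linear_frechet_derivative[OF f]])
  then show "dir_deriv e (\<lambda>x. f (L x + d)) x = complex_of_real \<sigma> * dir_deriv \<beta> f (L x + d)"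
    using dir_deriv_eq[OF D] by (simp add: dir_deriv_def L scaleR_conv_of_real)
qed

text \<open>\<open>C_k\<close> looks only at derivatives along basis vectors. If L sends each basis
  vector to a multiple of a basis vector, the chain rule produces a constant times such a derivative
  and the induction closes. Reflections and x \<mapsto> c (x \<bullet> b) are of this kind.\<close>

lemma C_k_compose:
  fixes L :: "'a::euclidean_space \<Rightarrow> 'b::euclidean_space"
  assumes L: "linear L" "\<And>e. e \<in> Basis \<Longrightarrow> L e = \<sigma> e *\<^sub>R \<beta> e" "\<And>e. e \<in> Basis \<Longrightarrow> \<beta> e \<in> Basis"
  shows "C_k k f \<Longrightarrow> C_k k (\<lambda>x. f (L x + d))"
proof (induction k arbitrary: f)
  case 0
  have "continuous_on UNIV (\<lambda>x. L x + d)" using L by (intro continuous_intros linear_continuous_on) (simp add: linear_conv_bounded_linear)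
  with 0 show ?case by (auto intro: continuous_on_compose2)
next
  case (Suc k)
  then have f: "f differentiable at x" for x by auto
  have "dir_deriv e (\<lambda>x. f (L x + d)) = (\<lambda>x. complex_of_real (\<sigma> e) * dir_deriv (\<beta> e) f (L x + d))" if "e \<in> Basis" for e
    using that by (intro ext dir_deriv_compose L f)
  moreover have "(\<lambda>x. f (L x + d)) differentiable at x" for x
    using dir_deriv_compose(2)[OF L(1) L(2) f] nonempty_Basis by blast
  ultimately show ?case using Suc L(3) by (auto intro!: C_k_mult C_k_const)
qed

lemma C_k_real_compose:
  fixes g :: "real \<Rightarrow> complex" and b :: "'a::euclidean_space"
  assumes "C_k k g"
  shows "C_k k (\<lambda>x. g (c * (x \<bullet> b) + d))"
  by (rule C_k_compose[where \<sigma> = "\<lambda>e. c * (e \<bullet> b)" and \<beta> = "\<lambda>_. 1", OF _ _ _ assms])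
     (auto intro!: linearI simp: algebra_simps)

section \<open>A smooth step function built from exp (- 1 / x)\<close>

definition exp_inv :: "nat \<Rightarrow> real \<Rightarrow> real" where
  "exp_inv n x = (if x \<le> 0 then 0 else (1 / x) ^ n * exp (- (1 / x)))"

lemma exp_inv_tendsto_0: "(exp_inv n \<longlongrightarrow> 0) (at_right 0)"
proof -
  have "((\<lambda>x. (1 / x) ^ n / exp (1 / x)) \<longlongrightarrow> (0::real)) (at_right 0)"
    by (rule filterlim_compose[OF tendsto_power_div_exp_0])
       (simp add: divide_inverse filterlim_inverse_at_top_right)
  then show ?thesis
    by (rule Lim_transform_eventually)
       (auto simp: exp_inv_def eventually_at_filter exp_minus divide_inverse)
qed

text \<open>The exponent n is a parameter because the family is then closed under differentiation up
  to linear combinations; smoothness follows by induction on the order with n arbitrary.\<close>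

lemma exp_inv_deriv: "(exp_inv n has_real_derivative exp_inv (n + 2) x - real n * exp_inv (n + 1) x) (at x)"
proof (cases x "0::real" rule: linorder_cases)
  case less
  have "((\<lambda>x. 0) has_real_derivative 0) (at x)" by simp
  then have "(exp_inv n has_real_derivative 0) (at x)"
    by (rule has_field_derivative_transform_within_open[of _ _ _ "{..<0}"]) (use less in \<open>auto simp: exp_inv_def\<close>)
  then show ?thesis using less by (simp add: exp_inv_def)
next
  case greater
  have "((\<lambda>x. (1 / x) ^ n * exp (- (1 / x))) has_real_derivative exp_inv (n + 2) x - real n * exp_inv (n + 1) x) (at x)"
  proof (cases n)
    case 0
    then show ?thesis
      using greater by (auto intro!: derivative_eq_intros simp: exp_inv_def field_simps power2_eq_square)
  next
    case (Suc m)
    have "((\<lambda>x. (1 / x) ^ n * exp (- (1 / x))) has_real_derivative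
        (real n * (1 / x) ^ m * (- ((1 / x) * (1 / x)))) * exp (- (1 / x)) + (1 / x) ^ n * (exp (- (1 / x)) * ((1 / x) * (1 / x)))) (at x)"
    proof -
      have u: "((\<lambda>x. 1 / x) has_real_derivative - ((1 / x) * (1 / x))) (at x)"
        using greater by (auto intro!: derivative_eq_intros)
      have "((\<lambda>x. - (1 / x)) has_real_derivative (1 / x) * (1 / x)) (at x)"
        using DERIV_minus[OF u] by simp
      from DERIV_mult[OF DERIV_power[OF u, of n] DERIV_fun_exp[OF this]] show ?thesis
        by (rule DERIV_cong) (simp add: Suc algebra_simps add_divide_distrib)
    qed
    moreover have "(real n * (1 / x) ^ m * (- ((1 / x) * (1 / x)))) * exp (- (1 / x)) + (1 / x) ^ n * (exp (- (1 / x)) * ((1 / x) * (1 / x))) =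
        exp_inv (n + 2) x - real n * exp_inv (n + 1) x"
      using greater Suc by (simp add: exp_inv_def algebra_simps add_divide_distrib)
    ultimately show ?thesis by simp
  qed
  then show ?thesis
    by (rule has_field_derivative_transform_within_open[of _ _ _ "{0<..}"]) (use greater in \<open>auto simp: exp_inv_def\<close>)
next
  case equal
  have "((\<lambda>y. (exp_inv n y - exp_inv n 0) / (y - 0)) \<longlongrightarrow> 0) (at 0)"
  proof (rule filterlim_split_at)
    show "((\<lambda>y. (exp_inv n y - exp_inv n 0) / (y - 0)) \<longlongrightarrow> 0) (at_left 0)"
      by (rule Lim_transform_eventually[OF tendsto_const])
         (auto simp: exp_inv_def eventually_at_filter)
    \<comment> \<open>For y > 0 this quotient is \<open>exp_inv (Suc n) y\<close>, as dividing by y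
      raises the exponent by one.\<close>
    show "((\<lambda>y. (exp_inv n y - exp_inv n 0) / (y - 0)) \<longlongrightarrow> 0) (at_right 0)"
      by (rule Lim_transform_eventually[OF exp_inv_tendsto_0[of "Suc n"]])
         (auto simp: exp_inv_def eventually_at_filter)
  qed
  then show ?thesis using equal by (simp add: has_field_derivative_iff exp_inv_def)
qed

lemma C_k_exp_inv: "C_k k (\<lambda>x. complex_of_real (exp_inv n x))"
proof (induction k arbitrary: n)
  case 0
  have "continuous_on UNIV (exp_inv n)"
    using exp_inv_deriv DERIV_isCont by (intro continuous_at_imp_continuous_on) blast
  then show ?case by (auto intro: continuous_on_of_real)
next
  case (Suc k)
  have D: "((\<lambda>x. complex_of_real (exp_inv n x)) has_derivative
      (\<lambda>h. complex_of_real (h * (exp_inv (n + 2) x - real n * exp_inv (n + 1) x)))) (at x)" for x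
    using exp_inv_deriv[of n x] unfolding has_field_derivative_def
    by (intro has_derivative_of_real) (simp add: mult_commute_abs)
  have eq: "dir_deriv 1 (\<lambda>x. complex_of_real (exp_inv n x)) =
      (\<lambda>x. complex_of_real (exp_inv (n + 2) x) + complex_of_real (- real n) * complex_of_real (exp_inv (n + 1) x))"
    by (rule ext) (simp add: dir_deriv_eq[OF D])
  have "C_k k (dir_deriv 1 (\<lambda>x. complex_of_real (exp_inv n x)))"
    unfolding eq by (intro C_k_add C_k_mult C_k_const Suc.IH)
  moreover have "(\<lambda>x. complex_of_real (exp_inv n x)) differentiable at x" for x
    using D unfolding differentiable_def by blast
  ultimately show ?case by simp
qed

definition smooth_step :: "real \<Rightarrow> real" where
  "smooth_step x = exp_inv 0 x / (exp_inv 0 x + exp_inv 0 (1 - x))"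

lemma smooth_step_denominator_pos: "exp_inv 0 x + exp_inv 0 (1 - x) > 0"
proof -
  have "exp_inv 0 x \<ge> 0" "exp_inv 0 (1 - x) \<ge> 0" "x > 0 \<or> 1 - x > 0" by (auto simp: exp_inv_def)
  then show ?thesis by (auto simp: exp_inv_def add_pos_nonneg add_nonneg_pos)
qed

lemma smooth_step_eq_0: "x \<le> 0 \<Longrightarrow> smooth_step x = 0"
  and smooth_step_eq_1: "x \<ge> 1 \<Longrightarrow> smooth_step x = 1"
  by (auto simp: smooth_step_def exp_inv_def)

lemma smooth_step_bounds: "0 \<le> smooth_step x" "smooth_step x \<le> 1"
proof -
  have "exp_inv 0 x \<ge> 0" "exp_inv 0 (1 - x) \<ge> 0" by (auto simp: exp_inv_def)
  then show "0 \<le> smooth_step x" "smooth_step x \<le> 1"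
    using smooth_step_denominator_pos[of x] by (auto simp: smooth_step_def field_simps)
qed

lemma C_k_smooth_step: "C_k k (\<lambda>x. complex_of_real (smooth_step x))"
proof -
  \<comment> \<open>The reflected argument 1 - x is written as an affine function of an inner
    product with the basis vector 1 of the real line, to match
    \<open>C_k_real_compose\<close>.\<close>
  have "C_k k (\<lambda>x. complex_of_real (exp_inv 0 ((-1) * ((x::real) \<bullet> 1) + 1)))"
    by (rule C_k_real_compose[OF C_k_exp_inv])
  then have "C_k k (\<lambda>x. complex_of_real (exp_inv 0 (1 - x)))" by (simp add: inner_real_def)
  then have "C_k k (\<lambda>x. complex_of_real (exp_inv 0 x) * inverse (complex_of_real (exp_inv 0 x) + complex_of_real (exp_inv 0 (1 - x))))"
    using smooth_step_denominator_pos
    by (intro C_k_mult C_k_inverse C_k_add C_k_exp_inv) (auto simp: less_le simp flip: of_real_add)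
  then show ?thesis by (simp add: smooth_step_def divide_inverse)
qed

section \<open>Test functions and integration by parts\<close>

lemma test_functions_C_k: "\<phi> \<in> test_functions \<Omega> \<Longrightarrow> C_k k \<phi>"
  by (simp add: test_functions_def)

lemma test_functions_differentiable: "\<phi> \<in> test_functions \<Omega> \<Longrightarrow> \<phi> differentiable at x"
  using test_functions_C_k[of \<phi> \<Omega> "Suc 0"] by simp

lemma test_functions_continuous: "\<phi> \<in> test_functions \<Omega> \<Longrightarrow> continuous_on UNIV \<phi>"
  using test_functions_C_k[of \<phi> \<Omega> 0] by simp

lemma test_functions_mono: "\<phi> \<in> test_functions \<Omega> \<Longrightarrow> \<Omega> \<subseteq> \<Omega>' \<Longrightarrow> \<phi> \<in> test_functions \<Omega>'"
  by (auto simp: test_functions_def)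

lemma test_functions_bounded:
  assumes "\<phi> \<in> test_functions \<Omega>"
  obtains C where "\<And>x. cmod (\<phi> x) \<le> C" "C \<ge> 0"
proof -
  obtain K where K: "compact K" "\<And>x. x \<notin> K \<Longrightarrow> \<phi> x = 0" using assms by (auto simp: test_functions_def)
  have "compact (\<phi> ` K)"
    using K test_functions_continuous[OF assms] by (intro compact_continuous_image) (auto intro: continuous_on_subset)
  then obtain B where B: "\<And>y. y \<in> \<phi> ` K \<Longrightarrow> norm y \<le> B" using compact_imp_bounded bounded_iff by metis
  have "cmod (\<phi> x) \<le> max B 0" for x using B[of "\<phi> x"] K(2)[of x] by (cases "x \<in> K") auto
  then show ?thesis using that[of "max B 0"] by simp
qed

lemma test_functions_measurable: "\<phi> \<in> test_functions \<Omega> \<Longrightarrow> \<phi> \<in> borel_measurable lebesgue"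
  by (intro measurable_completion) (simp add: borel_measurable_continuous_onI test_functions_continuous)

lemma sq_integrable_test:
  assumes "\<phi> \<in> test_functions \<Omega>"
  shows "sq_integrable \<phi>"
proof -
  obtain K where K: "compact K" "\<And>x. x \<notin> K \<Longrightarrow> \<phi> x = 0" using assms by (auto simp: test_functions_def)
  obtain C where C: "\<And>x. cmod (\<phi> x) \<le> C" "C \<ge> 0" using test_functions_bounded[OF assms] by blast
  obtain a where a: "K \<subseteq> box (- a) a" using bounded_subset_box_symmetric[OF compact_imp_bounded[OF K(1)]] by blast
  show ?thesis
    by (rule sq_integrable_dominated[OF sq_integrable_indicator_subset[of "box (-a) a" "-a" a 1], where C = C])
       (use C K a test_functions_measurable[OF assms] in \<open>auto simp: indicator_def\<close>)
qed

lemma test_functions_in_L2_on: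
  assumes "\<phi> \<in> test_functions \<Omega>"
  shows "to_l2 \<phi> \<in> L2_on \<Omega>"
  using l2_fun_to_l2[OF sq_integrable_test[OF assms]] assms
  by (auto simp: L2_on_def test_functions_def subset_iff elim!: eventually_mono)

lemma dir_deriv_test:
  assumes "\<phi> \<in> test_functions \<Omega>" "b \<in> Basis"
  shows "dir_deriv b \<phi> \<in> test_functions \<Omega>"
proof -
  obtain K where K: "compact K" "K \<subseteq> \<Omega>" "\<And>x. x \<notin> K \<Longrightarrow> \<phi> x = 0" using assms by (auto simp: test_functions_def)
  have "dir_deriv b \<phi> x = 0" if "x \<notin> K" for x
  proof -
    have "((\<lambda>x. 0) has_derivative (\<lambda>h. 0)) (at x)" by simp
    then have "(\<phi> has_derivative (\<lambda>h. 0)) (at x)"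
      by (rule has_derivative_transform_within_open[of _ _ _ _ "- K"]) (use K that in \<open>auto intro: compact_imp_closed\<close>)
    then show ?thesis by (rule dir_deriv_eq)
  qed
  moreover have "C_k k (dir_deriv b \<phi>)" for k using test_functions_C_k[OF assms(1), of "Suc k"] assms(2) by simp
  ultimately show ?thesis using K by (auto simp: test_functions_def)
qed

lemma test_functions_add:
  assumes "\<phi> \<in> test_functions \<Omega>" "\<psi> \<in> test_functions \<Omega>"
  shows "(\<lambda>x. \<phi> x + \<psi> x) \<in> test_functions \<Omega>"
proof -
  obtain K where K: "compact K" "K \<subseteq> \<Omega>" "\<And>x. x \<notin> K \<Longrightarrow> \<phi> x = 0" using assms by (auto simp: test_functions_def)
  obtain L where L: "compact L" "L \<subseteq> \<Omega>" "\<And>x. x \<notin> L \<Longrightarrow> \<psi> x = 0" using assms by (auto simp: test_functions_def)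
  show ?thesis unfolding test_functions_def mem_Collect_eq
    by (intro conjI allI C_k_add exI[of _ "K \<union> L"] impI) (use assms K L in \<open>auto intro: test_functions_C_k\<close>)
qed

lemma test_functions_mult:
  assumes "\<phi> \<in> test_functions \<Omega>" "\<And>k. C_k k \<eta>"
  shows "(\<lambda>x. \<eta> x * \<phi> x) \<in> test_functions \<Omega>"
proof -
  obtain K where K: "compact K" "K \<subseteq> \<Omega>" "\<And>x. x \<notin> K \<Longrightarrow> \<phi> x = 0" using assms by (auto simp: test_functions_def)
  show ?thesis unfolding test_functions_def mem_Collect_eq
    by (intro conjI allI C_k_mult exI[of _ K] impI) (use assms K in \<open>auto intro: test_functions_C_k\<close>)
qed

lemma test_functions_cmult: "\<phi> \<in> test_functions \<Omega> \<Longrightarrow> (\<lambda>x. c * \<phi> x) \<in> test_functions \<Omega>"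
  by (rule test_functions_mult[OF _ C_k_const])

lemma dir_deriv_add:
  assumes "f differentiable at x" "g differentiable at x"
  shows "dir_deriv b (\<lambda>x. f x + g x) x = dir_deriv b f x + dir_deriv b g x"
  unfolding dir_deriv_def[of b f] dir_deriv_def[of b g]
  by (rule dir_deriv_eq) (intro has_derivative_add has_derivative_frechet assms)

lemma dir_deriv_cmult:
  assumes "f differentiable at x"
  shows "dir_deriv b (\<lambda>x. c * f x) x = c * dir_deriv b f x"
  unfolding dir_deriv_def[of b f]
  by (rule dir_deriv_eq) (intro has_derivative_mult_right has_derivative_frechet assms)

lemma line_has_derivative:
  fixes f :: "'a::euclidean_space \<Rightarrow> complex"
  assumes "\<And>x. f differentiable at x"
  shows "((\<lambda>t. f (x + t *\<^sub>R b)) has_vector_derivative dir_deriv b f (x + t *\<^sub>R b)) (at t)"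
proof -
  have "((\<lambda>t. x + t *\<^sub>R b) has_derivative (\<lambda>h. h *\<^sub>R b)) (at t)" by (auto intro!: derivative_eq_intros)
  from has_derivative_compose[OF this has_derivative_frechet[OF assms]]
  have D: "((\<lambda>t. f (x + t *\<^sub>R b)) has_derivative (\<lambda>h. frechet_derivative f (at (x + t *\<^sub>R b)) (h *\<^sub>R b))) (at t)" .
  then show ?thesis
    by (simp add: has_vector_derivative_def dir_deriv_def linear_scale[OF linear_frechet_derivative[OF assms]])
qed

text \<open>Needed for two purposes: to dominate difference quotients when integrating a derivative,
  and to bound a test function that vanishes on the hyperplane by the distance to it.\<close>

lemma test_functions_lipschitz:
  assumes \<phi>: "\<phi> \<in> test_functions \<Omega>" and b: "b \<in> Basis"
  obtains C where "C \<ge> 0" "\<And>x t. cmod (\<phi> (x + t *\<^sub>R b) - \<phi> x) \<le> C * \<bar>t\<bar>"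
proof -
  obtain C where C: "\<And>x. cmod (dir_deriv b \<phi> x) \<le> C" "C \<ge> 0"
    using test_functions_bounded[OF dir_deriv_test[OF \<phi> b]] by blast
  have "cmod (\<phi> (x + t *\<^sub>R b) - \<phi> x) \<le> C * \<bar>t\<bar>" for x t
  proof -
    have "norm (\<phi> (x + t *\<^sub>R b) - \<phi> (x + 0 *\<^sub>R b)) \<le> C * norm (t - 0)"
    proof (rule differentiable_bound[of UNIV])
      show "((\<lambda>t. \<phi> (x + t *\<^sub>R b)) has_derivative (\<lambda>h. h *\<^sub>R dir_deriv b \<phi> (x + s *\<^sub>R b))) (at s within UNIV)" for s
        using line_has_derivative[of \<phi>, OF test_functions_differentiable[OF \<phi>]]
        by (simp add: has_vector_derivative_def)
      show "onorm (\<lambda>h. h *\<^sub>R dir_deriv b \<phi> (x + s *\<^sub>R b)) \<le> C" for s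
        using C(1)[of "x + s *\<^sub>R b"] by (intro onorm_le) (simp add: mult.commute[of C] mult_left_mono)
    qed auto
    then show ?thesis by simp
  qed
  with C show ?thesis by (intro that) auto
qed

lemma integral_translate:
  fixes f :: "'a::euclidean_space \<Rightarrow> complex"
  assumes "f \<in> borel_measurable lebesgue"
  shows "(LINT x|lebesgue. f (x + t)) = (LINT x|lebesgue. f x)"
proof -
  have T: "(\<lambda>x. t + (\<Sum>j\<in>Basis. (1 * (x \<bullet> j)) *\<^sub>R j)) = (\<lambda>x. x + t)" by (auto simp: euclidean_representation)
  have m: "(\<lambda>x. x + t) \<in> lebesgue \<rightarrow>\<^sub>M lebesgue" using lebesgue_affine_measurable[of "\<lambda>_. 1" t] unfolding T by simp
  have "lebesgue = distr lebesgue lebesgue (\<lambda>x. x + t)"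
    using lebesgue_affine_euclidean[of "\<lambda>_. 1" t] unfolding T by (simp add: density_1)
  then have "(LINT x|lebesgue. f x) = (LINT x|distr lebesgue lebesgue (\<lambda>x. x + t). f x)" by simp
  also have "\<dots> = (LINT x|lebesgue. f (x + t))" by (rule integral_distr[OF m assms])
  finally show ?thesis by simp
qed

lemma integrable_test:
  assumes "\<phi> \<in> test_functions \<Omega>"
  shows "integrable lebesgue \<phi>"
proof -
  obtain K where K: "compact K" "\<And>x. x \<notin> K \<Longrightarrow> \<phi> x = 0" using assms by (auto simp: test_functions_def)
  obtain a where a: "K \<subseteq> box (- a) a" using bounded_subset_box_symmetric[OF compact_imp_bounded[OF K(1)]] by blast
  have "integrable lebesgue (\<lambda>x. 1 * indicator (box (-a) a) x * \<phi> x)"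
    by (rule l2_Cauchy_Schwarz(1)[OF sq_integrable_indicator_subset sq_integrable_test[OF assms]]) auto
  moreover have "(\<lambda>x. 1 * indicator (box (-a) a) x * \<phi> x) = \<phi>" using K a by (auto simp: indicator_def fun_eq_iff)
  ultimately show ?thesis by simp
qed

text \<open>By translation invariance the integral of a difference quotient vanishes.\<close>

lemma integral_dir_deriv_test:
  assumes \<phi>: "\<phi> \<in> test_functions \<Omega>" and b: "b \<in> Basis"
  shows "(LINT x|lebesgue. dir_deriv b \<phi> x) = 0"
proof -
  obtain C where C: "C \<ge> 0" "\<And>x t. cmod (\<phi> (x + t *\<^sub>R b) - \<phi> x) \<le> C * \<bar>t\<bar>"
    using test_functions_lipschitz[OF \<phi> b] by blast
  obtain K where K: "compact K" "\<And>x. x \<notin> K \<Longrightarrow> \<phi> x = 0" using \<phi> by (auto simp: test_functions_def)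
  obtain R where R: "\<And>x. x \<in> K \<Longrightarrow> norm x \<le> R" using compact_imp_bounded[OF K(1)] bounded_iff by metis
  \<comment> \<open>Step lengths at most 1 keep the supports of all difference quotients in the ball
    of radius R + 1, where the dominating function lives.\<close>
  define t where "t n = 1 / real (Suc n)" for n
  have t: "0 < t n" "t n \<le> 1" for n by (auto simp: t_def)
  have t0: "t \<longlonglongrightarrow> 0" unfolding t_def by (rule LIMSEQ_Suc[OF lim_1_over_n])
  define q where "q n x = (\<phi> (x + t n *\<^sub>R b) - \<phi> x) /\<^sub>R t n" for n x
  note [measurable] = test_functions_measurable[OF \<phi>] test_functions_measurable[OF dir_deriv_test[OF \<phi> b]]
  have cont: "continuous_on UNIV (\<lambda>x. \<phi> (x + c))" for c
    by (rule continuous_on_compose2[OF test_functions_continuous[OF \<phi>]]) (auto intro!: continuous_intros)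
  have m: "(\<lambda>x. \<phi> (x + c)) \<in> borel_measurable lebesgue" for c
    by (intro measurable_completion) (simp add: borel_measurable_continuous_onI cont)
  have int: "integrable lebesgue \<phi>" by (rule integrable_test[OF \<phi>])
  have qm: "q n \<in> borel_measurable lebesgue" for n unfolding q_def using m by measurable
  have qb: "cmod (q n x) \<le> C * indicator (cball 0 (R + 1)) x" for n x
  proof (cases "x \<in> cball 0 (R + 1)")
    case True
    have "cmod (q n x) \<le> (C * \<bar>t n\<bar>) / t n"
      using C(2)[of x "t n"] t[of n] by (simp add: q_def divide_inverse_commute)
    then show ?thesis using True t[of n] by simp
  next
    case False
    have "norm (x + t n *\<^sub>R b) \<ge> norm x - 1"
      using norm_triangle_ineq2[of x "- (t n *\<^sub>R b)"] t[of n] b by simp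
    then have "x + t n *\<^sub>R b \<notin> K" "x \<notin> K" using False R[of x] R[of "x + t n *\<^sub>R b"] by auto
    then show ?thesis using K False by (simp add: q_def)
  qed
  have wint: "integrable lebesgue (\<lambda>x::'a. C * indicator (cball 0 (R + 1)) x)"
    using emeasure_lborel_cball_finite[of "0 :: 'a" "R + 1"] by (intro integrable_mult_right integrable_real_indicator) auto
  have lim: "(\<lambda>n. q n x) \<longlonglongrightarrow> dir_deriv b \<phi> x" for x
  proof -
    have "((\<lambda>s. (\<phi> (x + s *\<^sub>R b) - \<phi> x) /\<^sub>R s) \<longlongrightarrow> dir_deriv b \<phi> x) (at 0)"
      using line_has_derivative[of \<phi> x b 0, OF test_functions_differentiable[OF \<phi>]]
      by (simp add: has_vector_derivative_iff_quotient)
    moreover have "filterlim t (at 0) sequentially"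
      using t0 t by (auto simp: filterlim_at less_le[symmetric] intro!: always_eventually) (metis less_irrefl)
    ultimately show ?thesis unfolding q_def by (rule filterlim_compose)
  qed
  have "(\<lambda>n. LINT x|lebesgue. q n x) \<longlonglongrightarrow> (LINT x|lebesgue. dir_deriv b \<phi> x)"
    by (rule integral_dominated_convergence[OF _ qm wint]) (use lim qb in \<open>auto intro!: AE_I2\<close>)
  moreover have "(LINT x|lebesgue. q n x) = 0" for n
  proof -
    have "integrable lebesgue (q n)"
      by (rule Bochner_Integration.integrable_bound[OF wint qm]) (use qb C in \<open>auto simp: indicator_def\<close>)
    then have "integrable lebesgue (\<lambda>x. t n *\<^sub>R q n x + \<phi> x)" using int by simp
    then have i: "integrable lebesgue (\<lambda>x. \<phi> (x + t n *\<^sub>R b))" using t[of n] by (simp add: q_def)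
    have "(LINT x|lebesgue. q n x) = ((LINT x|lebesgue. \<phi> (x + t n *\<^sub>R b)) - (LINT x|lebesgue. \<phi> x)) /\<^sub>R t n"
      unfolding q_def using i int by simp
    then show ?thesis by (simp add: integral_translate)
  qed
  ultimately show ?thesis by (simp add: LIMSEQ_const_iff)
qed

lemma l2_bil_to_l2:
  assumes "sq_integrable f" "sq_integrable g"
  shows "l2_bil (to_l2 f) (to_l2 g) = (LINT x|lebesgue. f x * g x)"
proof -
  note [measurable] = assms[THEN sq_integrable_measurable]
  show ?thesis unfolding l2_bil_def
  proof (rule integral_cong_AE)
    show "AE x in lebesgue. l2_fun (to_l2 f) x * l2_fun (to_l2 g) x = f x * g x"
      using l2_fun_to_l2[OF assms(1)] l2_fun_to_l2[OF assms(2)] by eventually_elim simp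
  qed measurable
qed

text \<open>The derivative of the product of two test functions has integral 0, and the product rule
  splits it into the two pairings.\<close>

lemma integration_by_parts_test:
  assumes "\<phi> \<in> test_functions \<Omega>" "\<psi> \<in> test_functions \<Omega>'" "b \<in> Basis"
  shows "l2_bil (to_l2 \<phi>) (to_l2 (dir_deriv b \<psi>)) = - l2_bil (to_l2 (dir_deriv b \<phi>)) (to_l2 \<psi>)"
proof -
  have p: "(\<lambda>x. \<psi> x * \<phi> x) \<in> test_functions \<Omega>"
    using assms by (intro test_functions_mult test_functions_C_k)
  have D: "dir_deriv b (\<lambda>x. \<psi> x * \<phi> x) x = dir_deriv b \<phi> x * \<psi> x + \<phi> x * dir_deriv b \<psi> x" for x
    using assms by (subst dir_deriv_mult) (auto intro: test_functions_differentiable simp: mult.commute)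
  have i: "integrable lebesgue (\<lambda>x. dir_deriv b \<phi> x * \<psi> x)" "integrable lebesgue (\<lambda>x. \<phi> x * dir_deriv b \<psi> x)"
    using assms by (auto intro!: l2_Cauchy_Schwarz sq_integrable_test dir_deriv_test)
  have "0 = (LINT x|lebesgue. dir_deriv b \<phi> x * \<psi> x) + (LINT x|lebesgue. \<phi> x * dir_deriv b \<psi> x)"
    using integral_dir_deriv_test[OF p assms(3)] i unfolding D by simp
  moreover have "sq_integrable \<phi>" "sq_integrable \<psi>" "sq_integrable (dir_deriv b \<phi>)" "sq_integrable (dir_deriv b \<psi>)"
    using assms by (auto intro: sq_integrable_test dir_deriv_test)
  ultimately show ?thesis by (simp add: l2_bil_to_l2 eq_neg_iff_add_eq_0 add.commute)
qed

section \<open>The fundamental lemma of the calculus of variations\<close>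

lemma AE_0_of_box_integrals:
  fixes f :: "'a::euclidean_space \<Rightarrow> complex"
  assumes f: "integrable lebesgue f" and supp: "\<And>x. x \<notin> box p q \<Longrightarrow> f x = 0"
    and box: "\<And>a b. (LINT x:box a b|lebesgue. f x) = 0"
  shows "AE x in lebesgue. f x = 0"
proof (rule sigma_finite_measure.density_unique_banach[OF _ f])
  show "sigma_finite_measure (lebesgue :: 'a measure)"
  proof
    have "(\<Union>n::nat. cball (0::'a) n) = UNIV" using real_arch_simple by (auto simp: set_eq_iff)
    then show "\<exists>A. countable A \<and> A \<subseteq> sets (lebesgue :: 'a measure) \<and> \<Union>A = space (lebesgue :: 'a measure) \<and>
        (\<forall>a\<in>A. emeasure lebesgue a \<noteq> \<infinity>)"
      using emeasure_lborel_cball_finite[where 'a = 'a]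
      by (intro exI[of _ "range (\<lambda>n::nat. cball (0::'a) n)"]) (auto simp: less_top)
  qed
  define G where "G = range (\<lambda>(a, b). box a b :: 'a set)"
  have borel: "sets (borel :: 'a measure) = sigma_sets UNIV G"
    by (subst borel_eq_box) (simp add: G_def)
  have si: "set_integrable lebesgue A f" if "A \<in> sets lebesgue" for A
    using integrable_mult_indicator[OF that f] by (simp add: set_integrable_def)
  have bl: "A \<in> sets lebesgue" if "A \<in> sets (borel :: 'a measure)" for A using that by simp
  \<comment> \<open>Complements in the induction over Borel sets require the integral over the whole
    space. Since f vanishes outside one box, this is again the integral over a box.\<close>
  have UN: "(LINT x:UNIV|lebesgue. f x) = 0"
  proof -
    have "(LINT x:UNIV|lebesgue. f x) = (LINT x:box p q|lebesgue. f x)"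
      unfolding set_lebesgue_integral_def using supp
      by (intro Bochner_Integration.integral_cong) (auto simp: indicator_def)
    then show ?thesis by (simp add: box)
  qed
  \<comment> \<open>Boxes form an intersection-stable generator of the Borel sets, so the vanishing
    extends from boxes to Borel sets. Lebesgue sets are treated afterwards; they differ from Borel
    sets by null sets.\<close>
  have *: "(LINT x:B|lebesgue. f x) = 0" if B: "B \<in> sets (borel :: 'a measure)" for B
  proof -
    have "Int_stable G"
      unfolding Int_stable_def G_def by (auto simp: box_Int_box)
    moreover have "G \<subseteq> Pow UNIV" by simp
    moreover have "B \<in> sigma_sets UNIV G" using B borel by simp
    ultimately show ?thesis
    proof (induction B rule: sigma_sets_induct_disjoint)
      case (basic A)
      then show ?case by (auto simp: G_def box)
    next
      case empty
      then show ?case by (simp add: set_lebesgue_integral_def)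
    next
      case (compl A)
      then have A: "A \<in> sets lebesgue" using borel bl by simp
      have "(LINT x:(A \<union> (UNIV - A))|lebesgue. f x) = (LINT x:A|lebesgue. f x) + (LINT x:UNIV - A|lebesgue. f x)"
        using A by (intro set_integral_Un si) auto
      then show ?case using compl UN by simp
    next
      case (union A)
      have A: "A i \<in> sets lebesgue" for i using union(2) bl[of "A i"] unfolding borel by auto
      have "(LINT x:(\<Union>i. A i)|lebesgue. f x) = (\<Sum>i. LINT x:A i|lebesgue. f x)"
        using union(1) A by (intro lebesgue_integral_countable_add si)
          (auto simp: disjoint_family_on_def)
      then show ?case using union(3) by simp
    qed
  qed
  fix A :: "'a set" assume A: "A \<in> sets lebesgue"
  then obtain B N N' where B: "A = B \<union> N" "N \<subseteq> N'" "N' \<in> null_sets lborel" "B \<in> sets lborel"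
    by (rule sets_completionE)
  then have "AE x in lebesgue. indicator A x = (indicator B x :: real)"
    by (intro AE_I'[of N']) (auto simp: null_sets_completionI indicator_def)
  then have "(LINT x:A|lebesgue. f x) = (LINT x:B|lebesgue. f x)"
    unfolding set_lebesgue_integral_def
    using A B f by (intro integral_cong_AE) (auto elim: eventually_mono intro!: borel_measurable_scaleR borel_measurable_indicator bl)
  then show "(LINT x:A|lebesgue. f x) = (LINT x:A|lebesgue. 0)" using *[of B] B by (simp add: set_lebesgue_integral_def)
qed simp

lemma box_indicator_approx:
  fixes a b :: "'a::euclidean_space"
  assumes "box a b \<subseteq> \<Omega>"
  obtains \<phi> :: "nat \<Rightarrow> 'a \<Rightarrow> complex" where
    "\<And>n. \<phi> n \<in> test_functions \<Omega>" "(\<lambda>n. to_l2 (\<phi> n)) \<longlonglongrightarrow> to_l2 (indicator (box a b))"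
proof -
  define s where "s x = complex_of_real (smooth_step x)" for x
  \<comment> \<open>In each coordinate one factor rises between a + 1/n and a + 2/n and the other
    falls between b - 2/n and b - 1/n, so the support keeps distance 1/n from the faces of the box.
    The index is shifted by one later to avoid n = 0.\<close>
  define \<phi> where "\<phi> n x = (\<Prod>i\<in>Basis. s (real n * (x \<bullet> i) + (- real n * (a \<bullet> i) - 1)) * s ((- real n) * (x \<bullet> i) + (real n * (b \<bullet> i) - 1)))"
    for n x
  have s01: "s x = 0" if "x \<le> 0" for x using that by (simp add: s_def smooth_step_eq_0)
  have s1: "s x = 1" if "x \<ge> 1" for x using that by (simp add: s_def smooth_step_eq_1)
  have sb: "cmod (s x) \<le> 1" for x using smooth_step_bounds[of x] by (simp add: s_def)
  have C: "C_k k (\<phi> n)" for n k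
    unfolding \<phi>_def s_def by (intro C_k_prod C_k_mult C_k_real_compose[OF C_k_smooth_step])
  define e :: "nat \<Rightarrow> 'a" where "e n = (\<Sum>i\<in>Basis. (1 / real (Suc n)) *\<^sub>R i)" for n
  have e: "e n \<bullet> i = 1 / real (Suc n)" if "i \<in> Basis" for n i
    unfolding e_def using that by (rule inner_sum_left_Basis)
  define K where "K n = cbox (a + e n) (b - e n)" for n
  have K0: "\<phi> (Suc n) x = 0" if x: "x \<notin> K n" for x n
  proof -
    obtain i where i: "i \<in> Basis" "\<not> ((a + e n) \<bullet> i \<le> x \<bullet> i \<and> x \<bullet> i \<le> (b - e n) \<bullet> i)"
      using x by (auto simp: K_def mem_box)
    then have "x \<bullet> i < a \<bullet> i + 1 / real (Suc n) \<or> x \<bullet> i > b \<bullet> i - 1 / real (Suc n)"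
      by (auto simp: inner_simps e simp del: of_nat_Suc)
    then have "real (Suc n) * (x \<bullet> i) + (- real (Suc n) * (a \<bullet> i) - 1) \<le> 0 \<or> (- real (Suc n)) * (x \<bullet> i) + (real (Suc n) * (b \<bullet> i) - 1) \<le> 0"
      by (auto simp: field_simps)
    then show ?thesis unfolding \<phi>_def using i(1) by (intro prod_zero) (auto intro!: bexI[of _ i] s01)
  qed
  have Kbox: "K n \<subseteq> box a b" for n
  proof
    fix x assume x: "x \<in> K n"
    have "a \<bullet> i < x \<bullet> i \<and> x \<bullet> i < b \<bullet> i" if "i \<in> Basis" for i
    proof -
      have "a \<bullet> i + 1 / real (Suc n) \<le> x \<bullet> i" "x \<bullet> i \<le> b \<bullet> i - 1 / real (Suc n)"
        using x that by (auto simp: K_def mem_box inner_simps e simp del: of_nat_Suc)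
      moreover have "1 / real (Suc n) > 0" by simp
      ultimately show ?thesis by linarith
    qed
    then show "x \<in> box a b" by (simp add: mem_box)
  qed
  have T: "\<phi> (Suc n) \<in> test_functions \<Omega>" for n
    unfolding test_functions_def mem_Collect_eq
    by (intro conjI allI C exI[of _ "K n"] impI K0) (use Kbox assms in \<open>auto simp: K_def\<close>)
  have "(\<lambda>n. to_l2 (\<phi> (Suc n))) \<longlonglongrightarrow> to_l2 (indicator (box a b))"
  proof (rule to_l2_dominated_convergence(3)[OF sq_integrable_indicator_subset[of "box a b" a b 1], where C = 1])
    show "AE x in lebesgue. cmod (\<phi> (Suc i) x) \<le> 1 * cmod (1 * indicator (box a b) x)" for i
    proof (intro AE_I2)
      fix x
      have "cmod (\<phi> (Suc i) x) \<le> 1"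
        unfolding \<phi>_def by (simp only: prod_norm[symmetric] norm_mult) (intro prod_le_1 conjI mult_nonneg_nonneg mult_le_one sb norm_ge_zero)
      then show "cmod (\<phi> (Suc i) x) \<le> 1 * cmod (1 * indicator (box a b) x)"
        using K0[of x i] Kbox[of i] by (cases "x \<in> box a b") auto
    qed
    show "AE x in lebesgue. (\<lambda>i. \<phi> (Suc i) x) \<longlonglongrightarrow> indicator (box a b) x"
    proof (intro AE_I2)
      fix x
      show "(\<lambda>i. \<phi> (Suc i) x) \<longlonglongrightarrow> indicator (box a b) x"
      proof (cases "x \<in> box a b")
        case False
        then have "\<phi> (Suc i) x = 0" for i using K0 Kbox by blast
        then show ?thesis using False by simp
      next
        case True
        have "eventually (\<lambda>n. s (real n * (x \<bullet> i) + (- real n * (a \<bullet> i) - 1)) * s ((- real n) * (x \<bullet> i) + (real n * (b \<bullet> i) - 1)) = 1) sequentially"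
          if "i \<in> Basis" for i
        proof -
          have pos: "x \<bullet> i - a \<bullet> i > 0" "b \<bullet> i - x \<bullet> i > 0" using True that by (auto simp: mem_box)
          have ev: "eventually (\<lambda>n. real n * c \<ge> 2) sequentially" if "c > 0" for c
          proof -
            obtain m :: nat where "2 / c \<le> m" using real_arch_simple by blast
            then show ?thesis using that
              by (intro eventually_sequentiallyI[of m]) (auto simp: field_simps intro: order_trans mult_left_mono)
          qed
          show ?thesis using ev[OF pos(1)] ev[OF pos(2)]
            by eventually_elim (simp add: s1 algebra_simps)
        qed
        then have "eventually (\<lambda>n. \<forall>i\<in>Basis. s (real n * (x \<bullet> i) + (- real n * (a \<bullet> i) - 1)) * s ((- real n) * (x \<bullet> i) + (real n * (b \<bullet> i) - 1)) = 1) sequentially"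
          by (intro eventually_ball_finite) auto
        then have "eventually (\<lambda>n. \<phi> n x = 1) sequentially"
          by eventually_elim (auto simp: \<phi>_def intro: prod.neutral)
        then have "eventually (\<lambda>n. \<phi> (Suc n) x = 1) sequentially"
          by (rule eventually_sequentially_Suc[of "\<lambda>n. \<phi> n x = 1", THEN iffD2])
        then show ?thesis using True by (intro tendsto_eventually) simp
      qed
    qed
  qed (use T test_functions_measurable in \<open>auto intro!: borel_measurable_indicator\<close>)
  with T show ?thesis by (rule that)
qed

text \<open>Indicators of boxes in \<Omega> are limits in \<open>L\<^sup>2\<close> of test
  functions, so g has integral 0 over every such box. On a single box g is integrable and hence
  vanishes a.e.; countably many boxes exhaust \<Omega>.\<close>

lemma fundamental_lemma:
  fixes g :: "'a::euclidean_space l2"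
  assumes \<Omega>: "open \<Omega>" and g: "g \<in> L2_on \<Omega>" and 0: "\<And>\<phi>. \<phi> \<in> test_functions \<Omega> \<Longrightarrow> l2_bil g (to_l2 \<phi>) = 0"
  shows "g = 0"
proof -
  have box0: "(LINT x:box a b|lebesgue. l2_fun g x) = 0" if ab: "box a b \<subseteq> \<Omega>" for a b
  proof -
    obtain \<phi> :: "nat \<Rightarrow> 'a \<Rightarrow> complex" where \<phi>: "\<And>n. \<phi> n \<in> test_functions \<Omega>" "(\<lambda>n. to_l2 (\<phi> n)) \<longlonglongrightarrow> to_l2 (indicator (box a b))"
      using box_indicator_approx[OF ab] by blast
    have "(\<lambda>n. l2_bil g (to_l2 (\<phi> n))) \<longlonglongrightarrow> l2_bil g (to_l2 (indicator (box a b)))"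
      by (intro bounded_bilinear.tendsto[OF bounded_bilinear_l2_bil] \<phi> tendsto_const)
    then have "l2_bil g (to_l2 (indicator (box a b))) = 0" using 0[OF \<phi>(1)] by (simp add: LIMSEQ_const_iff)
    moreover have "sq_integrable (indicator (box a b) :: 'a \<Rightarrow> complex)"
      using sq_integrable_indicator_subset[of "box a b" a b 1] by simp
    ultimately have "(LINT x|lebesgue. l2_fun g x * indicator (box a b) x) = 0"
      using l2_bil_to_l2[OF sq_integrable_l2_fun[of g]] by simp
    moreover have "(\<lambda>x. l2_fun g x * indicator (box a b) x) = (\<lambda>x. indicator (box a b) x *\<^sub>R l2_fun g x)"
      by (auto simp: indicator_def)
    ultimately show ?thesis by (simp add: set_lebesgue_integral_def)
  qed
  have ae: "AE x in lebesgue. x \<in> box p q \<longrightarrow> l2_fun g x = 0" if pq: "box p q \<subseteq> \<Omega>" for p q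
  proof -
    have "AE x in lebesgue. indicator (box p q) x *\<^sub>R l2_fun g x = 0"
    proof (rule AE_0_of_box_integrals[where p = p and q = q])
      \<comment> \<open>A square-integrable function need not be integrable on the whole space, but
        it is on a box, by the Cauchy-Schwarz inequality against the indicator.\<close>
      have "integrable lebesgue (\<lambda>x. 1 * indicator (box p q) x * l2_fun g x)"
        by (rule l2_Cauchy_Schwarz(1)[OF sq_integrable_indicator_subset sq_integrable_l2_fun]) auto
      moreover have "(\<lambda>x. 1 * indicator (box p q) x * l2_fun g x) = (\<lambda>x. indicator (box p q) x *\<^sub>R l2_fun g x)"
        by (auto simp: indicator_def)
      ultimately show "integrable lebesgue (\<lambda>x. indicator (box p q) x *\<^sub>R l2_fun g x)" by simp
      show "(LINT x:box a b|lebesgue. indicator (box p q) x *\<^sub>R l2_fun g x) = 0" for a b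
      proof -
        obtain c d where cd: "box a b \<inter> box p q = box c d" using box_Int_box by blast
        have "(LINT x:box a b|lebesgue. indicator (box p q) x *\<^sub>R l2_fun g x) = (LINT x:box c d|lebesgue. l2_fun g x)"
          unfolding set_lebesgue_integral_def cd[symmetric] by (simp add: indicator_inter_arith)
        also have "\<dots> = 0" using cd pq by (intro box0) auto
        finally show ?thesis .
      qed
    qed simp
    then show ?thesis by (auto elim: eventually_mono)
  qed
  obtain D where D: "countable D" "D \<subseteq> Pow \<Omega>" "\<And>X. X \<in> D \<Longrightarrow> \<exists>a b. X = box a b" "\<Union>D = \<Omega>"
    using open_countable_Union_open_box[OF \<Omega>] by metis
  have "AE x in lebesgue. \<forall>X\<in>D. x \<in> X \<longrightarrow> l2_fun g x = 0"
  proof (subst AE_ball_countable[OF D(1)], rule ballI)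
    fix X assume X: "X \<in> D"
    then obtain a b where "X = box a b" using D(3) by blast
    then show "AE x in lebesgue. x \<in> X \<longrightarrow> l2_fun g x = 0" using ae[of a b] D(2) X by auto
  qed
  moreover have "AE x in lebesgue. x \<notin> \<Omega> \<longrightarrow> l2_fun g x = 0" using g by (simp add: L2_on_def)
  ultimately have "AE x in lebesgue. l2_fun g x = l2_fun 0 x"
    using l2_fun_0 by eventually_elim (use D(4) in auto)
  then show ?thesis by (rule l2_eqI)
qed

section \<open>Weak derivatives\<close>

lemma integral_lebesgue_on_test:
  assumes "open \<Omega>" "\<phi> \<in> test_functions \<Omega>"
  shows "(LINT x|lebesgue_on \<Omega>. l2_fun f x * \<phi> x) = l2_bil f (to_l2 \<phi>)"
proof -
  have "(LINT x|lebesgue_on \<Omega>. l2_fun f x * \<phi> x) = (LINT x|lebesgue. indicator \<Omega> x *\<^sub>R (l2_fun f x * \<phi> x))"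
    using assms(1) by (intro integral_restrict_space) auto
  also have "(\<lambda>x. indicator \<Omega> x *\<^sub>R (l2_fun f x * \<phi> x)) = (\<lambda>x. l2_fun f x * \<phi> x)"
    using assms(2) by (auto simp: fun_eq_iff indicator_def test_functions_def)
  also have "(LINT x|lebesgue. l2_fun f x * \<phi> x) = l2_bil f (to_l2 \<phi>)"
    using l2_bil_to_l2[OF sq_integrable_l2_fun[of f] sq_integrable_test[OF assms(2)]] by simp
  finally show ?thesis .
qed

text \<open>Test functions vanish outside \<Omega>, so integrals over \<Omega> become pairings over
  the whole space. From here on only the bilinearity, continuity and symmetries of
  \<open>l2_bil\<close> matter.\<close>

lemma is_weak_deriv_iff:
  assumes "open \<Omega>" "b \<in> Basis"
  shows "is_weak_deriv \<Omega> b f g \<longleftrightarrow> f \<in> L2_on \<Omega> \<and> g \<in> L2_on \<Omega> \<and>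
    (\<forall>\<phi>\<in>test_functions \<Omega>. l2_bil f (to_l2 (dir_deriv b \<phi>)) = - l2_bil g (to_l2 \<phi>))"
  using assms by (auto simp: is_weak_deriv_def integral_lebesgue_on_test dir_deriv_test)

lemma weak_deriv_unique:
  assumes "open \<Omega>" "b \<in> Basis" "is_weak_deriv \<Omega> b f g" "is_weak_deriv \<Omega> b f g'"
  shows "g = g'"
proof -
  interpret bounded_bilinear l2_bil by (rule bounded_bilinear_l2_bil)
  have "g - g' \<in> L2_on \<Omega>"
    using assms closed_subspace_L2_on(1)[of \<Omega>] by (auto simp: is_weak_deriv_iff intro: subspace_diff)
  then have "g - g' = 0"
    using assms by (intro fundamental_lemma) (auto simp: is_weak_deriv_iff diff_left)
  then show ?thesis by simp
qed

lemma weak_deriv_eq: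
  assumes "open \<Omega>" "b \<in> Basis" "is_weak_deriv \<Omega> b f g"
  shows "weak_deriv \<Omega> b f = g"
  unfolding weak_deriv_def using weak_deriv_unique[OF assms(1,2)] assms(3) by blast

lemma H1_weak_deriv:
  assumes "open \<Omega>" "b \<in> Basis" "f \<in> H1 \<Omega>"
  shows "is_weak_deriv \<Omega> b f (weak_deriv \<Omega> b f)"
  using assms weak_deriv_eq[OF assms(1,2)] by (auto simp: H1_def)

lemma is_weak_deriv_add:
  assumes "open \<Omega>" "b \<in> Basis" "is_weak_deriv \<Omega> b f g" "is_weak_deriv \<Omega> b f' g'"
  shows "is_weak_deriv \<Omega> b (f + f') (g + g')"
proof -
  interpret bounded_bilinear l2_bil by (rule bounded_bilinear_l2_bil)
  show ?thesis using assms closed_subspace_L2_on(1)[of \<Omega>]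
    by (auto simp: is_weak_deriv_iff add_left intro: subspace_add)
qed

lemma is_weak_deriv_scaleR:
  assumes "open \<Omega>" "b \<in> Basis" "is_weak_deriv \<Omega> b f g"
  shows "is_weak_deriv \<Omega> b (c *\<^sub>R f) (c *\<^sub>R g)"
proof -
  interpret bounded_bilinear l2_bil by (rule bounded_bilinear_l2_bil)
  show ?thesis using assms closed_subspace_L2_on(1)[of \<Omega>]
    by (auto simp: is_weak_deriv_iff scaleR_left intro: subspace_scale)
qed

lemma is_weak_deriv_diff:
  assumes "open \<Omega>" "b \<in> Basis" "is_weak_deriv \<Omega> b f g" "is_weak_deriv \<Omega> b f' g'"
  shows "is_weak_deriv \<Omega> b (f - f') (g - g')"
  using is_weak_deriv_add[OF assms(1-3) is_weak_deriv_scaleR[OF assms(1,2,4), of "-1"]] by simp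

lemma is_weak_deriv_test:
  assumes "open \<Omega>" "b \<in> Basis" "\<phi> \<in> test_functions \<Omega>"
  shows "is_weak_deriv \<Omega> b (to_l2 \<phi>) (to_l2 (dir_deriv b \<phi>))"
  using assms by (auto simp: is_weak_deriv_iff test_functions_in_L2_on dir_deriv_test integration_by_parts_test)

text \<open>Each side of the defining identity is continuous in \<open>L\<^sup>2\<close> for a fixed
  test function, and \<open>L2_on \<Omega>\<close> is closed.\<close>

lemma is_weak_deriv_LIMSEQ:
  assumes "open \<Omega>" "b \<in> Basis" and wd: "\<And>n. is_weak_deriv \<Omega> b (f n) (g n)" and lim: "f \<longlonglongrightarrow> l" "g \<longlonglongrightarrow> m"
  shows "is_weak_deriv \<Omega> b l m"
proof -
  interpret bounded_bilinear l2_bil by (rule bounded_bilinear_l2_bil)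
  have wd': "f n \<in> L2_on \<Omega>" "g n \<in> L2_on \<Omega>"
    "\<phi> \<in> test_functions \<Omega> \<Longrightarrow> l2_bil (f n) (to_l2 (dir_deriv b \<phi>)) = - l2_bil (g n) (to_l2 \<phi>)" for n \<phi>
    using wd assms(1,2) by (auto simp: is_weak_deriv_iff)
  have c: "closed (L2_on \<Omega>)" using assms(1) by (intro closed_subspace_L2_on) auto
  have "l2_bil l (to_l2 (dir_deriv b \<phi>)) = - l2_bil m (to_l2 \<phi>)" if "\<phi> \<in> test_functions \<Omega>" for \<phi>
  proof (rule LIMSEQ_unique)
    show "(\<lambda>n. l2_bil (f n) (to_l2 (dir_deriv b \<phi>))) \<longlonglongrightarrow> l2_bil l (to_l2 (dir_deriv b \<phi>))"
      by (intro tendsto lim tendsto_const)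
    have "(\<lambda>n. - l2_bil (g n) (to_l2 \<phi>)) \<longlonglongrightarrow> - l2_bil m (to_l2 \<phi>)"
      by (intro tendsto_minus tendsto lim tendsto_const)
    then show "(\<lambda>n. l2_bil (f n) (to_l2 (dir_deriv b \<phi>))) \<longlonglongrightarrow> - l2_bil m (to_l2 \<phi>)"
      using wd'(3)[OF that] by simp
  qed
  moreover have "l \<in> L2_on \<Omega>" "m \<in> L2_on \<Omega>"
    using closed_sequentially[OF c _ lim(1)] closed_sequentially[OF c _ lim(2)] wd' by auto
  ultimately show ?thesis using assms(1,2) by (simp add: is_weak_deriv_iff)
qed

text \<open>Names the gradient explicitly. \<open>weak_deriv\<close> is a definite description that
  says nothing until a derivative is known to exist, whereas this approximation property can be
  proved directly and yields that existence.\<close>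

definition H01_grad :: "'a::euclidean_space set \<Rightarrow> 'a l2 \<Rightarrow> ('a \<Rightarrow> 'a l2) \<Rightarrow> bool" where
  "H01_grad \<Omega> f G \<longleftrightarrow>
     (\<forall>\<epsilon>>0. \<exists>\<phi>\<in>test_functions \<Omega>. norm (f - to_l2 \<phi>) < \<epsilon> \<and> (\<forall>b\<in>Basis. norm (G b - to_l2 (dir_deriv b \<phi>)) < \<epsilon>))"

lemma H01_grad_sequence:
  assumes "H01_grad \<Omega> f G"
  obtains \<phi> where "\<And>n. \<phi> n \<in> test_functions \<Omega>" "(\<lambda>n. to_l2 (\<phi> n)) \<longlonglongrightarrow> f"
    "\<And>b. b \<in> Basis \<Longrightarrow> (\<lambda>n. to_l2 (dir_deriv b (\<phi> n))) \<longlonglongrightarrow> G b"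
proof -
  have "\<forall>n. \<exists>\<phi>. \<phi> \<in> test_functions \<Omega> \<and> norm (f - to_l2 \<phi>) < 1 / real (Suc n) \<and>
      (\<forall>b\<in>Basis. norm (G b - to_l2 (dir_deriv b \<phi>)) < 1 / real (Suc n))"
    using assms unfolding H01_grad_def by (meson divide_pos_pos of_nat_0_less_iff zero_less_Suc zero_less_one)
  then obtain \<phi> where \<phi>: "\<And>n. \<phi> n \<in> test_functions \<Omega>" "\<And>n. norm (f - to_l2 (\<phi> n)) < 1 / real (Suc n)"
      "\<And>n b. b \<in> Basis \<Longrightarrow> norm (G b - to_l2 (dir_deriv b (\<phi> n))) < 1 / real (Suc n)" by metis
  have *: "X \<longlonglongrightarrow> l" if "\<And>n. norm (l - X n) < 1 / real (Suc n)" for X and l :: "'a l2"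
    \<comment> \<open>The null sequence l - X n is subtracted from the constant l.\<close>
    using LIMSEQ_norm_0[of "\<lambda>n. l - X n", OF that] tendsto_diff[OF tendsto_const[of l] , of "\<lambda>n. l - X n" 0] by simp
  show ?thesis by (rule that[of \<phi>]) (intro \<phi> *, assumption?)+
qed

lemma H01_gradI_sequence:
  assumes "\<And>n. \<phi> n \<in> test_functions \<Omega>" "(\<lambda>n. to_l2 (\<phi> n)) \<longlonglongrightarrow> f"
    "\<And>b. b \<in> Basis \<Longrightarrow> (\<lambda>n. to_l2 (dir_deriv b (\<phi> n))) \<longlonglongrightarrow> G b"
  shows "H01_grad \<Omega> f G"
  unfolding H01_grad_def
proof (intro allI impI)
  fix e :: real assume e: "e > 0"
  have "eventually (\<lambda>n. norm (f - to_l2 (\<phi> n)) < e) sequentially"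
    using tendstoD[OF assms(2) e] by (simp add: dist_norm norm_minus_commute)
  moreover have "eventually (\<lambda>n. \<forall>b\<in>Basis. norm (G b - to_l2 (dir_deriv b (\<phi> n))) < e) sequentially"
    using tendstoD[OF assms(3) e] by (intro eventually_ball_finite) (auto simp: dist_norm norm_minus_commute)
  ultimately have "eventually (\<lambda>n. norm (f - to_l2 (\<phi> n)) < e \<and> (\<forall>b\<in>Basis. norm (G b - to_l2 (dir_deriv b (\<phi> n))) < e)) sequentially"
    by (rule eventually_conj)
  then obtain n where "norm (f - to_l2 (\<phi> n)) < e \<and> (\<forall>b\<in>Basis. norm (G b - to_l2 (dir_deriv b (\<phi> n))) < e)"
    by (auto dest!: eventually_happens'[OF sequentially_bot])
  then show "\<exists>\<phi>\<in>test_functions \<Omega>. norm (f - to_l2 \<phi>) < e \<and> (\<forall>b\<in>Basis. norm (G b - to_l2 (dir_deriv b \<phi>)) < e)"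
    using assms(1) by blast
qed

text \<open>Closedness in the graph norm. It permits a second limit when each approximant of an
  element is itself only a limit of test functions.\<close>

lemma H01_grad_LIMSEQ:
  assumes "\<And>n. H01_grad \<Omega> (f n) (G n)" "f \<longlonglongrightarrow> l" "\<And>b. b \<in> Basis \<Longrightarrow> (\<lambda>n. G n b) \<longlonglongrightarrow> L b"
  shows "H01_grad \<Omega> l L"
  unfolding H01_grad_def
proof (intro allI impI)
  fix e :: real assume "e > 0"
  then have e: "e / 2 > 0" by simp
  have "eventually (\<lambda>n. norm (l - f n) < e / 2) sequentially"
    using tendstoD[OF assms(2) e] by (simp add: dist_norm norm_minus_commute)
  moreover have "eventually (\<lambda>n. \<forall>b\<in>Basis. norm (L b - G n b) < e / 2) sequentially"
    using tendstoD[OF assms(3) e] by (intro eventually_ball_finite) (auto simp: dist_norm norm_minus_commute)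
  ultimately have "eventually (\<lambda>n. norm (l - f n) < e / 2 \<and> (\<forall>b\<in>Basis. norm (L b - G n b) < e / 2)) sequentially"
    by (rule eventually_conj)
  then obtain n where n: "norm (l - f n) < e / 2" "\<And>b. b \<in> Basis \<Longrightarrow> norm (L b - G n b) < e / 2"
    using eventually_happens'[OF sequentially_bot] by blast
  obtain \<phi> where \<phi>: "\<phi> \<in> test_functions \<Omega>" "norm (f n - to_l2 \<phi>) < e / 2"
      "\<And>b. b \<in> Basis \<Longrightarrow> norm (G n b - to_l2 (dir_deriv b \<phi>)) < e / 2"
    using assms(1)[of n] e unfolding H01_grad_def by blast
  have "norm (l - to_l2 \<phi>) < e" using norm_triangle_lt[of "l - f n" "f n - to_l2 \<phi>" e] n \<phi> by simp
  moreover have "norm (L b - to_l2 (dir_deriv b \<phi>)) < e" if "b \<in> Basis" for b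
    using norm_triangle_lt[of "L b - G n b" "G n b - to_l2 (dir_deriv b \<phi>)" e] n(2)[OF that] \<phi>(3)[OF that] by simp
  ultimately show "\<exists>\<phi>\<in>test_functions \<Omega>. norm (l - to_l2 \<phi>) < e \<and> (\<forall>b\<in>Basis. norm (L b - to_l2 (dir_deriv b \<phi>)) < e)"
    using \<phi>(1) by blast
qed

lemma H01_grad_is_weak_deriv:
  assumes "open \<Omega>" "H01_grad \<Omega> f G" "b \<in> Basis"
  shows "is_weak_deriv \<Omega> b f (G b)"
proof -
  obtain \<phi> where \<phi>: "\<And>n. \<phi> n \<in> test_functions \<Omega>" "(\<lambda>n. to_l2 (\<phi> n)) \<longlonglongrightarrow> f"
      "\<And>b. b \<in> Basis \<Longrightarrow> (\<lambda>n. to_l2 (dir_deriv b (\<phi> n))) \<longlonglongrightarrow> G b"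
    using H01_grad_sequence[OF assms(2)] by blast
  show ?thesis
    by (rule is_weak_deriv_LIMSEQ[OF assms(1,3) _ \<phi>(2) \<phi>(3)[OF assms(3)]])
       (intro is_weak_deriv_test assms \<phi>)
qed

lemma H01_iff:
  assumes "open \<Omega>"
  shows "f \<in> H01 \<Omega> \<longleftrightarrow> (\<exists>G. H01_grad \<Omega> f G)"
proof
  assume f: "f \<in> H01 \<Omega>"
  then have H1: "f \<in> H1 \<Omega>" by (simp add: H01_def)
  have "H01_grad \<Omega> f (\<lambda>b. weak_deriv \<Omega> b f)"
    unfolding H01_grad_def
  proof (intro allI impI)
    fix e :: real assume "e > 0"
    then obtain \<phi> where \<phi>: "\<phi> \<in> test_functions \<Omega>" "h1_norm \<Omega> (f - to_l2 \<phi>) < e" using f by (auto simp: H01_def)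
    have D: "weak_deriv \<Omega> b (f - to_l2 \<phi>) = weak_deriv \<Omega> b f - to_l2 (dir_deriv b \<phi>)" if "b \<in> Basis" for b
      using that assms \<phi> H1 by (intro weak_deriv_eq is_weak_deriv_diff H1_weak_deriv is_weak_deriv_test)
    have "norm (f - to_l2 \<phi>) \<le> h1_norm \<Omega> (f - to_l2 \<phi>)"
      unfolding h1_norm_def by (intro real_le_rsqrt) (simp add: sum_nonneg)
    moreover have "norm (weak_deriv \<Omega> b f - to_l2 (dir_deriv b \<phi>)) \<le> h1_norm \<Omega> (f - to_l2 \<phi>)" if "b \<in> Basis" for b
      unfolding h1_norm_def D[OF that, symmetric] using that
      by (intro real_le_rsqrt add_increasing member_le_sum[of b Basis "\<lambda>b. (norm (weak_deriv \<Omega> b (f - to_l2 \<phi>)))\<^sup>2"]) auto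
    ultimately show "\<exists>\<phi>\<in>test_functions \<Omega>. norm (f - to_l2 \<phi>) < e \<and> (\<forall>b\<in>Basis. norm (weak_deriv \<Omega> b f - to_l2 (dir_deriv b \<phi>)) < e)"
      using \<phi> by (intro bexI[of _ \<phi>]) (auto intro: le_less_trans)
  qed
  then show "\<exists>G. H01_grad \<Omega> f G" by blast
next
  assume "\<exists>G. H01_grad \<Omega> f G"
  then obtain G where G: "H01_grad \<Omega> f G" by blast
  note wd = H01_grad_is_weak_deriv[OF assms G]
  \<comment> \<open>Support in \<Omega> is part of \<open>is_weak_deriv\<close>, so any one basis
    direction supplies it.\<close>
  have "f \<in> L2_on \<Omega>" using wd[OF SOME_Basis] by (simp add: is_weak_deriv_def)
  then have H1: "f \<in> H1 \<Omega>" using wd by (auto simp: H1_def)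
  obtain \<phi> where \<phi>: "\<And>n. \<phi> n \<in> test_functions \<Omega>" "(\<lambda>n. to_l2 (\<phi> n)) \<longlonglongrightarrow> f"
      "\<And>b. b \<in> Basis \<Longrightarrow> (\<lambda>n. to_l2 (dir_deriv b (\<phi> n))) \<longlonglongrightarrow> G b"
    using H01_grad_sequence[OF G] by blast
  have D: "weak_deriv \<Omega> b (f - to_l2 (\<phi> n)) = G b - to_l2 (dir_deriv b (\<phi> n))" if "b \<in> Basis" for b n
    using that assms \<phi> wd by (intro weak_deriv_eq is_weak_deriv_diff is_weak_deriv_test)
  have "(\<lambda>n. sqrt ((norm (f - to_l2 (\<phi> n)))\<^sup>2 + (\<Sum>b\<in>Basis. (norm (G b - to_l2 (dir_deriv b (\<phi> n))))\<^sup>2)))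
      \<longlonglongrightarrow> sqrt ((norm (f - f))\<^sup>2 + (\<Sum>b\<in>Basis. (norm (G b - G b))\<^sup>2))"
    by (intro tendsto_intros \<phi>)
  then have lim: "(\<lambda>n. h1_norm \<Omega> (f - to_l2 (\<phi> n))) \<longlonglongrightarrow> 0" by (simp add: h1_norm_def D)
  have "\<exists>\<phi>\<in>test_functions \<Omega>. h1_norm \<Omega> (f - to_l2 \<phi>) < e" if "e > 0" for e
    using order_tendstoD(2)[OF lim that] \<phi>(1) by (auto dest!: eventually_happens'[OF sequentially_bot])
  then show "f \<in> H01 \<Omega>" using H1 by (simp add: H01_def)
qed

section \<open>Approximation on the half domain\<close>

text \<open>The eigenvalue of the reflection at the basis vector b, and therefore the factor a
  derivative in direction b picks up.\<close>

definition mirror_sign :: "'n::finite \<Rightarrow> real ^ 'n \<Rightarrow> real" where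
  "mirror_sign k b = (if b = axis k 1 then -1 else 1)"

lemma mirror_sign_square [simp]: "mirror_sign k b * mirror_sign k b = 1" "mirror_sign k b * (mirror_sign k b * c) = c"
  by (auto simp: mirror_sign_def)

lemma mirror_Basis: "b \<in> Basis \<Longrightarrow> mirror k b = mirror_sign k b *\<^sub>R b"
proof -
  assume "b \<in> Basis"
  then obtain i where "b = axis i 1" by (auto simp: Basis_vec_def)
  then show ?thesis by (auto simp: mirror_sign_def axis_eq_axis mirror_def vec_eq_iff) (auto simp: axis_def)
qed

lemma inner_axis_Basis: "b \<in> Basis \<Longrightarrow> b \<bullet> axis k (1::real) = (if b = axis k 1 then 1 else 0)"
proof -
  assume "b \<in> Basis"
  then obtain i where "b = axis i 1" by (auto simp: Basis_vec_def)
  then show ?thesis by (simp add: inner_axis axis_eq_axis) (simp add: axis_def)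
qed

lemma dir_deriv_mirror:
  assumes "b \<in> Basis" "f differentiable at (mirror k x)"
  shows "dir_deriv b (\<lambda>x. f (mirror k x)) x = complex_of_real (mirror_sign k b) * dir_deriv b f (mirror k x)"
  using dir_deriv_compose(1)[OF linear_mirror mirror_Basis[OF assms(1)], where f = f and x = x and d = 0] assms(2) by simp

lemma test_functions_mirror:
  assumes "\<phi> \<in> test_functions \<Omega>"
  shows "(\<lambda>x. \<phi> (mirror k x)) \<in> test_functions (mirror k ` \<Omega>)"
proof -
  obtain K where K: "compact K" "K \<subseteq> \<Omega>" "\<And>x. x \<notin> K \<Longrightarrow> \<phi> x = 0" using assms by (auto simp: test_functions_def)
  have "compact (mirror k ` K)"
    using K(1) by (intro compact_continuous_image linear_continuous_on) (simp_all add: linear_mirror linear_conv_bounded_linear[symmetric])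
  moreover have "C_k j (\<lambda>x. \<phi> (mirror k x))" for j
    using C_k_compose[OF linear_mirror mirror_Basis _ test_functions_C_k[OF assms], where d = 0 and k = j] mirror_Basis by simp
  moreover have "\<phi> (mirror k x) = 0" if "x \<notin> mirror k ` K" for x using K(3) that by (simp add: mem_mirror_image)
  ultimately show ?thesis unfolding test_functions_def using K(2) by blast
qed

section \<open>Odd and even extension across the hyperplane\<close>

locale mirror_domain =
  fixes k :: "'n::finite" and \<Omega> \<Omega>' :: "(real ^ 'n) set"
  assumes open': "open \<Omega>'" and mirror_domain: "mirror k ` \<Omega>' = \<Omega>'"
    and half: "\<Omega> = \<Omega>' \<inter> {x. x $ k > 0}"
begin

lemma open_half: "open \<Omega>"
  unfolding half using open' by (intro open_Int open_Collect_less continuous_intros)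

lemma sets [simp]: "\<Omega> \<in> sets lebesgue" "\<Omega>' \<in> sets lebesgue"
  using open' open_half by auto

lemma mirror_mem: "mirror k x \<in> \<Omega>' \<longleftrightarrow> x \<in> \<Omega>'"
  using mirror_domain by (metis mem_mirror_image)

text \<open>Up to this null set, \<Omega>' is the disjoint union of \<Omega> and its mirror
  image.\<close>

lemma AE_not_hyperplane: "AE x :: real ^ 'n in lebesgue. x $ k \<noteq> 0"
proof -
  have "negligible {x :: real ^ 'n. x \<bullet> axis k 1 = 0}"
    by (rule negligible_standard_hyperplane) (simp add: axis_in_Basis_iff)
  then have "{x :: real ^ 'n. x $ k = 0} \<in> null_sets lebesgue"
    by (simp add: negligible_iff_null_sets inner_axis)
  then show ?thesis by (rule AE_I') auto
qed

text \<open>For \<open>\<epsilon> = \<plusminus>1\<close> these are the operators \<open>E\<close> and \<open>E\<^sup>*\<close> of the introduction; signs \<open>\<epsilon>\<close> that differ from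
  the one of the boundary condition occur for the normal derivative.\<close>

definition ext :: "real \<Rightarrow> (real ^ 'n) l2 \<Rightarrow> (real ^ 'n) l2" where
  "ext \<epsilon> f = f + \<epsilon> *\<^sub>R l2_mirror k f"

definition rst :: "real \<Rightarrow> (real ^ 'n) l2 \<Rightarrow> (real ^ 'n) l2" where
  "rst \<epsilon> f = cutoff \<Omega> (ext \<epsilon> f)"

lemma bounded_linear_ext: "bounded_linear (ext \<epsilon>)"
  unfolding ext_def[abs_def]
  by (intro bounded_linear_add bounded_linear_ident bounded_linear_const_scaleR bounded_linear_l2_mirror)

lemma bounded_linear_rst: "bounded_linear (rst \<epsilon>)"
  unfolding rst_def[abs_def]
  by (rule bounded_linear_compose[OF bounded_linear_cutoff bounded_linear_ext]) simp

lemma l2_fun_ext: "AE x in lebesgue. l2_fun (ext \<epsilon> f) x = l2_fun f x + \<epsilon> *\<^sub>R l2_fun f (mirror k x)"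
  unfolding ext_def
  using l2_fun_add[of f "\<epsilon> *\<^sub>R l2_mirror k f"] l2_fun_scaleR[of \<epsilon> "l2_mirror k f"] l2_fun_mirror[of k f]
  by eventually_elim simp

lemma l2_fun_rst: "AE x in lebesgue. l2_fun (rst \<epsilon> f) x = indicator \<Omega> x * (l2_fun f x + \<epsilon> *\<^sub>R l2_fun f (mirror k x))"
  unfolding rst_def using l2_fun_cutoff[OF sets(1), of "ext \<epsilon> f"] l2_fun_ext[of \<epsilon> f]
  by eventually_elim simp

lemma ext_in_L2_on: "f \<in> L2_on \<Omega>' \<Longrightarrow> ext \<epsilon> f \<in> L2_on \<Omega>'"
proof -
  assume f: "f \<in> L2_on \<Omega>'"
  then have f': "AE x in lebesgue. x \<notin> \<Omega>' \<longrightarrow> l2_fun f x = 0" by (simp add: L2_on_def)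
  show ?thesis unfolding L2_on_def mem_Collect_eq
    using l2_fun_ext[of \<epsilon> f] f' AE_mirror[OF f', of k] by eventually_elim (simp add: mirror_mem)
qed

lemma half_in_L2_on: "f \<in> L2_on \<Omega> \<Longrightarrow> f \<in> L2_on \<Omega>'"
  by (rule L2_on_mono) (auto simp: half)

lemma rst_in_L2_on: "rst \<epsilon> f \<in> L2_on \<Omega>"
  unfolding rst_def by (rule cutoff_in_L2_on) simp

text \<open>On \<Omega> the extension agrees with f, and its reflection there is \<epsilon> f; the
  second factor \<epsilon> turns this into another copy of f.\<close>

lemma rst_ext:
  assumes "f \<in> L2_on \<Omega>" "\<epsilon> * \<epsilon> = 1"
  shows "rst \<epsilon> (ext \<epsilon> f) = 2 *\<^sub>R f"
proof (rule l2_eqI)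
  have f: "AE x in lebesgue. x \<notin> \<Omega> \<longrightarrow> l2_fun f x = 0" using assms(1) by (simp add: L2_on_def)
  show "AE x in lebesgue. l2_fun (rst \<epsilon> (ext \<epsilon> f)) x = l2_fun (2 *\<^sub>R f) x"
    using l2_fun_rst[of \<epsilon> "ext \<epsilon> f"] l2_fun_ext[of \<epsilon> f] AE_mirror[OF l2_fun_ext[of \<epsilon> f], of k] f
      AE_mirror[OF f, of k] l2_fun_scaleR[of 2 f]
  proof eventually_elim
    case (elim x)
    have "x \<in> \<Omega> \<Longrightarrow> mirror k x \<notin> \<Omega>" by (auto simp: half mirror_nth)
    then show ?case using elim assms(2)
      by (cases "x \<in> \<Omega>") (auto simp: scaleR_add_right scaleR_2)
  qed
qed

lemma cutoff_ext:
  assumes "f \<in> L2_on \<Omega>"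
  shows "cutoff \<Omega> (ext \<epsilon> f) = f"
proof (rule l2_eqI)
  have f: "AE x in lebesgue. x \<notin> \<Omega> \<longrightarrow> l2_fun f x = 0" using assms(1) by (simp add: L2_on_def)
  show "AE x in lebesgue. l2_fun (cutoff \<Omega> (ext \<epsilon> f)) x = l2_fun f x"
    using l2_fun_rst[of \<epsilon> f, unfolded rst_def] f AE_mirror[OF f, of k]
  proof eventually_elim
    case (elim x)
    have "x \<in> \<Omega> \<Longrightarrow> mirror k x \<notin> \<Omega>" by (auto simp: half mirror_nth)
    then show ?case using elim by (cases "x \<in> \<Omega>") auto
  qed
qed

text \<open>A function of parity \<epsilon> is determined by its values on one half, the hyperplane
  being null. Together with \<open>cutoff_ext\<close> this makes the cutoff the inverse of the
  extension on functions of that parity.\<close>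

lemma ext_cutoff:
  assumes "f \<in> L2_on \<Omega>'" "l2_mirror k f = \<epsilon> *\<^sub>R f" "\<epsilon> * \<epsilon> = 1"
  shows "ext \<epsilon> (cutoff \<Omega> f) = f"
proof (rule l2_eqI)
  have f: "AE x in lebesgue. x \<notin> \<Omega>' \<longrightarrow> l2_fun f x = 0" using assms(1) by (simp add: L2_on_def)
  have m: "AE x in lebesgue. l2_fun f (mirror k x) = \<epsilon> *\<^sub>R l2_fun f x"
    using l2_fun_mirror[of k f] l2_fun_scaleR[of \<epsilon> f] unfolding assms(2) by eventually_elim simp
  show "AE x in lebesgue. l2_fun (ext \<epsilon> (cutoff \<Omega> f)) x = l2_fun f x"
    using l2_fun_ext[of \<epsilon> "cutoff \<Omega> f"] l2_fun_cutoff[OF sets(1), of f] AE_mirror[OF l2_fun_cutoff[OF sets(1), of f], of k]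
      f m AE_not_hyperplane
  proof eventually_elim
    case (elim x)
    have "\<epsilon> *\<^sub>R \<epsilon> *\<^sub>R l2_fun f x = l2_fun f x" using assms(3) by simp
    then show ?case using elim
      by (cases "x \<in> \<Omega>'"; cases "x $ k > 0") (auto simp: half indicator_def mirror_nth mirror_mem simp del: scaleR_scaleR)
  qed
qed

text \<open>Reflection and cutoff are both symmetric for either pairing, and f is fixed by the
  cutoff.\<close>

lemma
  assumes "f \<in> L2_on \<Omega>"
  shows l2_bil_ext: "l2_bil (ext \<epsilon> f) g = l2_bil f (rst \<epsilon> g)"
    and l2_inner_ext: "l2_inner (ext \<epsilon> f) g = l2_inner f (rst \<epsilon> g)"
proof -
  have f: "cutoff \<Omega> f = f" using assms L2_on_iff_cutoff[of \<Omega> f] by simp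
  show "l2_bil (ext \<epsilon> f) g = l2_bil f (rst \<epsilon> g)"
  proof -
    interpret bounded_bilinear l2_bil by (rule bounded_bilinear_l2_bil)
    have "l2_bil f (rst \<epsilon> g) = l2_bil f (ext \<epsilon> g)" by (simp add: rst_def l2_bil_cutoff[symmetric] f)
    also have "\<dots> = l2_bil (ext \<epsilon> f) g"
      by (simp add: ext_def add_left add_right scaleR_left scaleR_right l2_bil_mirror)
    finally show ?thesis by simp
  qed
  show "l2_inner (ext \<epsilon> f) g = l2_inner f (rst \<epsilon> g)"
  proof -
    interpret bounded_bilinear l2_inner by (rule bounded_bilinear_l2_inner)
    have "l2_inner f (rst \<epsilon> g) = l2_inner f (ext \<epsilon> g)" by (simp add: rst_def l2_inner_cutoff[symmetric] f)
    also have "\<dots> = l2_inner (ext \<epsilon> f) g"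
      by (simp add: ext_def add_left add_right scaleR_left scaleR_right l2_inner_mirror)
    finally show ?thesis by simp
  qed
qed

text \<open>Multiplication by a cutoff in the variable \<open>x\<^sub>k\<close>, which switches on between \<open>1/n\<close> and \<open>2/n\<close>,
  turns a test function of the full domain into one of the half domain. The derivative of the cutoff is
  of order \<open>n\<close>, which is harmless if \<open>\<psi>\<close> vanishes on the hyperplane and so is of order \<open>1/n\<close> there.\<close>

lemma half_approx:
  assumes \<psi>: "\<psi> \<in> test_functions \<Omega>'"
  obtains \<zeta> where "\<And>n. \<zeta> n \<in> test_functions \<Omega>" "(\<lambda>n. to_l2 (\<zeta> n)) \<longlonglongrightarrow> cutoff \<Omega> (to_l2 \<psi>)"
    "\<And>b. b \<in> Basis \<Longrightarrow> b \<noteq> axis k 1 \<or> (\<forall>x. x $ k = 0 \<longrightarrow> \<psi> x = 0) \<Longrightarrow>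
      (\<lambda>n. to_l2 (dir_deriv b (\<zeta> n))) \<longlonglongrightarrow> cutoff \<Omega> (to_l2 (dir_deriv b \<psi>))"
proof -
  define s where "s x = complex_of_real (smooth_step x)" for x
  define \<eta> where "\<eta> n x = s (real (Suc n) * (x \<bullet> axis k 1) + (-1))" for n and x :: "real ^ 'n"
  have inner: "x \<bullet> axis k 1 = x $ k" for x :: "real ^ 'n" by (simp add: inner_axis)
  have Cs: "C_k j s" for j unfolding s_def by (rule C_k_smooth_step)
  have C\<eta>: "C_k j (\<eta> n)" for j n unfolding \<eta>_def by (rule C_k_real_compose[OF Cs])
  have \<eta>_bound: "cmod (\<eta> n x) \<le> 1" for n x
    using smooth_step_bounds by (simp add: \<eta>_def s_def)
  have \<eta>0: "\<eta> n x = 0" if "real (Suc n) * x $ k \<le> 1" for n x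
    using that by (simp add: \<eta>_def s_def inner smooth_step_eq_0 del: of_nat_Suc)
  have \<eta>1: "\<eta> n x = 1" if "real (Suc n) * x $ k \<ge> 2" for n x
    using that by (simp add: \<eta>_def s_def inner smooth_step_eq_1 del: of_nat_Suc)
  define \<zeta> where "\<zeta> n x = \<eta> n x * \<psi> x" for n x
  obtain K where K: "compact K" "K \<subseteq> \<Omega>'" "\<And>x. x \<notin> K \<Longrightarrow> \<psi> x = 0" using \<psi> by (auto simp: test_functions_def)
  have \<zeta>: "\<zeta> n \<in> test_functions \<Omega>" for n
  proof -
    have "compact (K \<inter> {x. real (Suc n) * x $ k \<ge> 1})"
      using K(1) by (intro compact_Int_closed closed_Collect_le continuous_intros)
    moreover have "K \<inter> {x. real (Suc n) * x $ k \<ge> 1} \<subseteq> \<Omega>"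
    proof
      fix x assume x: "x \<in> K \<inter> {x. real (Suc n) * x $ k \<ge> 1}"
      then have "0 < real (Suc n) * x $ k" by auto
      then have "x $ k > 0" by (simp add: zero_less_mult_iff del: of_nat_Suc)
      then show "x \<in> \<Omega>" using x K(2) by (auto simp: half)
    qed
    moreover have "\<zeta> n x = 0" if "x \<notin> K \<inter> {x. real (Suc n) * x $ k \<ge> 1}" for x
      using that K(3)[of x] \<eta>0[of n x] by (cases "x \<in> K") (auto simp: \<zeta>_def)
    moreover have "C_k j (\<zeta> n)" for j unfolding \<zeta>_def using C\<eta> test_functions_C_k[OF \<psi>] by (intro C_k_mult)
    ultimately show ?thesis unfolding test_functions_def by blast
  qed
  have ev: "eventually (\<lambda>n. real (Suc n) * c > 2) sequentially" if "c > 0" for c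
  proof -
    obtain m :: nat where m: "2 / c < m" using reals_Archimedean2 by blast
    show ?thesis
    proof (rule eventually_sequentiallyI[of m])
      fix n assume "m \<le> n"
      then have "2 / c < real (Suc n)" using m by linarith
      then show "real (Suc n) * c > 2" using that by (simp add: pos_divide_less_eq)
    qed
  qed
  have [measurable]: "\<eta> n \<in> borel_measurable lebesgue" for n
    using C\<eta>[of 0 n] by (intro measurable_completion) (simp add: borel_measurable_continuous_onI)
  have lim: "(\<lambda>n. to_l2 (\<lambda>x. \<eta> n x * g x)) \<longlonglongrightarrow> cutoff \<Omega> (to_l2 g)" if g: "g \<in> test_functions \<Omega>'" for g
  proof -
    note [measurable] = test_functions_measurable[OF g]
    have "(\<lambda>n. to_l2 (\<lambda>x. \<eta> n x * g x)) \<longlonglongrightarrow> to_l2 (\<lambda>x. indicator \<Omega> x * g x)"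
    proof (rule to_l2_dominated_convergence(3)[OF sq_integrable_test[OF g], where C = 1])
      show "(\<lambda>x. indicator \<Omega> x * g x) \<in> borel_measurable lebesgue"
        by (intro borel_measurable_times borel_measurable_indicator) auto
      show "AE x in lebesgue. (\<lambda>n. \<eta> n x * g x) \<longlonglongrightarrow> indicator \<Omega> x * g x"
      proof (intro AE_I2)
        fix x
        show "(\<lambda>n. \<eta> n x * g x) \<longlonglongrightarrow> indicator \<Omega> x * g x"
        proof (cases "x $ k > 0")
          case True
          have "eventually (\<lambda>n. \<eta> n x * g x = indicator \<Omega> x * g x) sequentially"
            using ev[OF True]
          proof eventually_elim
            case (elim n)
            have "x \<notin> \<Omega> \<Longrightarrow> g x = 0" using g True by (auto simp: half test_functions_def)
            then show ?case using elim \<eta>1[of n x] by (auto simp: indicator_def)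
          qed
          then show ?thesis by (rule tendsto_eventually)
        next
          case False
          then have "real (Suc n) * x $ k \<le> 1" for n by (intro order_trans[OF mult_nonneg_nonpos]) auto
          then have "\<eta> n x = 0" for n by (rule \<eta>0)
          then show ?thesis using False by (simp add: half)
        qed
      qed
      show "AE x in lebesgue. cmod (\<eta> n x * g x) \<le> 1 * cmod (g x)" for n
        using \<eta>_bound[of n] by (auto simp: norm_mult mult_left_le_one_le)
    qed measurable
    then show ?thesis using sq_integrable_test[OF g] by (simp add: cutoff_to_l2)
  qed
  have "continuous_on (cbox 0 1) (dir_deriv 1 s)"
    using Cs[of "Suc 0"] by (auto intro: continuous_on_subset)
  then have "bounded (dir_deriv 1 s ` cbox 0 1)"
    by (intro compact_imp_bounded compact_continuous_image) auto
  then obtain B where "B > 0" "\<And>y. y \<in> cbox 0 1 \<Longrightarrow> cmod (dir_deriv 1 s y) \<le> B"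
    unfolding bounded_pos by auto
  then have B: "\<And>y. 0 \<le> y \<Longrightarrow> y \<le> 1 \<Longrightarrow> cmod (dir_deriv 1 s y) \<le> B" "B > 0"
    by auto
  \<comment> \<open>Outside the unit interval the step is locally constant, so the derivative of the
    cutoff lives in the transition layer only.\<close>
  have s'0: "dir_deriv 1 s y = 0" if "y < 0 \<or> y > 1" for y
  proof -
    have "((\<lambda>x. if y < 0 then 0 else 1) has_derivative (\<lambda>h. 0)) (at y)" by simp
    then have "(s has_derivative (\<lambda>h. 0)) (at y)"
      by (rule has_derivative_transform_within_open[of _ _ _ _ "if y < 0 then {..<0} else {1<..}"])
         (use that in \<open>auto simp: s_def smooth_step_eq_0 smooth_step_eq_1\<close>)
    then show ?thesis by (rule dir_deriv_eq)
  qed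
  have d\<eta>: "dir_deriv b (\<eta> n) x = complex_of_real (real (Suc n) * (b \<bullet> axis k 1)) * dir_deriv 1 s (real (Suc n) * x $ k - 1)"
    if "b \<in> Basis" for b n x
  proof -
    have "linear (\<lambda>x. real (Suc n) * (x \<bullet> axis k 1))" by (auto intro!: linearI simp: algebra_simps)
    from dir_deriv_compose(1)[OF this, of b "real (Suc n) * (b \<bullet> axis k 1)" 1 s x "-1"]
    show ?thesis using Cs[of "Suc 0"] by (simp add: \<eta>_def[abs_def] inner)
  qed
  have diff: "\<eta> n differentiable at x" for n x using C\<eta>[of "Suc 0" n] by simp
  have D: "dir_deriv b (\<zeta> n) = (\<lambda>x. \<eta> n x * dir_deriv b \<psi> x + dir_deriv b (\<eta> n) x * \<psi> x)" for b n
    unfolding \<zeta>_def by (rule ext) (intro dir_deriv_mult diff test_functions_differentiable[OF \<psi>])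
  have main: "(\<lambda>n. to_l2 (dir_deriv b (\<zeta> n))) \<longlonglongrightarrow> cutoff \<Omega> (to_l2 (dir_deriv b \<psi>))"
    if b: "b \<in> Basis" "b \<noteq> axis k 1 \<or> (\<forall>x. x $ k = 0 \<longrightarrow> \<psi> x = 0)" for b
  proof (cases "b = axis k 1")
    case False
    then have "dir_deriv b (\<zeta> n) = (\<lambda>x. \<eta> n x * dir_deriv b \<psi> x)" for n
      unfolding D using b(1) by (simp add: d\<eta> inner_axis_Basis)
    then show ?thesis using lim[OF dir_deriv_test[OF \<psi> b(1)]] by simp
  next
    case True
    then have \<psi>0: "x $ k = 0 \<Longrightarrow> \<psi> x = 0" for x using b by blast
    define t where "t n x = dir_deriv b (\<eta> n) x * \<psi> x" for n x
    have t_eq: "t n x = complex_of_real (real (Suc n)) * dir_deriv 1 s (real (Suc n) * x $ k - 1) * \<psi> x" for n x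
      using b(1) True by (simp add: t_def d\<eta> inner_axis_Basis)
    obtain C where C: "C \<ge> 0" "\<And>x t. cmod (\<psi> (x + t *\<^sub>R b) - \<psi> x) \<le> C * \<bar>t\<bar>"
      using test_functions_lipschitz[OF \<psi> b(1)] by blast
    \<comment> \<open>Moving from x along the normal to its foot point on the hyperplane, where
      \<psi> vanishes, costs at most C times the distance.\<close>
    have \<psi>b: "cmod (\<psi> x) \<le> C * \<bar>x $ k\<bar>" for x
    proof -
      have "\<psi> (x + (- x $ k) *\<^sub>R b) = 0" by (rule \<psi>0) (simp add: True axis_def)
      then show ?thesis using C(2)[of x "- x $ k"] by simp
    qed
    \<comment> \<open>In the transition layer \<open>real (Suc n) * x $ k\<close> is at most 2, so
      the factor n + 1 from differentiating the cutoff is absorbed by the linear bound on \<psi>.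
      This gives the constant 2 B C, uniform in n.\<close>
    have tb: "cmod (t n x) \<le> 2 * B * C" for n x
    proof (cases "0 \<le> real (Suc n) * x $ k - 1 \<and> real (Suc n) * x $ k - 1 \<le> 1")
      case True
      have pos: "x $ k \<ge> 0"
      proof -
        have "0 \<le> real (Suc n) * x $ k" using True by linarith
        then show ?thesis by (simp add: zero_le_mult_iff del: of_nat_Suc)
      qed
      have "cmod (t n x) = real (Suc n) * cmod (dir_deriv 1 s (real (Suc n) * x $ k - 1)) * cmod (\<psi> x)"
        by (simp add: t_eq norm_mult del: of_nat_Suc)
      also have "\<dots> \<le> real (Suc n) * B * (C * \<bar>x $ k\<bar>)"
        using True B C \<psi>b[of x] by (intro mult_mono) auto
      also have "\<dots> = B * C * (real (Suc n) * x $ k)" using pos by simp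
      also have "\<dots> \<le> B * C * 2" using True B C by (intro mult_left_mono) auto
      finally show ?thesis by simp
    next
      case False
      then have "t n x = 0" using s'0[of "real (Suc n) * x $ k - 1"] by (auto simp: t_eq not_le)
      then show ?thesis using B C by simp
    qed
    obtain a where a: "K \<subseteq> box (- a) a" using bounded_subset_box_symmetric[OF compact_imp_bounded[OF K(1)]] by blast
    have C\<eta>': "C_k j (dir_deriv b (\<eta> n))" for j n using C\<eta>[of "Suc j" n] b(1) by simp
    have [measurable]: "dir_deriv b (\<eta> n) \<in> borel_measurable lebesgue" for n
      using C\<eta>'[of 0 n] by (intro measurable_completion) (simp add: borel_measurable_continuous_onI)
    note [measurable] = test_functions_measurable[OF \<psi>]
    have tm: "t n \<in> borel_measurable lebesgue" for n unfolding t_def by measurable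
    \<comment> \<open>For fixed x with positive coordinate the layer eventually lies below x, and
      for the other x it is never met. The uniform bound on a box containing the support turns this
      into convergence in \<open>L\<^sup>2\<close>.\<close>
    have "(\<lambda>n. to_l2 (t n)) \<longlonglongrightarrow> to_l2 (\<lambda>x. 0)"
    proof (rule to_l2_dominated_convergence(3)[OF sq_integrable_indicator_subset[of "box (-a) a" "-a" a 1], where C = "2 * B * C"])
      show "AE x in lebesgue. cmod (t n x) \<le> 2 * B * C * cmod (1 * indicator (box (- a) a) x)" for n
      proof (intro AE_I2)
        fix x
        show "cmod (t n x) \<le> 2 * B * C * cmod (1 * indicator (box (- a) a) x)"
          using tb[of n x] K(3)[of x] a by (cases "x \<in> K") (auto simp: t_def)
      qed
      show "AE x in lebesgue. (\<lambda>n. t n x) \<longlonglongrightarrow> 0"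
      proof (intro AE_I2)
        fix x
        show "(\<lambda>n. t n x) \<longlonglongrightarrow> 0"
        proof (cases "x $ k > 0")
          case True
          have "eventually (\<lambda>n. t n x = 0) sequentially"
            using ev[OF True] by eventually_elim (use s'0 in \<open>auto simp: t_eq\<close>)
          then show ?thesis by (rule tendsto_eventually)
        next
          case False
          then have "real (Suc n) * x $ k \<le> 0" for n by (intro mult_nonneg_nonpos) auto
          then have "real (Suc n) * x $ k - 1 < 0" for n by (smt (verit))
          then have "t n x = 0" for n using s'0 unfolding t_eq by (simp del: of_nat_Suc)
          then show ?thesis by simp
        qed
      qed
    qed (auto intro: tm)
    moreover have "to_l2 (dir_deriv b (\<zeta> n)) = to_l2 (\<lambda>x. \<eta> n x * dir_deriv b \<psi> x) + to_l2 (t n)" for n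
      unfolding D t_def
      by (intro to_l2_add sq_integrable_test[where \<Omega> = \<Omega>'] test_functions_mult[where \<Omega> = \<Omega>'] dir_deriv_test \<psi> b C\<eta> C\<eta>')
    ultimately show ?thesis
      using tendsto_add[OF lim[OF dir_deriv_test[OF \<psi> b(1)]]] by fastforce
  qed
  show ?thesis
  proof (rule that[of \<zeta>])
    show "(\<lambda>n. to_l2 (\<zeta> n)) \<longlonglongrightarrow> cutoff \<Omega> (to_l2 \<psi>)" using lim[OF \<psi>] by (simp add: \<zeta>_def[abs_def])
  qed (use \<zeta> main in auto)
qed

end

section \<open>Extension and restriction on form domains\<close>

lemma H01_grad_mono: "H01_grad \<Omega> f G \<Longrightarrow> \<Omega> \<subseteq> \<Omega>' \<Longrightarrow> H01_grad \<Omega>' f G"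
  unfolding H01_grad_def by (meson test_functions_mono)

lemma H01_grad_add_scaleR:
  assumes "H01_grad \<Omega> f G" "H01_grad \<Omega> g H"
  shows "H01_grad \<Omega> (f + c *\<^sub>R g) (\<lambda>b. G b + c *\<^sub>R H b)"
proof -
  obtain \<phi> where \<phi>: "\<And>n. \<phi> n \<in> test_functions \<Omega>" "(\<lambda>n. to_l2 (\<phi> n)) \<longlonglongrightarrow> f"
      "\<And>b. b \<in> Basis \<Longrightarrow> (\<lambda>n. to_l2 (dir_deriv b (\<phi> n))) \<longlonglongrightarrow> G b"
    using H01_grad_sequence[OF assms(1)] by blast
  obtain \<psi> where \<psi>: "\<And>n. \<psi> n \<in> test_functions \<Omega>" "(\<lambda>n. to_l2 (\<psi> n)) \<longlonglongrightarrow> g"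
      "\<And>b. b \<in> Basis \<Longrightarrow> (\<lambda>n. to_l2 (dir_deriv b (\<psi> n))) \<longlonglongrightarrow> H b"
    using H01_grad_sequence[OF assms(2)] by blast
  define \<zeta> where "\<zeta> n x = \<phi> n x + complex_of_real c * \<psi> n x" for n x
  have to: "to_l2 (\<lambda>x. u x + complex_of_real c * v x) = to_l2 u + c *\<^sub>R to_l2 v"
    if "u \<in> test_functions \<Omega>" "v \<in> test_functions \<Omega>" for u v
    using that by (intro to_l2_add_of_real_mult sq_integrable_test)
  have D: "dir_deriv b (\<zeta> n) = (\<lambda>x. dir_deriv b (\<phi> n) x + complex_of_real c * dir_deriv b (\<psi> n) x)" for b n
    unfolding \<zeta>_def
    by (rule ext) (simp add: dir_deriv_add dir_deriv_cmult test_functions_differentiable[OF \<phi>(1)]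
        test_functions_differentiable[OF \<psi>(1)] test_functions_differentiable[OF test_functions_cmult[OF \<psi>(1)]])
  show ?thesis
  proof (rule H01_gradI_sequence[of \<zeta>])
    show "\<zeta> n \<in> test_functions \<Omega>" for n
      unfolding \<zeta>_def by (intro test_functions_add test_functions_cmult \<phi> \<psi>)
    show "(\<lambda>n. to_l2 (\<zeta> n)) \<longlonglongrightarrow> f + c *\<^sub>R g"
      unfolding \<zeta>_def using \<phi>(2) \<psi>(2) by (simp add: to \<phi>(1) \<psi>(1) tendsto_intros)
    show "(\<lambda>n. to_l2 (dir_deriv b (\<zeta> n))) \<longlonglongrightarrow> G b + c *\<^sub>R H b" if "b \<in> Basis" for b
      unfolding D using \<phi>(3)[OF that] \<psi>(3)[OF that]
      by (simp add: to dir_deriv_test that \<phi>(1) \<psi>(1) tendsto_intros)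
  qed
qed

fun bc_sign :: "boundary_condition \<Rightarrow> real" where
  "bc_sign Dirichlet = -1"
| "bc_sign Neumann = 1"

lemma bc_sign_square [simp]: "bc_sign bc * bc_sign bc = 1"
  by (cases bc) auto

context mirror_domain
begin

abbreviation \<sigma> :: "real ^ 'n \<Rightarrow> real" where "\<sigma> \<equiv> mirror_sign k"

lemma mirror_in_L2_on: "f \<in> L2_on \<Omega>' \<Longrightarrow> l2_mirror k f \<in> L2_on \<Omega>'"
  using l2_mirror_cutoff[OF sets(2), of k f] by (simp add: L2_on_iff_cutoff mirror_domain)

lemma test_functions_mirror':
  assumes "\<phi> \<in> test_functions \<Omega>'"
  shows "(\<lambda>x. \<phi> (mirror k x)) \<in> test_functions \<Omega>'"
    and "to_l2 (\<lambda>x. \<phi> (mirror k x)) = l2_mirror k (to_l2 \<phi>)"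
    and "b \<in> Basis \<Longrightarrow> to_l2 (dir_deriv b (\<lambda>x. \<phi> (mirror k x))) = \<sigma> b *\<^sub>R l2_mirror k (to_l2 (dir_deriv b \<phi>))"
proof -
  show "(\<lambda>x. \<phi> (mirror k x)) \<in> test_functions \<Omega>'"
    using test_functions_mirror[OF assms, of k] by (simp add: mirror_domain)
  show "to_l2 (\<lambda>x. \<phi> (mirror k x)) = l2_mirror k (to_l2 \<phi>)"
    using assms by (simp add: l2_mirror_to_l2 sq_integrable_test)
  assume b: "b \<in> Basis"
  have "dir_deriv b (\<lambda>x. \<phi> (mirror k x)) = (\<lambda>x. \<sigma> b *\<^sub>R dir_deriv b \<phi> (mirror k x))"
    using b assms by (auto simp: dir_deriv_mirror test_functions_differentiable scaleR_conv_of_real)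
  then show "to_l2 (dir_deriv b (\<lambda>x. \<phi> (mirror k x))) = \<sigma> b *\<^sub>R l2_mirror k (to_l2 (dir_deriv b \<phi>))"
    using l2_mirror_to_l2[OF sq_integrable_test[OF dir_deriv_test[OF assms b]], of k]
      to_l2_scaleR[OF sq_integrable_mirror[OF sq_integrable_test[OF dir_deriv_test[OF assms b]], of k], of "\<sigma> b"]
    by simp
qed

text \<open>Reflection flips the sign of the normal derivative only, so differentiating changes the
  sign c into \<open>c * \<sigma> b\<close>. All later signs of derivatives stem from this
  rule.\<close>

lemma test_functions_ext:
  assumes "\<phi> \<in> test_functions \<Omega>'"
  shows "(\<lambda>x. \<phi> x + complex_of_real c * \<phi> (mirror k x)) \<in> test_functions \<Omega>'"
    and "to_l2 (\<lambda>x. \<phi> x + complex_of_real c * \<phi> (mirror k x)) = ext c (to_l2 \<phi>)"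
    and "b \<in> Basis \<Longrightarrow> to_l2 (dir_deriv b (\<lambda>x. \<phi> x + complex_of_real c * \<phi> (mirror k x))) = ext (c * \<sigma> b) (to_l2 (dir_deriv b \<phi>))"
proof -
  note m = test_functions_mirror'[OF assms]
  show 1: "(\<lambda>x. \<phi> x + complex_of_real c * \<phi> (mirror k x)) \<in> test_functions \<Omega>'"
    by (intro test_functions_add test_functions_cmult assms m)
  have to: "to_l2 (\<lambda>x. u x + complex_of_real c * v x) = to_l2 u + c *\<^sub>R to_l2 v"
    if "u \<in> test_functions \<Omega>'" "v \<in> test_functions \<Omega>'" for u v
    using that by (intro to_l2_add_of_real_mult sq_integrable_test)
  show "to_l2 (\<lambda>x. \<phi> x + complex_of_real c * \<phi> (mirror k x)) = ext c (to_l2 \<phi>)"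
    using to[OF assms m(1)] by (simp add: m(2) ext_def)
  assume b: "b \<in> Basis"
  have "dir_deriv b (\<lambda>x. \<phi> x + complex_of_real c * \<phi> (mirror k x)) =
      (\<lambda>x. dir_deriv b \<phi> x + complex_of_real c * dir_deriv b (\<lambda>x. \<phi> (mirror k x)) x)"
    by (rule HOL.ext) (simp add: dir_deriv_add dir_deriv_cmult test_functions_differentiable[OF assms]
        test_functions_differentiable[OF m(1)] test_functions_differentiable[OF test_functions_cmult[OF m(1)]])
  then show "to_l2 (dir_deriv b (\<lambda>x. \<phi> x + complex_of_real c * \<phi> (mirror k x))) = ext (c * \<sigma> b) (to_l2 (dir_deriv b \<phi>))"
    using to[OF dir_deriv_test[OF assms b] dir_deriv_test[OF m(1) b]] by (simp add: m(3)[OF b] ext_def)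
qed

section \<open>Weak derivatives under restriction, reflection and extension\<close>

lemma is_weak_deriv_restrict:
  assumes "is_weak_deriv \<Omega>' b f g" "b \<in> Basis"
  shows "is_weak_deriv \<Omega> b (cutoff \<Omega> f) (cutoff \<Omega> g)"
proof -
  have c: "cutoff \<Omega> (to_l2 \<phi>) = to_l2 \<phi>" if "\<phi> \<in> test_functions \<Omega>" for \<phi>
    using test_functions_in_L2_on[OF that] by (simp add: L2_on_iff_cutoff)
  have "\<phi> \<in> test_functions \<Omega> \<Longrightarrow> \<phi> \<in> test_functions \<Omega>'" for \<phi>
    by (erule test_functions_mono) (auto simp: half)
  then show ?thesis
    using assms by (simp add: is_weak_deriv_iff open_half open' cutoff_in_L2_on l2_bil_cutoff c dir_deriv_test)
qed

text \<open>The reflection is moved to the test function, whose derivative contributes the sign;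
  multiplying by that sign once more cancels it.\<close>

lemma is_weak_deriv_mirror:
  assumes "is_weak_deriv \<Omega>' b f g" "b \<in> Basis"
  shows "is_weak_deriv \<Omega>' b (l2_mirror k f) (\<sigma> b *\<^sub>R l2_mirror k g)"
proof -
  interpret bounded_bilinear l2_bil by (rule bounded_bilinear_l2_bil)
  have *: "f \<in> L2_on \<Omega>'" "g \<in> L2_on \<Omega>'" and eq: "\<phi> \<in> test_functions \<Omega>' \<Longrightarrow> l2_bil f (to_l2 (dir_deriv b \<phi>)) = - l2_bil g (to_l2 \<phi>)" for \<phi>
    using assms by (auto simp: is_weak_deriv_iff open')
  have "l2_bil (l2_mirror k f) (to_l2 (dir_deriv b \<phi>)) = - l2_bil (\<sigma> b *\<^sub>R l2_mirror k g) (to_l2 \<phi>)"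
    if \<phi>: "\<phi> \<in> test_functions \<Omega>'" for \<phi>
  proof -
    have "\<sigma> b *\<^sub>R l2_bil f (l2_mirror k (to_l2 (dir_deriv b \<phi>))) = - l2_bil g (l2_mirror k (to_l2 \<phi>))"
      using eq[OF test_functions_mirror'(1)[OF \<phi>]] test_functions_mirror'(2)[OF \<phi>] test_functions_mirror'(3)[OF \<phi> assms(2)]
      by (simp add: scaleR_right)
    then have "\<sigma> b *\<^sub>R \<sigma> b *\<^sub>R l2_bil f (l2_mirror k (to_l2 (dir_deriv b \<phi>))) = - (\<sigma> b *\<^sub>R l2_bil g (l2_mirror k (to_l2 \<phi>)))"
      by simp
    then show ?thesis by (simp add: l2_bil_mirror scaleR_left)
  qed
  then show ?thesis
    using assms * by (simp add: is_weak_deriv_iff open' mirror_in_L2_on subspace_scale closed_subspace_L2_on)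
qed

lemma is_weak_deriv_rst:
  assumes "is_weak_deriv \<Omega>' b f g" "b \<in> Basis"
  shows "is_weak_deriv \<Omega> b (rst \<epsilon> f) (rst (\<epsilon> * \<sigma> b) g)"
  using is_weak_deriv_restrict[OF is_weak_deriv_add[OF open' assms(2,1)
      is_weak_deriv_scaleR[OF open' assms(2) is_weak_deriv_mirror[OF assms], of \<epsilon>]] assms(2)]
  by (simp add: rst_def ext_def)

text \<open>Moving the extension to the other side of the pairing leaves f paired with the
  restriction of the derivative of
  \<open>\<psi> = \<phi> + \<sigma> b * (\<phi> \<circ> mirror k)\<close>. In the normal direction
  \<psi> is odd and vanishes on the hyperplane; in the others \<open>half_approx\<close> asks for no
  such condition. So \<psi> can be replaced by test functions of \<Omega>.\<close>

lemma is_weak_deriv_even_ext: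
  assumes "is_weak_deriv \<Omega> b f g" "b \<in> Basis"
  shows "is_weak_deriv \<Omega>' b (ext 1 f) (ext (\<sigma> b) g)"
proof -
  interpret bounded_bilinear l2_bil by (rule bounded_bilinear_l2_bil)
  have *: "f \<in> L2_on \<Omega>" "g \<in> L2_on \<Omega>" and eq: "\<phi> \<in> test_functions \<Omega> \<Longrightarrow> l2_bil f (to_l2 (dir_deriv b \<phi>)) = - l2_bil g (to_l2 \<phi>)" for \<phi>
    using assms by (auto simp: is_weak_deriv_iff open_half)
  have "l2_bil (ext 1 f) (to_l2 (dir_deriv b \<phi>)) = - l2_bil (ext (\<sigma> b) g) (to_l2 \<phi>)"
    if \<phi>: "\<phi> \<in> test_functions \<Omega>'" for \<phi>
  proof -
    define \<psi> where "\<psi> = (\<lambda>x. \<phi> x + complex_of_real (\<sigma> b) * \<phi> (mirror k x))"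
    have \<psi>: "\<psi> \<in> test_functions \<Omega>'" "to_l2 \<psi> = ext (\<sigma> b) (to_l2 \<phi>)" "to_l2 (dir_deriv b \<psi>) = ext 1 (to_l2 (dir_deriv b \<phi>))"
      unfolding \<psi>_def using test_functions_ext[OF \<phi>, where c = "\<sigma> b"] assms(2) by simp_all
    have "mirror k x = x" if "x $ k = 0" for x using that by (simp add: vec_eq_iff mirror_nth)
    then have "b \<noteq> axis k 1 \<or> (\<forall>x. x $ k = 0 \<longrightarrow> \<psi> x = 0)" by (auto simp: \<psi>_def mirror_sign_def)
    then obtain \<zeta> where \<zeta>: "\<And>n. \<zeta> n \<in> test_functions \<Omega>" "(\<lambda>n. to_l2 (\<zeta> n)) \<longlonglongrightarrow> cutoff \<Omega> (to_l2 \<psi>)"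
      "(\<lambda>n. to_l2 (dir_deriv b (\<zeta> n))) \<longlonglongrightarrow> cutoff \<Omega> (to_l2 (dir_deriv b \<psi>))"
      using half_approx[OF \<psi>(1)] assms(2) by metis
    have "l2_bil f (cutoff \<Omega> (to_l2 (dir_deriv b \<psi>))) = - l2_bil g (cutoff \<Omega> (to_l2 \<psi>))"
    proof (rule LIMSEQ_unique)
      show "(\<lambda>n. l2_bil f (to_l2 (dir_deriv b (\<zeta> n)))) \<longlonglongrightarrow> l2_bil f (cutoff \<Omega> (to_l2 (dir_deriv b \<psi>)))"
        by (intro tendsto \<zeta> tendsto_const)
      have "(\<lambda>n. - l2_bil g (to_l2 (\<zeta> n))) \<longlonglongrightarrow> - l2_bil g (cutoff \<Omega> (to_l2 \<psi>))"
        by (intro tendsto_minus tendsto \<zeta> tendsto_const)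
      then show "(\<lambda>n. l2_bil f (to_l2 (dir_deriv b (\<zeta> n)))) \<longlonglongrightarrow> - l2_bil g (cutoff \<Omega> (to_l2 \<psi>))"
        using eq \<zeta>(1) by simp
    qed
    then show ?thesis by (simp add: l2_bil_ext * rst_def \<psi>)
  qed
  then show ?thesis
    using assms * by (simp add: is_weak_deriv_iff open' ext_in_L2_on half_in_L2_on)
qed

lemma H01_grad_ext:
  assumes "H01_grad \<Omega>' f G"
  shows "H01_grad \<Omega>' (ext \<epsilon> f) (\<lambda>b. ext (\<epsilon> * \<sigma> b) (G b))"
proof -
  interpret R: bounded_linear "l2_mirror k" by (rule bounded_linear_l2_mirror)
  obtain \<phi> where \<phi>: "\<And>n. \<phi> n \<in> test_functions \<Omega>'" "(\<lambda>n. to_l2 (\<phi> n)) \<longlonglongrightarrow> f"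
      "\<And>b. b \<in> Basis \<Longrightarrow> (\<lambda>n. to_l2 (dir_deriv b (\<phi> n))) \<longlonglongrightarrow> G b"
    using H01_grad_sequence[OF assms(1)] by blast
  show ?thesis
    by (rule H01_gradI_sequence[of "\<lambda>n x. \<phi> n x + complex_of_real \<epsilon> * \<phi> n (mirror k x)"])
       (simp_all add: test_functions_ext[OF \<phi>(1)] bounded_linear.tendsto[OF bounded_linear_ext] \<phi>)
qed

text \<open>The reflection is the extension with sign 1 minus f, so no separate approximation is
  required.\<close>

lemma H01_grad_mirror:
  assumes "H01_grad \<Omega>' f G"
  shows "H01_grad \<Omega>' (l2_mirror k f) (\<lambda>b. \<sigma> b *\<^sub>R l2_mirror k (G b))"
  using H01_grad_add_scaleR[OF H01_grad_ext[OF assms, of 1] assms, of "-1"] by (simp add: ext_def)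

text \<open>Antisymmetrised test functions vanish on the hyperplane, hence their restrictions, with
  all derivatives, are limits of test functions of \<Omega>. A second limit passes from test
  functions to f.\<close>

lemma H01_grad_rst:
  assumes "H01_grad \<Omega>' f G"
  shows "H01_grad \<Omega> (rst (-1) f) (\<lambda>b. rst (- \<sigma> b) (G b))"
proof -
  obtain \<phi> where \<phi>: "\<And>n. \<phi> n \<in> test_functions \<Omega>'" "(\<lambda>n. to_l2 (\<phi> n)) \<longlonglongrightarrow> f"
      "\<And>b. b \<in> Basis \<Longrightarrow> (\<lambda>n. to_l2 (dir_deriv b (\<phi> n))) \<longlonglongrightarrow> G b"
    using H01_grad_sequence[OF assms(1)] by blast
  have "H01_grad \<Omega> (rst (-1) (to_l2 (\<phi> n))) (\<lambda>b. rst (- \<sigma> b) (to_l2 (dir_deriv b (\<phi> n))))" for n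
  proof -
    define \<psi> where "\<psi> = (\<lambda>x. \<phi> n x + complex_of_real (-1) * \<phi> n (mirror k x))"
    have \<psi>: "\<psi> \<in> test_functions \<Omega>'" "to_l2 \<psi> = ext (-1) (to_l2 (\<phi> n))"
      "b \<in> Basis \<Longrightarrow> to_l2 (dir_deriv b \<psi>) = ext (- \<sigma> b) (to_l2 (dir_deriv b (\<phi> n)))" for b
      unfolding \<psi>_def using test_functions_ext[OF \<phi>(1), where c = "-1"] by simp_all
    have "mirror k x = x" if "x $ k = 0" for x using that by (simp add: vec_eq_iff mirror_nth)
    then have 0: "\<forall>x. x $ k = 0 \<longrightarrow> \<psi> x = 0" by (auto simp: \<psi>_def)
    obtain \<zeta> where \<zeta>: "\<And>n. \<zeta> n \<in> test_functions \<Omega>" "(\<lambda>n. to_l2 (\<zeta> n)) \<longlonglongrightarrow> cutoff \<Omega> (to_l2 \<psi>)"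
      "\<And>b. b \<in> Basis \<Longrightarrow> (\<lambda>n. to_l2 (dir_deriv b (\<zeta> n))) \<longlonglongrightarrow> cutoff \<Omega> (to_l2 (dir_deriv b \<psi>))"
      using half_approx[OF \<psi>(1)] 0 by metis
    show ?thesis
      by (rule H01_gradI_sequence[of \<zeta>]) (use \<zeta> \<psi> in \<open>simp_all add: rst_def\<close>)
  qed
  then show ?thesis
    by (rule H01_grad_LIMSEQ[where f = "\<lambda>n. rst (-1) (to_l2 (\<phi> n))" and
          G = "\<lambda>n b. rst (- \<sigma> b) (to_l2 (dir_deriv b (\<phi> n)))"])
       (intro bounded_linear.tendsto[OF bounded_linear_rst] \<phi>, assumption?)+
qed

section \<open>Form domains, both boundary conditions at once\<close>

lemma form_domain_Dirichlet_iff: "open W \<Longrightarrow> f \<in> form_domain Dirichlet W \<longleftrightarrow> H01_grad W f (\<lambda>b. weak_deriv W b f)"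
proof -
  assume W: "open W"
  have "H01_grad W f (\<lambda>b. weak_deriv W b f)" if "H01_grad W f G" for G
  proof -
    have "\<forall>b\<in>Basis. weak_deriv W b f = G b" using weak_deriv_eq[OF W _ H01_grad_is_weak_deriv[OF W that]] by blast
    then show ?thesis using that by (simp add: H01_grad_def)
  qed
  then show ?thesis using H01_iff[OF W, of f] by auto
qed

lemma form_domain_weak_deriv:
  assumes "open W" "f \<in> form_domain bc W" "b \<in> Basis"
  shows "is_weak_deriv W b f (weak_deriv W b f)"
  using assms H1_weak_deriv by (cases bc) (auto simp: H01_def)

text \<open>Separates what both boundary conditions share, the weak derivatives, from the
  approximation demanded by the Dirichlet condition alone.\<close>

lemma form_domain_intro:
  assumes W: "open W" and f: "\<And>b. b \<in> Basis \<Longrightarrow> is_weak_deriv W b f (G b)" and D: "bc = Dirichlet \<Longrightarrow> H01_grad W f G"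
  shows "f \<in> form_domain bc W" "b \<in> Basis \<Longrightarrow> weak_deriv W b f = G b"
proof -
  show "b \<in> Basis \<Longrightarrow> weak_deriv W b f = G b" using weak_deriv_eq[OF W _ f] .
  have "f \<in> L2_on W" using f[OF SOME_Basis] by (simp add: is_weak_deriv_def)
  then show "f \<in> form_domain bc W"
    using f D H01_iff[OF W, of f] by (cases bc) (auto simp: H1_def)
qed

lemma form_domain_subset: "open W \<Longrightarrow> f \<in> form_domain bc W \<Longrightarrow> f \<in> L2_on W"
  using form_domain_weak_deriv[OF _ _ SOME_Basis] by (auto simp: is_weak_deriv_def)

lemma form_domain_scaleR: 
  assumes "open W" "f \<in> form_domain bc W"
  shows "c *\<^sub>R f \<in> form_domain bc W"
proof (rule form_domain_intro(1)[OF assms(1), where G = "\<lambda>b. c *\<^sub>R weak_deriv W b f"])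
  show "b \<in> Basis \<Longrightarrow> is_weak_deriv W b (c *\<^sub>R f) (c *\<^sub>R weak_deriv W b f)" for b
    using assms by (intro is_weak_deriv_scaleR form_domain_weak_deriv)
  assume "bc = Dirichlet"
  then have "H01_grad W f (\<lambda>b. weak_deriv W b f)" using assms(2) form_domain_Dirichlet_iff[OF assms(1)] by blast
  from H01_grad_add_scaleR[OF this this, of "c - 1"] show "H01_grad W (c *\<^sub>R f) (\<lambda>b. c *\<^sub>R weak_deriv W b f)"
    by (simp add: scaleR_diff_left)
qed

lemma
  assumes "f \<in> form_domain bc \<Omega>"
  shows form_domain_ext: "ext (bc_sign bc) f \<in> form_domain bc \<Omega>'"
    and weak_deriv_ext: "b \<in> Basis \<Longrightarrow> weak_deriv \<Omega>' b (ext (bc_sign bc) f) = ext (bc_sign bc * \<sigma> b) (weak_deriv \<Omega> b f)"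
proof -
  have D: "H01_grad \<Omega>' (ext (bc_sign bc) f) (\<lambda>b. ext (bc_sign bc * \<sigma> b) (weak_deriv \<Omega> b f))" if "bc = Dirichlet"
  proof -
    have "H01_grad \<Omega> f (\<lambda>b. weak_deriv \<Omega> b f)"
      using assms that form_domain_Dirichlet_iff[OF open_half, of f] by blast
    then have "H01_grad \<Omega>' f (\<lambda>b. weak_deriv \<Omega> b f)" by (rule H01_grad_mono) (auto simp: half)
    then show ?thesis by (rule H01_grad_ext)
  qed
  have "is_weak_deriv \<Omega>' b (ext (bc_sign bc) f) (ext (bc_sign bc * \<sigma> b) (weak_deriv \<Omega> b f))" if "b \<in> Basis" for b
  \<comment> \<open>The odd extension gets its derivatives from the approximating test functions,
    whose extensions by zero are smooth. The even extension of a general element of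
    \<open>H1 \<Omega>\<close> needs the argument with the cutoff.\<close>
  proof (cases bc)
    case Dirichlet
    then show ?thesis using H01_grad_is_weak_deriv[OF open' D that] by simp
  next
    case Neumann
    then show ?thesis using is_weak_deriv_even_ext[OF form_domain_weak_deriv[OF open_half assms that] that] by simp
  qed
  from form_domain_intro[OF open' this D]
  show "ext (bc_sign bc) f \<in> form_domain bc \<Omega>'"
    "b \<in> Basis \<Longrightarrow> weak_deriv \<Omega>' b (ext (bc_sign bc) f) = ext (bc_sign bc * \<sigma> b) (weak_deriv \<Omega> b f)" by auto
qed

lemma
  assumes "f \<in> form_domain bc \<Omega>'"
  shows form_domain_rst: "rst (bc_sign bc) f \<in> form_domain bc \<Omega>"
    and weak_deriv_rst: "b \<in> Basis \<Longrightarrow> weak_deriv \<Omega> b (rst (bc_sign bc) f) = rst (bc_sign bc * \<sigma> b) (weak_deriv \<Omega>' b f)"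
proof -
  have D: "H01_grad \<Omega> (rst (bc_sign bc) f) (\<lambda>b. rst (bc_sign bc * \<sigma> b) (weak_deriv \<Omega>' b f))" if "bc = Dirichlet"
    using assms that form_domain_Dirichlet_iff[OF open', of f] H01_grad_rst[of f] by simp
  have "is_weak_deriv \<Omega> b (rst (bc_sign bc) f) (rst (bc_sign bc * \<sigma> b) (weak_deriv \<Omega>' b f))" if "b \<in> Basis" for b
    by (rule is_weak_deriv_rst[OF form_domain_weak_deriv[OF open' assms that] that])
  from form_domain_intro[OF open_half this D]
  show "rst (bc_sign bc) f \<in> form_domain bc \<Omega>"
    "b \<in> Basis \<Longrightarrow> weak_deriv \<Omega> b (rst (bc_sign bc) f) = rst (bc_sign bc * \<sigma> b) (weak_deriv \<Omega>' b f)" by auto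
qed

lemma
  assumes "f \<in> form_domain bc \<Omega>'"
  shows form_domain_mirror: "l2_mirror k f \<in> form_domain bc \<Omega>'"
    and weak_deriv_mirror: "b \<in> Basis \<Longrightarrow> weak_deriv \<Omega>' b (l2_mirror k f) = \<sigma> b *\<^sub>R l2_mirror k (weak_deriv \<Omega>' b f)"
proof -
  have D: "H01_grad \<Omega>' (l2_mirror k f) (\<lambda>b. \<sigma> b *\<^sub>R l2_mirror k (weak_deriv \<Omega>' b f))" if "bc = Dirichlet"
    using assms that form_domain_Dirichlet_iff[OF open', of f] H01_grad_mirror[of f] by simp
  have "is_weak_deriv \<Omega>' b (l2_mirror k f) (\<sigma> b *\<^sub>R l2_mirror k (weak_deriv \<Omega>' b f))" if "b \<in> Basis" for b
    by (rule is_weak_deriv_mirror[OF form_domain_weak_deriv[OF open' assms that] that])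
  from form_domain_intro[OF open' this D]
  show "l2_mirror k f \<in> form_domain bc \<Omega>'"
    "b \<in> Basis \<Longrightarrow> weak_deriv \<Omega>' b (l2_mirror k f) = \<sigma> b *\<^sub>R l2_mirror k (weak_deriv \<Omega>' b f)" by auto
qed

end

section \<open>The forms\<close>

definition bounded_coeff :: "'a::euclidean_space set \<Rightarrow> ('a \<Rightarrow> real) \<Rightarrow> bool" where
  "bounded_coeff W m \<longleftrightarrow> m \<in> borel_measurable (lebesgue_on W) \<and> (\<exists>C. AE x in lebesgue_on W. \<bar>m x\<bar> \<le> C)"

definition weighted_inner :: "'a::euclidean_space set \<Rightarrow> ('a \<Rightarrow> real) \<Rightarrow> 'a l2 \<Rightarrow> 'a l2 \<Rightarrow> complex" where
  "weighted_inner W m u v = (LINT x|lebesgue_on W. complex_of_real (m x) * l2_fun u x * cnj (l2_fun v x))"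

text \<open>A weighted integral is the inner product after a bounded multiplication operator
  supported in W. Linearity, integrability and compatibility with the cutoff are then inherited from
  \<open>l2_inner\<close>.\<close>

lemma weighted_inner_multiplier:
  assumes W: "W \<in> sets lebesgue" and m: "bounded_coeff W m"
  obtains L :: "'a::euclidean_space l2 \<Rightarrow> 'a l2" where "bounded_linear L" "\<And>u. cutoff W (L u) = L u" "\<And>u. L (cutoff W u) = L u"
    "\<And>u v. weighted_inner W m u v = l2_inner (L u) v"
    "\<And>u v. integrable (lebesgue_on W) (\<lambda>x. complex_of_real (m x) * l2_fun u x * cnj (l2_fun v x))"
proof -
  obtain C where C: "AE x in lebesgue_on W. \<bar>m x\<bar> \<le> C" and mm: "m \<in> borel_measurable (lebesgue_on W)"
    using m by (auto simp: bounded_coeff_def)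
  \<comment> \<open>The weight is measurable on W only and bounded only almost everywhere.
    Truncation at C and extension by 0 make it bounded and measurable everywhere and change it on W
    at most on a null set.\<close>
  define M where "M x = complex_of_real (if x \<in> W \<and> \<bar>m x\<bar> \<le> C then m x else 0)" for x
  have Mm: "M \<in> borel_measurable lebesgue"
  proof -
    have "(\<lambda>x. if \<bar>m x\<bar> \<le> C then m x else 0) \<in> borel_measurable (lebesgue_on W)"
      using mm by measurable
    then have "(\<lambda>x. if x \<in> W then (if \<bar>m x\<bar> \<le> C then m x else 0) else 0) \<in> borel_measurable lebesgue"
      using W by (subst borel_measurable_if) auto
    moreover have "(\<lambda>x. if x \<in> W then (if \<bar>m x\<bar> \<le> C then m x else 0) else 0) =
        (\<lambda>x. if x \<in> W \<and> \<bar>m x\<bar> \<le> C then m x else 0)" by auto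
    ultimately show ?thesis unfolding M_def by simp
  qed
  have Mb: "cmod (M x) \<le> max C 0" for x by (auto simp: M_def)
  have C': "AE x in lebesgue. x \<in> W \<longrightarrow> \<bar>m x\<bar> \<le> C"
    using C W by (simp add: AE_restrict_space_iff)
  define L where "L = l2_mult M"
  note L = l2_fun_mult[OF Mm Mb, folded L_def]
  have lin: "bounded_linear L" unfolding L_def by (rule bounded_linear_l2_mult[OF Mm Mb])
  have cL: "cutoff W (L u) = L u" for u
    by (rule l2_eqI) (use l2_fun_cutoff[OF W, of "L u"] L[of u] in \<open>eventually_elim, simp add: M_def\<close>)
  have Lc: "L (cutoff W u) = L u" for u
    by (rule l2_eqI) (use l2_fun_cutoff[OF W, of u] L[of u] L[of "cutoff W u"] in \<open>eventually_elim, simp add: M_def\<close>)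
  have ae: "AE x in lebesgue. l2_fun (L u) x * cnj (l2_fun v x) =
      indicator W x *\<^sub>R (complex_of_real (m x) * l2_fun u x * cnj (l2_fun v x))" for u v
    using L[of u] C' by eventually_elim (auto simp: M_def indicator_def)
  have meas: "(\<lambda>x. indicator W x *\<^sub>R (complex_of_real (m x) * l2_fun u x * cnj (l2_fun v x))) \<in> borel_measurable lebesgue" for u v
  proof -
    have "l2_fun u \<in> borel_measurable (lebesgue_on W)" "l2_fun v \<in> borel_measurable (lebesgue_on W)"
      by (auto intro: measurable_restrict_space1)
    then have "(\<lambda>x. complex_of_real (m x) * l2_fun u x * cnj (l2_fun v x)) \<in> borel_measurable (lebesgue_on W)"
      using mm by measurable
    then show ?thesis using W by (subst (asm) borel_measurable_restrict_space_iff) auto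
  qed
  have sv: "sq_integrable (\<lambda>x. cnj (l2_fun v x))" for v :: "'a l2"
    by (rule sq_integrable_dominated[OF sq_integrable_l2_fun[of v], where C = 1]) auto
  have int: "integrable (lebesgue_on W) (\<lambda>x. complex_of_real (m x) * l2_fun u x * cnj (l2_fun v x))" for u v
  proof -
    have "integrable lebesgue (\<lambda>x. l2_fun (L u) x * cnj (l2_fun v x))"
      by (rule l2_Cauchy_Schwarz(1)[OF sq_integrable_l2_fun sv])
    then have "integrable lebesgue (\<lambda>x. indicator W x *\<^sub>R (complex_of_real (m x) * l2_fun u x * cnj (l2_fun v x)))"
      by (rule integrable_cong_AE_imp[OF _ meas]) (use ae[of u v] in \<open>auto elim: eventually_mono\<close>)
    then show ?thesis using W by (simp add: integrable_restrict_space)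
  qed
  have "weighted_inner W m u v = l2_inner (L u) v" for u v
  proof -
    have "weighted_inner W m u v = (LINT x|lebesgue. indicator W x *\<^sub>R (complex_of_real (m x) * l2_fun u x * cnj (l2_fun v x)))"
      unfolding weighted_inner_def using W by (subst integral_restrict_space) auto
    also have "\<dots> = l2_inner (L u) v"
      unfolding l2_inner_def using ae[of u v] meas by (intro integral_cong_AE) (auto elim: eventually_mono)
    finally show ?thesis .
  qed
  then show ?thesis by (rule that[OF lin cL Lc _ int])
qed

lemma
  assumes W: "W \<in> sets lebesgue" and m: "bounded_coeff W m"
  shows weighted_inner_add_right: "weighted_inner W m u (v + v') = weighted_inner W m u v + weighted_inner W m u v'"
    and weighted_inner_scaleR_left: "weighted_inner W m (c *\<^sub>R u) v = c *\<^sub>R weighted_inner W m u v"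
    and weighted_inner_scaleR_right: "weighted_inner W m u (c *\<^sub>R v) = c *\<^sub>R weighted_inner W m u v"
    and weighted_inner_cutoff_left: "weighted_inner W m (cutoff W u) v = weighted_inner W m u v"
    and weighted_inner_cutoff_right: "weighted_inner W m u (cutoff W v) = weighted_inner W m u v"
    and weighted_inner_integrable: "integrable (lebesgue_on W) (\<lambda>x. complex_of_real (m x) * l2_fun u x * cnj (l2_fun v x))"
proof -
  obtain L :: "'a l2 \<Rightarrow> 'a l2" where L: "bounded_linear L" "\<And>u. cutoff W (L u) = L u" "\<And>u. L (cutoff W u) = L u"
    "\<And>u v. weighted_inner W m u v = l2_inner (L u) v"
    "\<And>u v. integrable (lebesgue_on W) (\<lambda>x. complex_of_real (m x) * l2_fun u x * cnj (l2_fun v x))"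
    using weighted_inner_multiplier[OF W m] by metis
  interpret L: bounded_linear L by (rule L(1))
  interpret B: bounded_bilinear l2_inner by (rule bounded_bilinear_l2_inner)
  show "weighted_inner W m u (v + v') = weighted_inner W m u v + weighted_inner W m u v'"
    "weighted_inner W m (c *\<^sub>R u) v = c *\<^sub>R weighted_inner W m u v"
    "weighted_inner W m u (c *\<^sub>R v) = c *\<^sub>R weighted_inner W m u v"
    "weighted_inner W m (cutoff W u) v = weighted_inner W m u v"
    "integrable (lebesgue_on W) (\<lambda>x. complex_of_real (m x) * l2_fun u x * cnj (l2_fun v x))"
    using L by (simp_all add: L.add B.add_left B.add_right L.scaleR B.scaleR_left B.scaleR_right)
  show "weighted_inner W m u (cutoff W v) = weighted_inner W m u v"
    using L l2_inner_cutoff[OF W, of "L u" v] by simp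
qed

text \<open>Scalar weights, one for each matrix entry, turn the conjugation of A by the reflection
  matrix into mere signs. Row i goes with the derivative of g and column j with that of f.\<close>

lemma sesq_form_eq:
  fixes A :: "real ^ 'n \<Rightarrow> real ^ 'n ^ 'n"
  assumes W: "W \<in> sets lebesgue" and A: "\<And>i j. bounded_coeff W (\<lambda>x. A x $ i $ j)" and V: "bounded_coeff W V"
  shows "sesq_form W A V f g = (\<Sum>i\<in>UNIV. \<Sum>j\<in>UNIV.
      weighted_inner W (\<lambda>x. A x $ i $ j) (weak_deriv W (axis j 1) f) (weak_deriv W (axis i 1) g)) + weighted_inner W V f g"
proof -
  have "cvec_inner (cmat_vec (A x) (weak_grad W f x)) (weak_grad W g x) =
      (\<Sum>i\<in>UNIV. \<Sum>j\<in>UNIV. complex_of_real (A x $ i $ j) * l2_fun (weak_deriv W (axis j 1) f) x *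
        cnj (l2_fun (weak_deriv W (axis i 1) g) x))" for x
    by (simp add: cvec_inner_def cmat_vec_def matrix_vector_mult_def weak_grad_def map_matrix_def sum_distrib_right)
  then show ?thesis
    unfolding sesq_form_def weighted_inner_def
    by (simp add: Bochner_Integration.integral_sum weighted_inner_integrable[OF W A])
qed

context mirror_domain
begin

lemma AE_on_domain:
  assumes "AE x in lebesgue_on \<Omega>. P x" "AE x in lebesgue_on \<Omega>. P (mirror k x)"
  shows "AE x in lebesgue_on \<Omega>'. P x"
proof -
  have P: "AE x in lebesgue. x \<in> \<Omega> \<longrightarrow> P x" "AE x in lebesgue. x \<in> \<Omega> \<longrightarrow> P (mirror k x)"
    using assms by (auto simp: AE_restrict_space_iff)
  have "AE x in lebesgue. x \<in> \<Omega>' \<longrightarrow> P x"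
    using P(1) AE_mirror[OF P(2), of k] AE_not_hyperplane
    by eventually_elim (auto simp: half mirror_mem mirror_nth)
  then show ?thesis by (simp add: AE_restrict_space_iff)
qed

text \<open>Up to a null set the integral runs over \<Omega> and its mirror image, and the second
  part is pulled back to \<Omega> by the measure-preserving reflection.\<close>

lemma weighted_inner_split:
  assumes m': "bounded_coeff \<Omega>' m'" and m2: "bounded_coeff \<Omega> m2"
    and m1_eq: "\<And>x. x \<in> \<Omega> \<Longrightarrow> m' x = m1 x" and m2_eq: "\<And>x. x \<in> \<Omega> \<Longrightarrow> m' (mirror k x) = m2 x"
  shows "weighted_inner \<Omega>' m' u v = weighted_inner \<Omega> m1 u v + weighted_inner \<Omega> m2 (l2_mirror k u) (l2_mirror k v)"
proof -
  define F where "F x = complex_of_real (m' x) * l2_fun u x * cnj (l2_fun v x)" for x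
  have "integrable (lebesgue_on \<Omega>') F" unfolding F_def by (rule weighted_inner_integrable[OF sets(2) m'])
  then have F': "integrable lebesgue (\<lambda>x. indicator \<Omega>' x *\<^sub>R F x)" by (simp add: integrable_restrict_space)
  have F1: "integrable lebesgue (\<lambda>x. indicator \<Omega> x *\<^sub>R F x)"
  proof -
    have "(\<lambda>x. indicator \<Omega> x *\<^sub>R F x) = (\<lambda>x. indicator \<Omega> x *\<^sub>R (indicator \<Omega>' x *\<^sub>R F x))"
      by (auto simp: half indicator_def)
    then show ?thesis using integrable_mult_indicator[OF sets(1) F'] by simp
  qed
  have F2: "integrable lebesgue (\<lambda>x. indicator (mirror k ` \<Omega>) x *\<^sub>R F x)"
  proof -
    have "(\<lambda>x. indicator (mirror k ` \<Omega>) x *\<^sub>R F x) = (\<lambda>x. indicator (mirror k ` \<Omega>) x *\<^sub>R (indicator \<Omega>' x *\<^sub>R F x))"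
      by (auto simp: half indicator_def mem_mirror_image mirror_mem)
    then show ?thesis using integrable_mult_indicator[OF mirror_image_sets[OF sets(1)] F'] by simp
  qed
  have "weighted_inner \<Omega>' m' u v = (LINT x|lebesgue. indicator \<Omega>' x *\<^sub>R F x)"
    unfolding weighted_inner_def F_def by (subst integral_restrict_space) auto
  also have "\<dots> = (LINT x|lebesgue. indicator \<Omega> x *\<^sub>R F x + indicator (mirror k ` \<Omega>) x *\<^sub>R F x)"
  proof (rule integral_cong_AE)
    show "AE x in lebesgue. indicator \<Omega>' x *\<^sub>R F x = indicator \<Omega> x *\<^sub>R F x + indicator (mirror k ` \<Omega>) x *\<^sub>R F x"
      using AE_not_hyperplane by eventually_elim (auto simp: half indicator_def mem_mirror_image mirror_mem mirror_nth)
  qed (use F' F1 F2 in auto)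
  also have "\<dots> = (LINT x|lebesgue. indicator \<Omega> x *\<^sub>R F x) + (LINT x|lebesgue. indicator (mirror k ` \<Omega>) x *\<^sub>R F x)"
    using F1 F2 by simp
  also have "(LINT x|lebesgue. indicator (mirror k ` \<Omega>) x *\<^sub>R F x) =
      (LINT x|lebesgue. indicator (mirror k ` \<Omega>) (mirror k x) *\<^sub>R F (mirror k x))"
    using F2 by (intro integral_mirror[symmetric]) auto
  also have "\<dots> = (LINT x|lebesgue. indicator \<Omega> x *\<^sub>R (complex_of_real (m2 x) * l2_fun (l2_mirror k u) x * cnj (l2_fun (l2_mirror k v) x)))"
  proof (rule integral_cong_AE)
    show "AE x in lebesgue. indicator (mirror k ` \<Omega>) (mirror k x) *\<^sub>R F (mirror k x) =
        indicator \<Omega> x *\<^sub>R (complex_of_real (m2 x) * l2_fun (l2_mirror k u) x * cnj (l2_fun (l2_mirror k v) x))"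
      using l2_fun_mirror[of k u] l2_fun_mirror[of k v]
      by eventually_elim (auto simp: indicator_def mem_mirror_image F_def m2_eq)
    show "(\<lambda>x. indicator (mirror k ` \<Omega>) (mirror k x) *\<^sub>R F (mirror k x)) \<in> borel_measurable lebesgue"
      using integrable_mirror[OF F2, of k] by (rule borel_measurable_integrable)
    have "integrable lebesgue (\<lambda>x. indicator \<Omega> x *\<^sub>R (complex_of_real (m2 x) * l2_fun (l2_mirror k u) x * cnj (l2_fun (l2_mirror k v) x)))"
      using weighted_inner_integrable[OF sets(1) m2] by (simp add: integrable_restrict_space)
    then show "(\<lambda>x. indicator \<Omega> x *\<^sub>R (complex_of_real (m2 x) * l2_fun (l2_mirror k u) x * cnj (l2_fun (l2_mirror k v) x))) \<in> borel_measurable lebesgue"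
      by (rule borel_measurable_integrable)
  qed
  also have "\<dots> = weighted_inner \<Omega> m2 (l2_mirror k u) (l2_mirror k v)"
    unfolding weighted_inner_def by (subst integral_restrict_space) auto
  also have "(LINT x|lebesgue. indicator \<Omega> x *\<^sub>R F x) = weighted_inner \<Omega> m1 u v"
    unfolding weighted_inner_def by (subst integral_restrict_space) (auto simp: F_def m1_eq indicator_def intro!: Bochner_Integration.integral_cong)
  finally show ?thesis .
qed

end

section \<open>Forms with reflected coefficients\<close>

locale mirror_form = mirror_domain k \<Omega> \<Omega>' for k :: "'n::finite" and \<Omega> \<Omega>' +
  fixes A A' :: "real ^ 'n \<Rightarrow> real ^ 'n ^ 'n" and V V' :: "real ^ 'n \<Rightarrow> real"
  assumes A: "bounded_coeff \<Omega> (\<lambda>x. A x $ i $ j)" and V: "bounded_coeff \<Omega> V"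
    and A': "A' \<in> borel_measurable (lebesgue_on \<Omega>')" and V': "V' \<in> borel_measurable (lebesgue_on \<Omega>')"
    and same: "x \<in> \<Omega> \<Longrightarrow> A' x = A x \<and> V' x = V x"
    and reflected: "x \<in> mirror k ` \<Omega> \<Longrightarrow>
        A' x = mirror_matrix k ** A (mirror k x) ** mirror_matrix k \<and> V' x = V (mirror k x)"
begin

abbreviation axis_sign :: "'n \<Rightarrow> real" where "axis_sign i \<equiv> \<sigma> (axis i 1)"

lemma reflected_entry:
  assumes "x \<in> \<Omega>"
  shows "A' (mirror k x) $ i $ j = axis_sign i * axis_sign j * A x $ i $ j" "V' (mirror k x) = V x"
proof -
  have m: "mirror k x \<in> mirror k ` \<Omega>" using assms by simp
  have U: "mirror_matrix k $ a $ b = (if a = b then axis_sign b else 0)" for a b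
    by (simp add: mirror_matrix_def mirror_sign_def axis_eq_axis)
  have "(mirror_matrix k ** B) $ a $ b = axis_sign a * B $ a $ b" for B :: "real ^ 'n ^ 'n" and a b
  proof -
    have "(mirror_matrix k ** B) $ a $ b = (\<Sum>l\<in>UNIV. if a = l then axis_sign l * B $ l $ b else 0)"
      by (simp only: matrix_matrix_mult_def vec_lambda_beta U) (rule sum.cong, auto)
    then show ?thesis by simp
  qed
  moreover have "(B ** mirror_matrix k) $ a $ b = axis_sign b * B $ a $ b" for B :: "real ^ 'n ^ 'n" and a b
  proof -
    have "(B ** mirror_matrix k) $ a $ b = (\<Sum>l\<in>UNIV. if l = b then axis_sign l * B $ a $ l else 0)"
      by (simp only: matrix_matrix_mult_def vec_lambda_beta U) (rule sum.cong, auto)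
    then show ?thesis by simp
  qed
  ultimately show "A' (mirror k x) $ i $ j = axis_sign i * axis_sign j * A x $ i $ j"
    using reflected[OF m] by simp
  show "V' (mirror k x) = V x" using reflected[OF m] by simp
qed

lemma bounded_A': "bounded_coeff \<Omega>' (\<lambda>x. A' x $ i $ j)"
  unfolding bounded_coeff_def
proof
  have "(\<lambda>M :: real ^ 'n ^ 'n. M $ i $ j) \<in> borel_measurable borel"
    by (intro borel_measurable_continuous_onI continuous_intros)
  then show "(\<lambda>x. A' x $ i $ j) \<in> borel_measurable (lebesgue_on \<Omega>')"
    using A' by (rule measurable_compose[rotated])
  obtain C where C: "AE x in lebesgue_on \<Omega>. \<bar>A x $ i $ j\<bar> \<le> C" using A[of i j] by (auto simp: bounded_coeff_def)
  have sp: "AE x in lebesgue_on \<Omega>. x \<in> \<Omega>" by (rule AE_I2) simp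
  have "AE x in lebesgue_on \<Omega>'. \<bar>A' x $ i $ j\<bar> \<le> C"
  proof (rule AE_on_domain)
    show "AE x in lebesgue_on \<Omega>. \<bar>A' x $ i $ j\<bar> \<le> C"
      using C sp by eventually_elim (use same in auto)
    show "AE x in lebesgue_on \<Omega>. \<bar>A' (mirror k x) $ i $ j\<bar> \<le> C"
      using C sp by eventually_elim (simp add: reflected_entry abs_mult mirror_sign_def)
  qed
  then show "\<exists>C. AE x in lebesgue_on \<Omega>'. \<bar>A' x $ i $ j\<bar> \<le> C" by blast
qed

lemma bounded_V': "bounded_coeff \<Omega>' V'"
  unfolding bounded_coeff_def
proof
  obtain C where C: "AE x in lebesgue_on \<Omega>. \<bar>V x\<bar> \<le> C" using V by (auto simp: bounded_coeff_def)
  have sp: "AE x in lebesgue_on \<Omega>. x \<in> \<Omega>" by (rule AE_I2) simp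
  have "AE x in lebesgue_on \<Omega>'. \<bar>V' x\<bar> \<le> C"
  proof (rule AE_on_domain)
    show "AE x in lebesgue_on \<Omega>. \<bar>V' x\<bar> \<le> C"
      using C sp by eventually_elim (use same in auto)
    show "AE x in lebesgue_on \<Omega>. \<bar>V' (mirror k x)\<bar> \<le> C"
      using C sp by eventually_elim (simp add: reflected_entry)
  qed
  then show "\<exists>C. AE x in lebesgue_on \<Omega>'. \<bar>V' x\<bar> \<le> C" by blast
qed (rule V')

lemma weighted_inner_V':
  "weighted_inner \<Omega>' V' u v = weighted_inner \<Omega> V u v + weighted_inner \<Omega> V (l2_mirror k u) (l2_mirror k v)"
  by (rule weighted_inner_split[OF bounded_V' V]) (use same reflected_entry in auto)

text \<open>The two signs of the reflected matrix entry are moved into the arguments, where they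
  match the signs that reflection gives to the partial derivatives. This is why the reflected
  coefficient is U A U.\<close>

lemma weighted_inner_A':
  "weighted_inner \<Omega>' (\<lambda>x. A' x $ i $ j) u v =
     weighted_inner \<Omega> (\<lambda>x. A x $ i $ j) u v +
     weighted_inner \<Omega> (\<lambda>x. A x $ i $ j) (axis_sign j *\<^sub>R l2_mirror k u) (axis_sign i *\<^sub>R l2_mirror k v)"
proof -
  have m2: "bounded_coeff \<Omega> (\<lambda>x. axis_sign i * axis_sign j * A x $ i $ j)"
    unfolding bounded_coeff_def
  proof
    show "(\<lambda>x. axis_sign i * axis_sign j * A x $ i $ j) \<in> borel_measurable (lebesgue_on \<Omega>)"
      using A[of i j] by (intro borel_measurable_times borel_measurable_const) (simp add: bounded_coeff_def)
    have "\<bar>axis_sign i * axis_sign j * A x $ i $ j\<bar> = \<bar>A x $ i $ j\<bar>" for x by (simp add: abs_mult mirror_sign_def)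
    then show "\<exists>C. AE x in lebesgue_on \<Omega>. \<bar>axis_sign i * axis_sign j * A x $ i $ j\<bar> \<le> C"
      using A[of i j] by (simp only: bounded_coeff_def)
  qed
  have "weighted_inner \<Omega> (\<lambda>x. axis_sign i * axis_sign j * A x $ i $ j) (l2_mirror k u) (l2_mirror k v) =
      weighted_inner \<Omega> (\<lambda>x. A x $ i $ j) (axis_sign j *\<^sub>R l2_mirror k u) (axis_sign i *\<^sub>R l2_mirror k v)"
    unfolding weighted_inner_scaleR_left[OF sets(1) A] weighted_inner_scaleR_right[OF sets(1) A]
    unfolding weighted_inner_def by (simp add: scaleR_conv_of_real mult.assoc flip: integral_mult_right_zero)
  moreover have "weighted_inner \<Omega>' (\<lambda>x. A' x $ i $ j) u v =
     weighted_inner \<Omega> (\<lambda>x. A x $ i $ j) u v + weighted_inner \<Omega> (\<lambda>x. axis_sign i * axis_sign j * A x $ i $ j) (l2_mirror k u) (l2_mirror k v)"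
    by (rule weighted_inner_split[OF bounded_A' m2]) (use same reflected_entry in auto)
  ultimately show ?thesis by simp
qed

text \<open>Reflecting either argument makes the contributions of the two halves trade
  places.\<close>

lemma sesq_form_mirror:
  assumes "f \<in> form_domain bc \<Omega>'" "g \<in> form_domain bc \<Omega>'"
  shows "sesq_form \<Omega>' A' V' (l2_mirror k f) g = sesq_form \<Omega>' A' V' f (l2_mirror k g)"
proof -
  interpret R: bounded_linear "l2_mirror k" by (rule bounded_linear_l2_mirror)
  show ?thesis
    unfolding sesq_form_eq[OF sets(2) bounded_A' bounded_V']
    by (simp add: weak_deriv_mirror[OF assms(1)] weak_deriv_mirror[OF assms(2)] axis_in_Basis_iff
        weighted_inner_A' weighted_inner_V' R.scaleR add.commute)
qed

lemma cutoff_ext_mirror: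
  assumes "h \<in> L2_on \<Omega>" "c * c = 1"
  shows "cutoff \<Omega> (l2_mirror k (ext c h)) = c *\<^sub>R h"
proof -
  interpret P: bounded_linear "cutoff \<Omega>" by (rule bounded_linear_cutoff) simp
  interpret R: bounded_linear "l2_mirror k" by (rule bounded_linear_l2_mirror)
  have "l2_mirror k (ext c h) = c *\<^sub>R ext c h"
    using assms(2) by (simp add: ext_def R.add R.scaleR scaleR_add_right)
  then show ?thesis using cutoff_ext[OF assms(1), of c] by (simp add: P.scaleR)
qed

lemma sesq_form_ext:
  assumes f: "f \<in> form_domain bc \<Omega>" and g: "g \<in> form_domain bc \<Omega>'"
  shows "sesq_form \<Omega>' A' V' (ext (bc_sign bc) f) g = sesq_form \<Omega> A V f (rst (bc_sign bc) g)"
proof -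
  define \<epsilon> where "\<epsilon> = bc_sign bc"
  have \<epsilon>: "\<epsilon> * \<epsilon> = 1" by (simp add: \<epsilon>_def)
  \<comment> \<open>Here h and u stand for a derivative of f and of g, with axis signs t and t';
    both signs are 1 for the potential term. On the reflected half the extension of parity c =
    \<epsilon> t equals c h, so that term carries the factor t t' c = \<epsilon> t', the sign in the
    restriction of u.\<close>
  have key: "weighted_inner \<Omega> m (ext c h) u + weighted_inner \<Omega> m (t *\<^sub>R l2_mirror k (ext c h)) (t' *\<^sub>R l2_mirror k u) =
      weighted_inner \<Omega> m h (rst (\<epsilon> * t') u)"
    if m: "bounded_coeff \<Omega> m" and h: "h \<in> L2_on \<Omega>" and c: "c = \<epsilon> * t" "t * t = 1" for m c h u t t'
  proof -
    interpret P: bounded_linear "cutoff \<Omega>" by (rule bounded_linear_cutoff) simp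
    note wi = weighted_inner_add_right[OF sets(1) m] weighted_inner_scaleR_left[OF sets(1) m]
      weighted_inner_scaleR_right[OF sets(1) m]
    have cc: "c * c = 1" using c \<epsilon> by (simp add: algebra_simps)
    have 1: "weighted_inner \<Omega> m (ext c h) u = weighted_inner \<Omega> m h u"
      using weighted_inner_cutoff_left[OF sets(1) m, of "ext c h" u] cutoff_ext[OF h] by simp
    have 2: "weighted_inner \<Omega> m (l2_mirror k (ext c h)) w = c *\<^sub>R weighted_inner \<Omega> m h w" for w
      using weighted_inner_cutoff_left[OF sets(1) m, of "l2_mirror k (ext c h)" w] cutoff_ext_mirror[OF h cc] by (simp add: wi)
    have "weighted_inner \<Omega> m h (rst (\<epsilon> * t') u) = weighted_inner \<Omega> m h (ext (\<epsilon> * t') u)"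
      unfolding rst_def by (rule weighted_inner_cutoff_right[OF sets(1) m])
    also have "\<dots> = weighted_inner \<Omega> m h u + (\<epsilon> * t') *\<^sub>R weighted_inner \<Omega> m h (l2_mirror k u)"
      by (simp add: ext_def wi)
    also have "(\<epsilon> * t') *\<^sub>R weighted_inner \<Omega> m h (l2_mirror k u) =
        weighted_inner \<Omega> m (t *\<^sub>R l2_mirror k (ext c h)) (t' *\<^sub>R l2_mirror k u)"
    proof -
      have "\<epsilon> * t' = t' * (t * c)" using c by (simp add: mult_ac)
      then show ?thesis unfolding wi 2 scaleR_scaleR by (simp only:)
    qed
    finally show ?thesis unfolding 1 by (rule sym)
  qed
  have h: "weak_deriv \<Omega> (axis j 1) f \<in> L2_on \<Omega>" for j
    using form_domain_weak_deriv[OF open_half f, of "axis j 1"] by (simp add: is_weak_deriv_def axis_in_Basis_iff)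
  have f': "f \<in> L2_on \<Omega>" by (rule form_domain_subset[OF open_half f])
  have "weighted_inner \<Omega>' V' (ext \<epsilon> f) g = weighted_inner \<Omega> V f (rst \<epsilon> g)"
    using key[OF V f', of \<epsilon> 1 g 1] by (simp add: weighted_inner_V')
  moreover have "weighted_inner \<Omega>' (\<lambda>x. A' x $ i $ j) (ext (\<epsilon> * axis_sign j) (weak_deriv \<Omega> (axis j 1) f)) (weak_deriv \<Omega>' (axis i 1) g) =
      weighted_inner \<Omega> (\<lambda>x. A x $ i $ j) (weak_deriv \<Omega> (axis j 1) f) (rst (\<epsilon> * axis_sign i) (weak_deriv \<Omega>' (axis i 1) g))" for i j
    unfolding weighted_inner_A' by (rule key[OF A h]) auto
  ultimately show ?thesis
    unfolding sesq_form_eq[OF sets(2) bounded_A' bounded_V'] sesq_form_eq[OF sets(1) A V] \<epsilon>_def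
    by (simp add: weak_deriv_ext[OF f] weak_deriv_rst[OF g] axis_in_Basis_iff)
qed

lemma realization_mirror:
  assumes "(f, w) \<in> realization bc \<Omega>' A' V'"
  shows "(l2_mirror k f, l2_mirror k w) \<in> realization bc \<Omega>' A' V'"
  using assms by (auto simp: realization_def form_domain_mirror mirror_in_L2_on sesq_form_mirror l2_inner_mirror)

text \<open>Forwards, adjointness of \<open>ext\<close> and \<open>rst\<close> suffices. Backwards,
  every g in the form domain on \<Omega> is \<open>rst\<close> of half its extension, so the
  identity on \<Omega>' tests against all of them; the same device puts f itself into the form
  domain.\<close>

lemma realization_ext_iff:
  assumes f: "f \<in> L2_on \<Omega>" and w: "w \<in> L2_on \<Omega>"
  shows "(f, w) \<in> realization bc \<Omega> A V \<longleftrightarrow> (ext (bc_sign bc) f, ext (bc_sign bc) w) \<in> realization bc \<Omega>' A' V'"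
proof
  assume "(f, w) \<in> realization bc \<Omega> A V"
  then have f: "f \<in> form_domain bc \<Omega>" and eq: "\<And>g. g \<in> form_domain bc \<Omega> \<Longrightarrow> sesq_form \<Omega> A V f g = l2_inner w g"
    by (auto simp: realization_def)
  show "(ext (bc_sign bc) f, ext (bc_sign bc) w) \<in> realization bc \<Omega>' A' V'"
    using f w by (simp add: realization_def form_domain_ext sesq_form_ext eq form_domain_rst l2_inner_ext ext_in_L2_on half_in_L2_on)
next
  assume "(ext (bc_sign bc) f, ext (bc_sign bc) w) \<in> realization bc \<Omega>' A' V'"
  then have Jf: "ext (bc_sign bc) f \<in> form_domain bc \<Omega>'"
    and eq: "\<And>g. g \<in> form_domain bc \<Omega>' \<Longrightarrow> sesq_form \<Omega>' A' V' (ext (bc_sign bc) f) g = l2_inner (ext (bc_sign bc) w) g"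
    by (auto simp: realization_def)
  have "(1/2) *\<^sub>R rst (bc_sign bc) (ext (bc_sign bc) f) \<in> form_domain bc \<Omega>"
    by (intro form_domain_scaleR open_half form_domain_rst Jf)
  then have f': "f \<in> form_domain bc \<Omega>" using rst_ext[OF f, of "bc_sign bc"] by simp
  have "sesq_form \<Omega> A V f g = l2_inner w g" if g: "g \<in> form_domain bc \<Omega>" for g
  proof -
    interpret r: bounded_linear "rst (bc_sign bc)" by (rule bounded_linear_rst)
    define g' where "g' = (1/2) *\<^sub>R ext (bc_sign bc) g"
    have g': "g' \<in> form_domain bc \<Omega>'" unfolding g'_def by (intro form_domain_scaleR open' form_domain_ext g)
    have "rst (bc_sign bc) g' = g"
      using rst_ext[OF form_domain_subset[OF open_half g], of "bc_sign bc"] by (simp add: g'_def r.scaleR)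
    then show ?thesis using eq[OF g'] sesq_form_ext[OF f' g'] l2_inner_ext[OF w] by simp
  qed
  then show "(f, w) \<in> realization bc \<Omega> A V" using f' w by (simp add: realization_def)
qed

end

section \<open>Semigroups and control\<close>

text \<open>\<open>c0_semigroup\<close> states homogeneity through complex multiples, whereas
  \<open>bounded_linear\<close> is about real ones.\<close>

lemma scaleR_eq_l2_mult: "r *\<^sub>R f = l2_mult (\<lambda>_. complex_of_real r) f"
  by (rule l2_eqI) (use l2_fun_scaleR[of r f] l2_fun_const_mult[of "complex_of_real r" f] in
      \<open>eventually_elim, simp add: scaleR_conv_of_real\<close>)

lemma bounded_linear_const_mult: "bounded_linear (l2_mult (\<lambda>_. c))"
  by (rule bounded_linear_l2_mult[where C = "cmod c"]) auto

lemma cutoff_const_mult: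
  assumes "S \<in> sets lebesgue"
  shows "cutoff S (l2_mult (\<lambda>_. c) f) = l2_mult (\<lambda>_. c) (cutoff S f)"
  by (rule l2_eqI) (use l2_fun_const_mult[of c f] l2_fun_cutoff[OF assms, of f]
      l2_fun_cutoff[OF assms, of "l2_mult (\<lambda>_. c) f"] l2_fun_const_mult[of c "cutoff S f"] in \<open>eventually_elim, simp\<close>)

text \<open>S is constrained only on \<open>L2_on W\<close>. Composition with the cutoff turns it
  into operators on the whole Banach space whose time 0 value is the projection onto that subspace,
  and the fixed point conditions in \<open>gen\<close> recover the subspace.\<close>

lemma
  assumes W: "W \<in> sets lebesgue" and S: "c0_semigroup (L2_on W) S"
  shows banach_semigroup_of_c0: "banach_semigroup (\<lambda>t f. S t (cutoff W f))"
    and gen_of_c0: "banach_semigroup.gen (\<lambda>t f. S t (cutoff W f)) = generator (L2_on W) S"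
proof -
  interpret P: bounded_linear "cutoff W" by (rule bounded_linear_cutoff[OF W])
  have in_X: "cutoff W f \<in> L2_on W" for f by (rule cutoff_in_L2_on[OF W])
  have S_add: "0 \<le> t \<Longrightarrow> f \<in> L2_on W \<Longrightarrow> g \<in> L2_on W \<Longrightarrow> S t (f + g) = S t f + S t g" for t f g
    using S by (simp add: c0_semigroup_def)
  have S_mult: "0 \<le> t \<Longrightarrow> f \<in> L2_on W \<Longrightarrow> S t (l2_mult (\<lambda>_. c) f) = l2_mult (\<lambda>_. c) (S t f)" for t c f
    using S by (simp add: c0_semigroup_def)
  have S_in: "0 \<le> t \<Longrightarrow> f \<in> L2_on W \<Longrightarrow> S t f \<in> L2_on W" for t f
    using S by (simp add: c0_semigroup_def)
  have S_0: "f \<in> L2_on W \<Longrightarrow> S 0 f = f" for f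
    using S by (simp add: c0_semigroup_def)
  have S_semi: "0 \<le> s \<Longrightarrow> 0 \<le> t \<Longrightarrow> f \<in> L2_on W \<Longrightarrow> S (s + t) f = S s (S t f)" for s t f
    using S by (simp add: c0_semigroup_def)
  have S_lim: "f \<in> L2_on W \<Longrightarrow> ((\<lambda>t. S t f) \<longlongrightarrow> f) (at_right 0)" for f
    using S by (simp add: c0_semigroup_def)
  have id: "f \<in> L2_on W \<Longrightarrow> cutoff W f = f" for f using L2_on_iff_cutoff[OF W] by blast
  show sg: "banach_semigroup (\<lambda>t f. S t (cutoff W f))"
  proof (rule banach_semigroup.intro)
    fix t :: real assume t: "0 \<le> t"
    have "\<exists>B. \<forall>f\<in>L2_on W. norm (S t f) \<le> B * norm f"
      using S t by (simp add: c0_semigroup_def)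
    then obtain B where B: "\<And>f. f \<in> L2_on W \<Longrightarrow> norm (S t f) \<le> B * norm f" by blast
    show "bounded_linear (\<lambda>f. S t (cutoff W f))"
    proof (rule bounded_linear_intro[where K = "max B 0"])
      show "S t (cutoff W (f + g)) = S t (cutoff W f) + S t (cutoff W g)" for f g
        by (simp add: P.add S_add t in_X)
      show "S t (cutoff W (r *\<^sub>R f)) = r *\<^sub>R S t (cutoff W f)" for r f
        unfolding scaleR_eq_l2_mult cutoff_const_mult[OF W] by (rule S_mult[OF t in_X])
      show "norm (S t (cutoff W f)) \<le> norm f * max B 0" for f
      proof -
        have "norm (S t (cutoff W f)) \<le> B * norm (cutoff W f)" by (rule B[OF in_X])
        also have "\<dots> \<le> max B 0 * norm f" using norm_cutoff_le[OF W, of f] by (intro mult_mono) auto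
        finally show ?thesis by (simp add: mult.commute)
      qed
    qed
  next
    fix s t :: real and f assume "0 \<le> s" "0 \<le> t"
    then show "S (s + t) (cutoff W f) = S s (cutoff W (S t (cutoff W f)))"
      by (simp add: S_semi in_X id S_in)
  next
    show "((\<lambda>t. S t (cutoff W f)) \<longlongrightarrow> S 0 (cutoff W f)) (at_right 0)" for f
      using S_lim[OF in_X] by (simp add: S_0 in_X)
  qed
  have "S 0 (cutoff W f) = f \<longleftrightarrow> f \<in> L2_on W" for f
    using L2_on_iff_cutoff[OF W, of f] by (simp add: S_0 in_X)
  then show "banach_semigroup.gen (\<lambda>t f. S t (cutoff W f)) = generator (L2_on W) S"
    unfolding banach_semigroup.gen_def[OF sg] generator_def by (auto simp: id)
qed

lemma exp_semigroup_unique: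
  assumes W: "W \<in> sets lebesgue" and S: "is_exp_semigroup (L2_on W) H S" "is_exp_semigroup (L2_on W) H S'"
    and t: "t \<ge> 0" and f: "f \<in> L2_on W"
  shows "S t f = S' t f"
proof -
  have c: "c0_semigroup (L2_on W) S" "c0_semigroup (L2_on W) S'" using S by (auto simp: is_exp_semigroup_def)
  have "(\<lambda>f. S t (cutoff W f)) = (\<lambda>f. S' t (cutoff W f))"
  proof (rule banach_semigroup_unique[OF banach_semigroup_of_c0[OF W c(1)] banach_semigroup_of_c0[OF W c(2)] _ _ t])
    show "(\<lambda>f. S 0 (cutoff W f)) = (\<lambda>f. S' 0 (cutoff W f))"
      using c cutoff_in_L2_on[OF W] by (simp add: c0_semigroup_def)
    show "banach_semigroup.gen (\<lambda>t f. S t (cutoff W f)) = banach_semigroup.gen (\<lambda>t f. S' t (cutoff W f))"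
      using S by (simp add: gen_of_c0[OF W] c is_exp_semigroup_def)
  qed
  moreover have "cutoff W f = f" using f L2_on_iff_cutoff[OF W] by blast
  ultimately show ?thesis by metis
qed

text \<open>Conjugation by an embedding E with left inverse P. The hypothesis \<open>inv\<close>
  says that orbits starting in the range of E stay in it, so the two descriptions determine each
  other, including their difference quotients at 0. It is used with E and P both the reflection, and
  with the extension and the cutoff.\<close>

lemma is_exp_semigroup_transport:
  assumes S: "is_exp_semigroup X' H' S" and X: "subspace X"
    and E: "bounded_linear E" "\<And>f. f \<in> X \<Longrightarrow> E f \<in> X'" "\<And>c f. E (l2_mult (\<lambda>_. c) f) = l2_mult (\<lambda>_. c) (E f)"
    and P: "bounded_linear P" "\<And>f. f \<in> X' \<Longrightarrow> P f \<in> X" "\<And>c f. P (l2_mult (\<lambda>_. c) f) = l2_mult (\<lambda>_. c) (P f)"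
    and PE: "\<And>f. f \<in> X \<Longrightarrow> P (E f) = f"
    and inv: "\<And>t f. 0 \<le> t \<Longrightarrow> f \<in> X \<Longrightarrow> E (P (S t (E f))) = S t (E f)"
    and H: "H \<subseteq> X \<times> X" "\<And>f w. f \<in> X \<Longrightarrow> w \<in> X \<Longrightarrow> (f, w) \<in> H \<longleftrightarrow> (E f, E w) \<in> H'"
  shows "is_exp_semigroup X H (\<lambda>t f. P (S t (E f)))"
proof -
  interpret E: bounded_linear E by (rule E(1))
  interpret P: bounded_linear P by (rule P(1))
  have c: "c0_semigroup X' S" and gen: "generator X' S = {(f, - w) | f w. (f, w) \<in> H'}"
    using S by (auto simp: is_exp_semigroup_def)
  have S_in: "0 \<le> t \<Longrightarrow> f \<in> X' \<Longrightarrow> S t f \<in> X'" for t f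
    using c by (simp add: c0_semigroup_def)
  have S_lim: "f \<in> X' \<Longrightarrow> ((\<lambda>t. S t f) \<longlongrightarrow> f) (at_right 0)" for f
    using c by (simp add: c0_semigroup_def)
  have c0: "c0_semigroup X (\<lambda>t f. P (S t (E f)))"
    unfolding c0_semigroup_def
  proof (intro conjI allI impI ballI)
    fix t :: real assume t: "0 \<le> t"
    show "f \<in> X \<Longrightarrow> P (S t (E f)) \<in> X" for f by (intro P S_in t E)
    show "f \<in> X \<Longrightarrow> g \<in> X \<Longrightarrow> P (S t (E (f + g))) = P (S t (E f)) + P (S t (E g))" for f g
      using c t E(2) by (simp add: c0_semigroup_def E.add P.add)
    show "f \<in> X \<Longrightarrow> P (S t (E (l2_mult (\<lambda>_. d) f))) = l2_mult (\<lambda>_. d) (P (S t (E f)))" for f d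
      using c t E(2) by (simp add: c0_semigroup_def E(3) P(3))
    have "\<exists>B. \<forall>f\<in>X'. norm (S t f) \<le> B * norm f"
      using c t by (simp add: c0_semigroup_def)
    then obtain B where B: "\<And>f. f \<in> X' \<Longrightarrow> norm (S t f) \<le> B * norm f" by blast
    obtain KP where KP: "\<And>f. norm (P f) \<le> norm f * KP" "KP > 0" using P.pos_bounded by blast
    obtain KE where KE: "\<And>f. norm (E f) \<le> norm f * KE" "KE > 0" using E.pos_bounded by blast
    have "norm (P (S t (E f))) \<le> (\<bar>B\<bar> * KE * KP) * norm f" if "f \<in> X" for f
    proof -
      have "norm (P (S t (E f))) \<le> norm (S t (E f)) * KP" by (rule KP)
      also have "norm (S t (E f)) \<le> B * norm (E f)" by (intro B E that)
      also have "\<dots> \<le> \<bar>B\<bar> * (norm f * KE)" using KE by (intro mult_mono) auto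
      finally show ?thesis using KP(2) by (simp add: mult_ac)
    qed
    then show "\<exists>B. \<forall>f\<in>X. norm (P (S t (E f))) \<le> B * norm f" by blast
  next
    show "P (S 0 (E f)) = f" if "f \<in> X" for f using c E(2)[OF that] PE[OF that] by (simp add: c0_semigroup_def)
  next
    fix s t :: real and f assume st: "0 \<le> s" "0 \<le> t" and f: "f \<in> X"
    have "S (s + t) (E f) = S s (S t (E f))" using c st E(2)[OF f] by (simp add: c0_semigroup_def)
    then show "P (S (s + t) (E f)) = P (S s (E (P (S t (E f)))))" by (simp add: inv st f)
  next
    show "((\<lambda>t. P (S t (E f))) \<longlongrightarrow> f) (at_right 0)" if "f \<in> X" for f
      using P.tendsto[OF S_lim[OF E(2)[OF that]]] PE[OF that] by simp
  qed
  have "(f, g) \<in> generator X (\<lambda>t f. P (S t (E f))) \<longleftrightarrow> (f, - g) \<in> H" for f g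
  proof (cases "f \<in> X \<and> g \<in> X")
    case False
    then have "(f, - g) \<notin> H" using H(1) subspace_neg[OF X, of "- g"] by auto
    with False show ?thesis by (auto simp: generator_def)
  next
    case True
    have ev: "eventually (\<lambda>t. (0::real) < t) (at_right 0)" by (rule eventually_at_right_less)
    \<comment> \<open>Applying E, where \<open>inv\<close> removes E P, gives one direction;
      applying P, a left inverse of E, gives the other.\<close>
    have "((\<lambda>t. (P (S t (E f)) - f) /\<^sub>R t) \<longlongrightarrow> g) (at_right 0) \<longleftrightarrow>
        ((\<lambda>t. (S t (E f) - E f) /\<^sub>R t) \<longlongrightarrow> E g) (at_right 0)"
    proof
      assume "((\<lambda>t. (P (S t (E f)) - f) /\<^sub>R t) \<longlongrightarrow> g) (at_right 0)"
      then have "((\<lambda>t. E ((P (S t (E f)) - f) /\<^sub>R t)) \<longlongrightarrow> E g) (at_right 0)" by (rule E.tendsto)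
      then show "((\<lambda>t. (S t (E f) - E f) /\<^sub>R t) \<longlongrightarrow> E g) (at_right 0)"
        by (rule Lim_transform_eventually)
           (use ev True in \<open>auto elim!: eventually_mono simp: E.scaleR E.diff inv\<close>)
    next
      assume "((\<lambda>t. (S t (E f) - E f) /\<^sub>R t) \<longlongrightarrow> E g) (at_right 0)"
      then have "((\<lambda>t. P ((S t (E f) - E f) /\<^sub>R t)) \<longlongrightarrow> P (E g)) (at_right 0)" by (rule P.tendsto)
      then show "((\<lambda>t. (P (S t (E f)) - f) /\<^sub>R t) \<longlongrightarrow> g) (at_right 0)"
        using True by (simp add: P.scaleR P.diff PE)
    qed
    then have "(f, g) \<in> generator X (\<lambda>t f. P (S t (E f))) \<longleftrightarrow> (E f, E g) \<in> generator X' S"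
      using True E(2) by (auto simp: generator_def)
    also have "\<dots> \<longleftrightarrow> (E f, E (- g)) \<in> H'" unfolding gen by (auto simp: E.neg) (metis minus_minus)
    also have "\<dots> \<longleftrightarrow> (f, - g) \<in> H" using True X by (intro H(2)[symmetric]) (auto intro: subspace_neg)
    finally show ?thesis .
  qed
  then have "generator X (\<lambda>t f. P (S t (E f))) = {(f, - w) | f w. (f, w) \<in> H}"
    by (auto simp: set_eq_iff) (metis minus_minus)
  with c0 show ?thesis by (simp add: is_exp_semigroup_def)
qed

lemma exp_semigroup_is_exp: "(\<exists>S. is_exp_semigroup X H S) \<Longrightarrow> is_exp_semigroup X H (exp_semigroup X H)"
  unfolding exp_semigroup_def by (rule someI_ex[where P = "is_exp_semigroup X H"])

lemma realization_subset: "open W \<Longrightarrow> realization bc W A V \<subseteq> L2_on W \<times> L2_on W"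
  using H1_def by (cases bc) (auto simp: realization_def H01_def H1_def)

section \<open>Norms of extensions and the control region\<close>

context mirror_domain
begin

lemma ext_const_mult: "ext c (l2_mult (\<lambda>_. d) f) = l2_mult (\<lambda>_. d) (ext c f)"
proof -
  interpret M: bounded_linear "l2_mult (\<lambda>_. d) :: (real ^ 'n) l2 \<Rightarrow> _" by (rule bounded_linear_const_mult)
  show ?thesis by (simp add: ext_def M.add M.scaleR l2_mirror_const_mult)
qed

text \<open>f and its reflection have disjoint supports and equal norms, so the squared norms add
  up.\<close>

lemma norm_ext:
  assumes f: "f \<in> L2_on \<Omega>" and c: "c * c = 1"
  shows "norm (ext c f) = sqrt 2 * norm f"
proof -
  have f': "AE x in lebesgue. x \<notin> \<Omega> \<longrightarrow> l2_fun f x = 0" using f by (simp add: L2_on_def)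
  have c1: "\<bar>c\<bar> = 1" using c by (metis abs_mult_self_eq abs_1 power2_eq_1_iff power2_eq_square abs_minus)
  have i: "integrable lebesgue (\<lambda>x. (cmod (l2_fun f x))\<^sup>2)" by (rule sq_integrableD[OF sq_integrable_l2_fun])
  have i': "integrable lebesgue (\<lambda>x. (cmod (l2_fun f (mirror k x)))\<^sup>2)" using integrable_mirror[OF i] .
  have "(LINT x|lebesgue. (cmod (l2_fun (ext c f) x))\<^sup>2) =
      (LINT x|lebesgue. (cmod (l2_fun f x))\<^sup>2 + (cmod (l2_fun f (mirror k x)))\<^sup>2)"
  proof (rule integral_cong_AE)
    show "AE x in lebesgue. (cmod (l2_fun (ext c f) x))\<^sup>2 = (cmod (l2_fun f x))\<^sup>2 + (cmod (l2_fun f (mirror k x)))\<^sup>2"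
      using l2_fun_ext[of c f] f' AE_mirror[OF f', of k]
    proof eventually_elim
      case (elim x)
      have "x \<in> \<Omega> \<Longrightarrow> mirror k x \<notin> \<Omega>" by (auto simp: half mirror_nth)
      then show ?case using elim c1 by (cases "x \<in> \<Omega>") auto
    qed
  qed (use i i' in auto)
  also have "\<dots> = (LINT x|lebesgue. (cmod (l2_fun f x))\<^sup>2) + (LINT x|lebesgue. (cmod (l2_fun f (mirror k x)))\<^sup>2)"
    using i i' by simp
  also have "(LINT x|lebesgue. (cmod (l2_fun f (mirror k x)))\<^sup>2) = (LINT x|lebesgue. (cmod (l2_fun f x))\<^sup>2)"
    by (rule integral_mirror) measurable
  finally show ?thesis by (simp add: norm_l2_eq real_sqrt_mult[symmetric])
qed

lemma norm_ext_le:
  assumes "c * c = 1"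
  shows "norm (ext c f) \<le> 2 * norm f"
proof -
  have "\<bar>c\<bar> = 1" using assms by (metis abs_mult_self_eq abs_1 power2_eq_1_iff power2_eq_square abs_minus)
  then show ?thesis using norm_triangle_ineq[of f "c *\<^sub>R l2_mirror k f"] by (simp add: ext_def)
qed

lemma mirror_ext: "c * c = 1 \<Longrightarrow> l2_mirror k (ext c f) = c *\<^sub>R ext c f"
proof -
  interpret R: bounded_linear "l2_mirror k" by (rule bounded_linear_l2_mirror)
  assume "c * c = 1"
  then show ?thesis by (simp add: ext_def R.add R.scaleR scaleR_add_right)
qed

text \<open>The symmetric region gives a cutoff that commutes with the extension. On
  \<open>ext c f\<close>, which has parity c, the part over the mirror image of \<omega> is c times
  the reflection of the part over \<omega>. This intertwines the two control operators.\<close>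

lemma ext_cutoff_ext:
  assumes \<omega>: "\<omega> \<in> sets lebesgue" "\<omega> \<subseteq> \<Omega>" and c: "c * c = 1"
  shows "ext c (cutoff \<omega> (ext c f)) = ext c (cutoff (\<omega> \<union> mirror k ` \<omega>) f)"
proof -
  let ?w = "\<omega> \<union> mirror k ` \<omega>"
  have w: "?w \<in> sets lebesgue" "mirror k ` \<omega> \<in> sets lebesgue" using \<omega> by (auto intro: mirror_image_sets)
  interpret R: bounded_linear "l2_mirror k" by (rule bounded_linear_l2_mirror)
  interpret C: bounded_linear "cutoff ?w" by (rule bounded_linear_cutoff[OF w(1)])
  interpret M: bounded_linear "cutoff (mirror k ` \<omega>)" by (rule bounded_linear_cutoff[OF w(2)])
  have sum: "cutoff ?w h = cutoff \<omega> h + cutoff (mirror k ` \<omega>) h" for h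
  proof (rule l2_eqI)
    have disj: "x \<in> \<omega> \<Longrightarrow> mirror k x \<notin> \<omega>" for x using \<omega>(2) by (auto simp: half subset_iff mirror_nth) (metis mirror_nth less_asym neg_less_0_iff_less)
    show "AE x in lebesgue. l2_fun (cutoff ?w h) x = l2_fun (cutoff \<omega> h + cutoff (mirror k ` \<omega>) h) x"
      using l2_fun_cutoff[OF w(1), of h] l2_fun_cutoff[OF \<omega>(1), of h] l2_fun_cutoff[OF w(2), of h]
        l2_fun_add[of "cutoff \<omega> h" "cutoff (mirror k ` \<omega>) h"]
      by eventually_elim (use disj in \<open>auto simp: indicator_def mem_mirror_image\<close>)
  qed
  have "mirror k ` ?w = ?w" by (auto simp: image_Un image_image)
  then have "ext c (cutoff ?w f) = cutoff ?w (ext c f)"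
    by (simp add: ext_def C.add C.scaleR l2_mirror_cutoff[OF w(1)])
  also have "\<dots> = cutoff \<omega> (ext c f) + cutoff (mirror k ` \<omega>) (c *\<^sub>R c *\<^sub>R ext c f)"
    using c by (simp add: sum)
  also have "\<dots> = ext c (cutoff \<omega> (ext c f))"
    unfolding ext_def[of c "cutoff \<omega> (ext c f)"] l2_mirror_cutoff[OF \<omega>(1)] mirror_ext[OF c] by (simp only: M.scaleR)
  finally show ?thesis by simp
qed

end

lemma L2_time_bounded_linear:
  assumes L: "bounded_linear L" and v: "v \<in> L2_time T X" and X: "\<And>f. f \<in> X \<Longrightarrow> L f \<in> Y"
  shows "(\<lambda>s. L (v s)) \<in> L2_time T Y"
proof -
  interpret L: bounded_linear L by (rule L)
  have v': "v \<in> borel_measurable (lebesgue_on {0<..<T})" "\<And>s. s \<in> {0<..<T} \<Longrightarrow> v s \<in> X"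
    "integrable (lebesgue_on {0<..<T}) (\<lambda>s. (norm (v s))\<^sup>2)" using v by (auto simp: L2_time_def)
  have m: "(\<lambda>s. L (v s)) \<in> borel_measurable (lebesgue_on {0<..<T})"
    using v'(1) by (rule measurable_compose) (intro borel_measurable_continuous_onI L.continuous_on continuous_intros)
  obtain K where K: "\<And>f. norm (L f) \<le> norm f * K" "K > 0" using L.pos_bounded by blast
  have "integrable (lebesgue_on {0<..<T}) (\<lambda>s. (norm (L (v s)))\<^sup>2)"
  proof (rule Bochner_Integration.integrable_bound)
    show "integrable (lebesgue_on {0<..<T}) (\<lambda>s. K\<^sup>2 * (norm (v s))\<^sup>2)" using v'(3) by simp
    show "(\<lambda>s. (norm (L (v s)))\<^sup>2) \<in> borel_measurable (lebesgue_on {0<..<T})" using m by measurable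
    have "(norm (L (v s)))\<^sup>2 \<le> K\<^sup>2 * (norm (v s))\<^sup>2" for s
      using power_mono[OF K(1)[of "v s"], of 2] by (simp add: power_mult_distrib mult.commute)
    then show "AE s in lebesgue_on {0<..<T}. norm ((norm (L (v s)))\<^sup>2) \<le> norm (K\<^sup>2 * (norm (v s))\<^sup>2)" by simp
  qed
  with m v'(2) X show ?thesis by (simp add: L2_time_def)
qed

section \<open>Transport of semigroups and controls to the half domain\<close>

context mirror_form
begin

context
  fixes bc :: boundary_condition and S' :: "real \<Rightarrow> (real ^ 'n) l2 \<Rightarrow> (real ^ 'n) l2"
  assumes S': "is_exp_semigroup (L2_on \<Omega>') (realization bc \<Omega>' A' V') S'"
begin

abbreviation \<epsilon> :: real where "\<epsilon> \<equiv> bc_sign bc"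

lemma semigroup_in: "0 \<le> t \<Longrightarrow> f \<in> L2_on \<Omega>' \<Longrightarrow> S' t f \<in> L2_on \<Omega>'"
  using S' by (simp add: is_exp_semigroup_def c0_semigroup_def)

lemma semigroup_add: "0 \<le> t \<Longrightarrow> f \<in> L2_on \<Omega>' \<Longrightarrow> g \<in> L2_on \<Omega>' \<Longrightarrow> S' t (f + g) = S' t f + S' t g"
  using S' by (simp add: is_exp_semigroup_def c0_semigroup_def)

lemma semigroup_scaleR: "0 \<le> t \<Longrightarrow> f \<in> L2_on \<Omega>' \<Longrightarrow> S' t (c *\<^sub>R f) = c *\<^sub>R S' t f"
  using S' unfolding scaleR_eq_l2_mult by (simp add: is_exp_semigroup_def c0_semigroup_def)

text \<open>The conjugate of the semigroup by the reflection has the same generator.\<close>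

lemma semigroup_mirror:
  assumes "0 \<le> t" "f \<in> L2_on \<Omega>'"
  shows "S' t (l2_mirror k f) = l2_mirror k (S' t f)"
proof -
  have "is_exp_semigroup (L2_on \<Omega>') (realization bc \<Omega>' A' V') (\<lambda>t f. l2_mirror k (S' t (l2_mirror k f)))"
  proof (rule is_exp_semigroup_transport[OF S'])
    show "(f, w) \<in> realization bc \<Omega>' A' V' \<longleftrightarrow> (l2_mirror k f, l2_mirror k w) \<in> realization bc \<Omega>' A' V'" for f w
      using realization_mirror[of f w] realization_mirror[of "l2_mirror k f" "l2_mirror k w"] by auto
  qed (use open' in \<open>auto simp: closed_subspace_L2_on bounded_linear_l2_mirror mirror_in_L2_on l2_mirror_const_mult dest: subsetD[OF realization_subset]\<close>)
  from exp_semigroup_unique[OF sets(2) this S' assms(1) mirror_in_L2_on[OF assms(2)]]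
  show ?thesis by simp
qed

lemma semigroup_ext:
  assumes "0 \<le> t" "f \<in> L2_on \<Omega>'"
  shows "S' t (ext \<epsilon> f) = ext \<epsilon> (S' t f)"
  using assms by (simp add: ext_def semigroup_add semigroup_scaleR semigroup_mirror mirror_in_L2_on
      subspace_scale closed_subspace_L2_on)

text \<open>Since the semigroup commutes with the extension, the orbit of an extended function keeps
  its parity and is recovered from its restriction. This is the invariance that the transport
  requires.\<close>

lemma ext_cutoff_semigroup:
  assumes "0 \<le> t" "f \<in> L2_on \<Omega>"
  shows "ext \<epsilon> (cutoff \<Omega> (S' t (ext \<epsilon> f))) = S' t (ext \<epsilon> f)"
  using assms
  by (intro ext_cutoff) (simp_all add: semigroup_ext half_in_L2_on semigroup_in ext_in_L2_on mirror_ext)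

text \<open>Besides a formula this yields existence of the semigroup on the half domain, which is
  part of \<open>null_controllable\<close>.\<close>

lemma half_semigroup:
  "is_exp_semigroup (L2_on \<Omega>) (realization bc \<Omega> A V) (\<lambda>t f. cutoff \<Omega> (S' t (ext \<epsilon> f)))"
proof (rule is_exp_semigroup_transport[OF S'])
  show "(f, w) \<in> realization bc \<Omega> A V \<longleftrightarrow> (ext \<epsilon> f, ext \<epsilon> w) \<in> realization bc \<Omega>' A' V'"
    if "f \<in> L2_on \<Omega>" "w \<in> L2_on \<Omega>" for f w
    by (rule realization_ext_iff[OF that])
qed (use open_half in \<open>auto simp: closed_subspace_L2_on bounded_linear_ext bounded_linear_cutoff ext_in_L2_on half_in_L2_on
    ext_const_mult cutoff_in_L2_on cutoff_const_mult cutoff_ext ext_cutoff_semigroup dest: subsetD[OF realization_subset]\<close>)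

text \<open>The response of the half system to a restricted control is the restriction of the
  response of the full system.\<close>

lemma half_semigroup_rst:
  assumes t: "0 \<le> t" and g: "g \<in> L2_on \<Omega>'" and \<omega>: "\<omega> \<in> sets lebesgue" "\<omega> \<subseteq> \<Omega>"
  shows "cutoff \<Omega> (S' t (ext \<epsilon> (cutoff \<omega> (r *\<^sub>R rst \<epsilon> g)))) = r *\<^sub>R rst \<epsilon> (S' t (cutoff (\<omega> \<union> mirror k ` \<omega>) g))"
proof -
  let ?w = "\<omega> \<union> mirror k ` \<omega>"
  interpret C: bounded_linear "cutoff \<omega>" by (rule bounded_linear_cutoff[OF \<omega>(1)])
  interpret P: bounded_linear "cutoff \<Omega>" by (rule bounded_linear_cutoff) simp
  interpret E: bounded_linear "ext \<epsilon>" by (rule bounded_linear_ext)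
  have w: "?w \<in> sets lebesgue" using \<omega> by (auto intro: mirror_image_sets)
  have wg: "cutoff ?w g \<in> L2_on \<Omega>'"
    by (rule L2_on_mono[OF _ cutoff_in_L2_on[OF w]]) (use \<omega>(2) in \<open>auto simp: half mirror_mem\<close>)
  have "cutoff \<omega> (rst \<epsilon> g) = cutoff \<omega> (ext \<epsilon> g)"
    using \<omega>(2) by (simp add: rst_def cutoff_cutoff[OF \<omega>(1) sets(1)] Int_absorb2)
  then have "ext \<epsilon> (cutoff \<omega> (r *\<^sub>R rst \<epsilon> g)) = r *\<^sub>R ext \<epsilon> (cutoff ?w g)"
    by (simp add: C.scaleR E.scaleR ext_cutoff_ext[OF \<omega>])
  then show ?thesis
    by (simp add: semigroup_scaleR t ext_in_L2_on wg semigroup_ext P.scaleR rst_def)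
qed

end

text \<open>On \<Omega> the extension scales norms by exactly \<open>sqrt 2\<close>, and in general
  by at most 2. Comparing both along \<open>ext_cutoff_ext\<close> loses a factor
  \<open>sqrt 2\<close>, which the normalisation \<open>1 / sqrt 2\<close> compensates, so the cost
  bound has constant 1.\<close>

lemma norm_cutoff_rst_le:
  assumes \<omega>: "\<omega> \<in> sets lebesgue" "\<omega> \<subseteq> \<Omega>" and c: "c * c = 1"
  shows "norm (cutoff \<omega> ((1 / sqrt 2) *\<^sub>R rst c g)) \<le> norm (cutoff (\<omega> \<union> mirror k ` \<omega>) g)"
proof -
  let ?w = "\<omega> \<union> mirror k ` \<omega>"
  interpret C: bounded_linear "cutoff \<omega>" by (rule bounded_linear_cutoff[OF \<omega>(1)])
  have eq: "cutoff \<omega> (rst c g) = cutoff \<omega> (ext c g)"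
    using \<omega>(2) by (simp add: rst_def cutoff_cutoff[OF \<omega>(1) sets(1)] Int_absorb2)
  have in_X: "cutoff \<omega> (ext c g) \<in> L2_on \<Omega>" by (rule L2_on_mono[OF \<omega>(2) cutoff_in_L2_on[OF \<omega>(1)]])
  have "sqrt 2 * norm (cutoff \<omega> (ext c g)) = norm (ext c (cutoff ?w g))"
    using norm_ext[OF in_X c] by (simp add: ext_cutoff_ext[OF \<omega> c])
  also have "\<dots> \<le> 2 * norm (cutoff ?w g)" by (rule norm_ext_le[OF c])
  also have "\<dots> = sqrt 2 * (sqrt 2 * norm (cutoff ?w g))" by simp
  finally have "norm (cutoff \<omega> (ext c g)) \<le> sqrt 2 * norm (cutoff ?w g)"
    by (rule mult_left_le_imp_le) simp
  then show ?thesis by (simp add: C.scaleR eq pos_divide_le_eq mult.commute)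
qed

lemma steers_half:
  assumes S: "\<exists>S. is_exp_semigroup (L2_on \<Omega>') (realization bc \<Omega>' A' V') S"
    and \<omega>: "\<omega> \<in> sets lebesgue" "\<omega> \<subseteq> \<Omega>" and T: "T > 0" and u0: "u0 \<in> L2_on \<Omega>"
    and v: "v \<in> L2_time T (L2_on \<Omega>')"
    and steer: "steers_to_zero (L2_on \<Omega>') (realization bc \<Omega>' A' V') (\<omega> \<union> mirror k ` \<omega>) T
        ((1 / sqrt 2) *\<^sub>R ext (bc_sign bc) u0) v"
  shows "steers_to_zero (L2_on \<Omega>) (realization bc \<Omega> A V) \<omega> T u0 (\<lambda>s. (1 / sqrt 2) *\<^sub>R rst (bc_sign bc) (v s))"
proof -
  let ?S' = "exp_semigroup (L2_on \<Omega>') (realization bc \<Omega>' A' V')"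
  let ?S = "exp_semigroup (L2_on \<Omega>) (realization bc \<Omega> A V)"
  let ?w = "\<omega> \<union> mirror k ` \<omega>" and ?\<epsilon> = "bc_sign bc" and ?r = "1 / sqrt 2"
  have S': "is_exp_semigroup (L2_on \<Omega>') (realization bc \<Omega>' A' V') ?S'" by (rule exp_semigroup_is_exp[OF S])
  note half = half_semigroup[OF S']
  \<comment> \<open>The chosen semigroup on \<Omega> is identified with the explicit one by
    uniqueness, which is available for elements of \<open>L2_on \<Omega>\<close> and nonnegative
    times only.\<close>
  have S_eq: "?S t f = cutoff \<Omega> (?S' t (ext ?\<epsilon> f))" if "0 \<le> t" "f \<in> L2_on \<Omega>" for t f
    by (rule exp_semigroup_unique[OF sets(1) exp_semigroup_is_exp half that]) (use half in blast)
  define L where "L f = ?r *\<^sub>R rst ?\<epsilon> f" for f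
  have L: "bounded_linear L"
    unfolding L_def by (intro bounded_linear_const_scaleR bounded_linear_rst)
  interpret L: bounded_linear L by (rule L)
  obtain w where w: "has_bochner_integral (lebesgue_on {0<..<T}) (\<lambda>s. ?S' (T - s) (cutoff ?w (v s))) w"
      and w0: "?S' T (?r *\<^sub>R ext ?\<epsilon> u0) + w = 0"
    using steer by (auto simp: steers_to_zero_def)
  have "has_bochner_integral (lebesgue_on {0<..<T}) (\<lambda>s. L (?S' (T - s) (cutoff ?w (v s)))) (L w)"
    by (rule has_bochner_integral_bounded_linear[OF L w])
  moreover have "?S (T - s) (cutoff \<omega> (L (v s))) = L (?S' (T - s) (cutoff ?w (v s)))" if s: "s \<in> {0<..<T}" for s
  proof -
    have "v s \<in> L2_on \<Omega>'" using v s by (simp add: L2_time_def)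
    moreover have "cutoff \<omega> (L (v s)) \<in> L2_on \<Omega>" by (rule L2_on_mono[OF \<omega>(2) cutoff_in_L2_on[OF \<omega>(1)]])
    ultimately show ?thesis using s half_semigroup_rst[OF S' _ _ \<omega>, of "T - s" "v s" ?r] by (simp add: S_eq L_def)
  qed
  ultimately have "has_bochner_integral (lebesgue_on {0<..<T}) (\<lambda>s. ?S (T - s) (cutoff \<omega> (L (v s)))) (L w)"
    by (subst has_bochner_integral_cong[OF refl _ refl]) auto
  moreover have "?S T u0 + L w = 0"
  proof -
    have e: "ext ?\<epsilon> u0 \<in> L2_on \<Omega>'" by (intro ext_in_L2_on half_in_L2_on u0)
    \<comment> \<open>One factor \<open>1 / sqrt 2\<close> comes from the initial state and one from
      L. Their product 1/2 cancels the factor 2 of \<open>rst_ext\<close>.\<close>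
    have "L (?S' T (?r *\<^sub>R ext ?\<epsilon> u0)) = (?r * ?r) *\<^sub>R rst ?\<epsilon> (?S' T (ext ?\<epsilon> u0))"
      using T e by (simp add: semigroup_scaleR[OF S'] L_def linear_scale[OF bounded_linear.linear[OF bounded_linear_rst]])
    also have "rst ?\<epsilon> (?S' T (ext ?\<epsilon> u0)) = rst ?\<epsilon> (ext ?\<epsilon> (?S T u0))"
      using T u0 by (simp add: S_eq ext_cutoff_semigroup[OF S'])
    also have "\<dots> = 2 *\<^sub>R ?S T u0"
      using T u0 by (intro rst_ext) (simp_all add: S_eq cutoff_in_L2_on)
    finally have "L (?S' T (?r *\<^sub>R ext ?\<epsilon> u0)) = ?S T u0" by simp
    then show ?thesis using w0 by (metis L.add L.zero)
  qed
  ultimately show ?thesis unfolding steers_to_zero_def L_def by blast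
qed

end

section \<open>From ellipticity to bounded coefficients\<close>

lemma norm_axis: "norm (axis i x) = norm (x :: 'a::real_normed_vector)"
proof -
  have "(\<Sum>j\<in>UNIV. (norm (axis i x $ j))\<^sup>2) = (\<Sum>j\<in>UNIV. if j = i then (norm x)\<^sup>2 else 0)"
    by (intro sum.cong) (auto simp: axis_def)
  then show ?thesis by (simp add: norm_vec_def L2_set_def)
qed

lemma cvec_inner_cmat_vec_axis:
  "cvec_inner (cmat_vec B (axis j a)) (axis i b) = complex_of_real (B $ i $ j) * a * cnj b"
proof -
  have "cmat_vec B (axis j a) $ l = complex_of_real (B $ l $ j) * a" for l
  proof -
    have "cmat_vec B (axis j a) $ l = (\<Sum>m\<in>UNIV. if m = j then complex_of_real (B $ l $ m) * a else 0)"
      by (simp add: cmat_vec_def matrix_vector_mult_def map_matrix_def axis_def if_distrib cong: if_cong)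
    then show ?thesis by simp
  qed
  then have "cvec_inner (cmat_vec B (axis j a)) (axis i b) =
      (\<Sum>l\<in>UNIV. if l = i then complex_of_real (B $ l $ j) * a * cnj b else 0)"
    unfolding cvec_inner_def by (intro sum.cong) (auto simp: axis_def)
  then show ?thesis by simp
qed

text \<open>Polarisation: evaluating the quadratic form at the sum and the difference of two basis
  vectors gives values between 0 and \<open>4 * \<theta>\<^sub>2\<close>, and these differ by four
  times the entry. The crude norm bound 2 from the triangle inequality also covers i = j.\<close>

lemma elliptic_entry_bound:
  assumes sym: "transpose B = B" and "\<theta>\<^sub>1 > 0" and \<theta>: "\<theta>\<^sub>2 > 0"
    and ell: "\<forall>\<xi>. complex_of_real (\<theta>\<^sub>1 * (norm \<xi>)\<^sup>2) \<le> cvec_inner (cmat_vec B \<xi>) \<xi> \<and>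
           cvec_inner (cmat_vec B \<xi>) \<xi> \<le> complex_of_real (\<theta>\<^sub>2 * (norm \<xi>)\<^sup>2)"
  shows "\<bar>B $ i $ j\<bar> \<le> \<theta>\<^sub>2"
proof -
  have add: "cvec_inner (x + y) z = cvec_inner x z + cvec_inner y z" "cvec_inner z (x + y) = cvec_inner z x + cvec_inner z y"
    "cmat_vec B (x + y) = cmat_vec B x + cmat_vec B y" for x y z
    by (simp_all add: cvec_inner_def cmat_vec_def algebra_simps sum.distrib matrix_vector_right_distrib)
  have q: "0 \<le> B $ i $ i + B $ j $ j + 2 * c * B $ i $ j \<and> B $ i $ i + B $ j $ j + 2 * c * B $ i $ j \<le> 4 * \<theta>\<^sub>2"
    if c: "c = 1 \<or> c = -1" for c
  proof -
    define \<xi> where "\<xi> = axis i 1 + axis j (complex_of_real c)"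
    have "B $ j $ i = B $ i $ j" using sym by (metis transpose_def vec_lambda_beta)
    then have eq: "cvec_inner (cmat_vec B \<xi>) \<xi> = complex_of_real (B $ i $ i + B $ j $ j + 2 * c * B $ i $ j)"
      using c by (auto simp: \<xi>_def add cvec_inner_cmat_vec_axis)
    have "norm \<xi> \<le> norm (axis i (1::complex)) + norm (axis j (complex_of_real c))" unfolding \<xi>_def by (rule norm_triangle_ineq)
    also have "\<dots> = 2" using c by (auto simp: norm_axis)
    finally have "(norm \<xi>)\<^sup>2 \<le> 2\<^sup>2" by (intro power_mono) auto
    then have "\<theta>\<^sub>2 * (norm \<xi>)\<^sup>2 \<le> 4 * \<theta>\<^sub>2" using \<theta> by simp
    moreover have "0 \<le> \<theta>\<^sub>1 * (norm \<xi>)\<^sup>2" using assms(2) by simp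
    ultimately show ?thesis using ell[rule_format, of \<xi>] unfolding eq by (auto simp: less_eq_complex_def)
  qed
  show ?thesis using q[of 1] q[of "-1"] by (auto simp: abs_le_iff)
qed

theorem theorem1p1:
  fixes k :: "'n::finite"
    and \<Omega> \<Omega>' \<omega> \<omega>' :: "(real ^ 'n) set"
    and A A' :: "real ^ 'n \<Rightarrow> real ^ 'n ^ 'n"
    and V V' :: "real ^ 'n \<Rightarrow> real"
    and \<theta>\<^sub>1 \<theta>\<^sub>2 T :: real
    and bc :: boundary_condition
  assumes "open \<Omega>'"
    and "mirror k ` \<Omega>' = \<Omega>'"
    and "\<Omega>' \<inter> {x. x $ k = 0} \<noteq> {}"
    and "\<Omega> = \<Omega>' \<inter> {x. x $ k > 0}"
    and "A \<in> borel_measurable (lebesgue_on \<Omega>)"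
    and "AE x in lebesgue_on \<Omega>. transpose (A x) = A x"
    and "\<theta>\<^sub>1 > 0" and "\<theta>\<^sub>2 > 0"
    and "AE x in lebesgue_on \<Omega>. \<forall>\<xi>.
           complex_of_real (\<theta>\<^sub>1 * (norm \<xi>)\<^sup>2) \<le> cvec_inner (cmat_vec (A x) \<xi>) \<xi> \<and>
           cvec_inner (cmat_vec (A x) \<xi>) \<xi> \<le> complex_of_real (\<theta>\<^sub>2 * (norm \<xi>)\<^sup>2)"
    and "V \<in> borel_measurable (lebesgue_on \<Omega>)"
    and "\<exists>C. AE x in lebesgue_on \<Omega>. \<bar>V x\<bar> \<le> C"
    and "A' \<in> borel_measurable (lebesgue_on \<Omega>')"
    and "V' \<in> borel_measurable (lebesgue_on \<Omega>')"
    and "\<And>x. x \<in> \<Omega> \<Longrightarrow> A' x = A x \<and> V' x = V x"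
    and "\<And>x. x \<in> mirror k ` \<Omega> \<Longrightarrow>
           A' x = mirror_matrix k ** A (mirror k x) ** mirror_matrix k \<and> V' x = V (mirror k x)"
    and "\<omega> \<in> sets lebesgue" and "\<omega> \<subseteq> \<Omega>"
    and "\<omega>' = \<omega> \<union> mirror k ` \<omega>"
    and "T > 0"
    and "null_controllable (L2_on \<Omega>') (realization bc \<Omega>' A' V') \<omega>' T"
  shows "null_controllable (L2_on \<Omega>) (realization bc \<Omega> A V) \<omega> T \<and>
    control_cost (L2_on \<Omega>) (realization bc \<Omega> A V) \<omega> T
      \<le> control_cost (L2_on \<Omega>') (realization bc \<Omega>' A' V') \<omega>' T"
proof -
  interpret mirror_form k \<Omega> \<Omega>' A A' V V'
  proof
    fix i j
    have "(\<lambda>M :: real ^ 'n ^ 'n. M $ i $ j) \<in> borel_measurable borel"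
      by (intro borel_measurable_continuous_onI continuous_intros)
    then have "(\<lambda>x. A x $ i $ j) \<in> borel_measurable (lebesgue_on \<Omega>)"
      using assms(5) by (rule measurable_compose[rotated])
    moreover have "AE x in lebesgue_on \<Omega>. \<bar>A x $ i $ j\<bar> \<le> \<theta>\<^sub>2"
      using assms(6,9) by eventually_elim (rule elliptic_entry_bound[OF _ assms(7,8)])
    ultimately show "bounded_coeff \<Omega> (\<lambda>x. A x $ i $ j)" by (auto simp: bounded_coeff_def)
  qed (use assms in \<open>auto simp: bounded_coeff_def\<close>)
  let ?X = "L2_on \<Omega>" and ?X' = "L2_on \<Omega>'" and ?H = "realization bc \<Omega> A V" and ?H' = "realization bc \<Omega>' A' V'"
  let ?L = "\<lambda>f. (1 / sqrt 2) *\<^sub>R rst (bc_sign bc) f" and ?u = "\<lambda>u0. (1 / sqrt 2) *\<^sub>R ext (bc_sign bc) u0"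
  let ?cost = "\<lambda>\<omega> v. ennreal (sqrt (LINT s|lebesgue_on {0<..<T}. (norm (cutoff \<omega> (v s)))\<^sup>2))"
  have nc: "\<exists>S. is_exp_semigroup ?X' ?H' S" "\<And>u0. u0 \<in> ?X' \<Longrightarrow> \<exists>v\<in>L2_time T ?X'. steers_to_zero ?X' ?H' \<omega>' T u0 v"
    using assms(20) by (auto simp: null_controllable_def)
  have L: "bounded_linear ?L" by (intro bounded_linear_const_scaleR bounded_linear_rst)
  have u: "?u u0 \<in> ?X'" if "u0 \<in> ?X" for u0
    using that by (intro subspace_scale closed_subspace_L2_on ext_in_L2_on half_in_L2_on) auto
  have Lv: "(\<lambda>s. ?L (v s)) \<in> L2_time T ?X" if "v \<in> L2_time T ?X'" for v
    by (rule L2_time_bounded_linear[OF L that]) (intro subspace_scale closed_subspace_L2_on rst_in_L2_on, simp)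
  have steer: "steers_to_zero ?X ?H \<omega> T u0 (\<lambda>s. ?L (v s))"
    if "u0 \<in> ?X" "v \<in> L2_time T ?X'" "steers_to_zero ?X' ?H' \<omega>' T (?u u0) v" for u0 v
    using steers_half[OF nc(1) assms(16,17,19) that(1,2)] that(3) assms(18) by simp
  have null: "null_controllable ?X ?H \<omega> T"
    unfolding null_controllable_def
  proof (intro conjI ballI)
    show "\<exists>S. is_exp_semigroup ?X ?H S" using half_semigroup nc(1) by blast
    fix u0 assume u0: "u0 \<in> ?X"
    obtain v where v: "v \<in> L2_time T ?X'" "steers_to_zero ?X' ?H' \<omega>' T (?u u0) v" using nc(2)[OF u[OF u0]] by blast
    show "\<exists>v\<in>L2_time T ?X. steers_to_zero ?X ?H \<omega> T u0 v" using Lv[OF v(1)] steer[OF u0 v] by blast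
  qed
  have \<omega>': "\<omega>' \<in> sets lebesgue" using assms(16,18) by (auto intro: mirror_image_sets)
  have cost: "?cost \<omega> (\<lambda>s. ?L (v s)) \<le> ?cost \<omega>' v" if v: "v \<in> L2_time T ?X'" for v
  proof -
    have "integrable (lebesgue_on {0<..<T}) (\<lambda>s. (norm (cutoff \<omega> (?L (v s))))\<^sup>2)"
      using L2_time_bounded_linear[OF bounded_linear_cutoff[OF assms(16)] Lv[OF v], of UNIV] by (simp add: L2_time_def)
    moreover have "integrable (lebesgue_on {0<..<T}) (\<lambda>s. (norm (cutoff \<omega>' (v s)))\<^sup>2)"
      using L2_time_bounded_linear[OF bounded_linear_cutoff[OF \<omega>'] v, of UNIV] by (simp add: L2_time_def)
    ultimately have "(LINT s|lebesgue_on {0<..<T}. (norm (cutoff \<omega> (?L (v s))))\<^sup>2) \<le>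
        (LINT s|lebesgue_on {0<..<T}. (norm (cutoff \<omega>' (v s)))\<^sup>2)"
      using norm_cutoff_rst_le[OF assms(16,17) bc_sign_square] assms(18)
      by (intro integral_mono power_mono) auto
    then show ?thesis by (intro ennreal_leI real_sqrt_le_mono)
  qed
  have "control_cost ?X ?H \<omega> T \<le> control_cost ?X' ?H' \<omega>' T"
    unfolding control_cost_def
  proof (rule SUP_least)
    fix u0 assume "u0 \<in> {u0 \<in> ?X. norm u0 = 1}"
    then have u0: "u0 \<in> ?X" "norm u0 = 1" by auto
    have "norm (ext (bc_sign bc) u0) = sqrt 2" using norm_ext[OF u0(1), of "bc_sign bc"] u0(2) by simp
    then have "norm (?u u0) = 1" by (simp only: norm_scaleR) simp
    then have mem: "?u u0 \<in> {u0 \<in> ?X'. norm u0 = 1}" using u[OF u0(1)] by blast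
    \<comment> \<open>Each control of the full system started at the normalised extension yields an
      admissible control of the half system at no larger cost, so the infima are ordered. The
      normalised extension has norm 1 and takes part in the supremum on the right.\<close>
    have "(INF v\<in>{v \<in> L2_time T ?X. steers_to_zero ?X ?H \<omega> T u0 v}. ?cost \<omega> v) \<le>
        (INF v\<in>{v \<in> L2_time T ?X'. steers_to_zero ?X' ?H' \<omega>' T (?u u0) v}. ?cost \<omega>' v)"
    proof (rule INF_greatest)
      fix v assume "v \<in> {v \<in> L2_time T ?X'. steers_to_zero ?X' ?H' \<omega>' T (?u u0) v}"
      then have v: "v \<in> L2_time T ?X'" "steers_to_zero ?X' ?H' \<omega>' T (?u u0) v" by auto
      show "(INF v\<in>{v \<in> L2_time T ?X. steers_to_zero ?X ?H \<omega> T u0 v}. ?cost \<omega> v) \<le> ?cost \<omega>' v"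
        using Lv[OF v(1)] steer[OF u0(1) v] cost[OF v(1)]
        by (intro INF_lower2[where i = "\<lambda>s. ?L (v s)"]) auto
    qed
    also have "\<dots> \<le> (SUP u0\<in>{u0 \<in> ?X'. norm u0 = 1}. INF v\<in>{v \<in> L2_time T ?X'. steers_to_zero ?X' ?H' \<omega>' T u0 v}. ?cost \<omega>' v)"
      by (rule SUP_upper[OF mem])
    finally show "(INF v\<in>{v \<in> L2_time T ?X. steers_to_zero ?X ?H \<omega> T u0 v}. ?cost \<omega> v) \<le>
        (SUP u0\<in>{u0 \<in> ?X'. norm u0 = 1}. INF v\<in>{v \<in> L2_time T ?X'. steers_to_zero ?X' ?H' \<omega>' T u0 v}. ?cost \<omega>' v)" .
  qed
  with null show ?thesis by simp
qed

end
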